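(* Let $K_1,K_2$ be fields, at least one of which is infinite, and let $X,Y$ be non-empty sets. Then $\mathbb{A}_{K_1}(X)\equiv \mathbb{A}_{K_2}(Y)$ (elementary equivalence in the language of rings) if and only if both of the following hold: (1) either $X$ and $Y$ are finite with $|X|=|Y|$, or both $X$ and $Y$ are infinite; (2) $HF(K_1)\equiv HF(K_2)$.
   Context: $\mathbb{A}_K(Z)$ denotes the free associative unitary algebra over the field $K$ with free basis $Z$, in the language $\{+,\cdot,0,1\}$. For a set $A$, let $Pf(A)$ be the set of finite subsets of $A$; put $HF_0(A)=A$, $HF_{n+1}(A)=HF_n(A)\cup Pf(HF_n(A))$, $HF(A)=\bigcup_n HF_n(A)$ (hereditarily finite sets over $A$). For a field $K$, $HF(K)$ is the two-sorted structure $\langle K, HF(K); \in\rangle$ whose first sort is the field $K$ with its field structure, whose second sort is $HF(K)$, and $\in$ is the membership relation on $K\cup HF(K)$. $HF(K_1)\equiv HF(K_2)$ means these structures are elementarily equivalent (i.e. $K_1$ and $K_2$ are equivalent in weak second-order logic). *)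

theory Defs
  imports "HOL-Library.Poly_Mapping" "HOL-Library.FSet"
begin

section \<open>Free associative unitary algebras\<close>

text \<open>
  The free monoid, written additively: polynomial mappings \<open>'m \<Rightarrow>\<^sub>0 'k\<close> use the addition of
  \<open>'m\<close> (not assumed commutative) to multiply monomials.  The wrapper keeps the instance away
  from the type of lists itself.
\<close>

datatype 'x fmonoid = FWord (letters: "'x list")

instantiation fmonoid :: (type) monoid_add
begin

definition zero_fmonoid :: "'x fmonoid" where
  "zero_fmonoid = FWord []"

definition plus_fmonoid :: "'x fmonoid \<Rightarrow> 'x fmonoid \<Rightarrow> 'x fmonoid" where
  "plus_fmonoid u v = FWord (letters u @ letters v)"

instance
  by intro_classes (simp_all add: zero_fmonoid_def plus_fmonoid_def)

end

type_synonym ('x, 'k) ncpoly = "'x fmonoid \<Rightarrow>\<^sub>0 'k"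

text \<open>
  Noncommutative polynomials over the field \<open>'k\<close> in the letters from \<open>X\<close>, with the ring
  operations of the type \<open>('x, 'k) ncpoly\<close>.
\<close>

definition free_algebra :: "'x set \<Rightarrow> ('x, 'k::field) ncpoly set" where
  "free_algebra X = {p. \<forall>w \<in> Poly_Mapping.keys p. set (letters w) \<subseteq> X}"

lemma zero_in_free_algebra: "0 \<in> free_algebra X"
  by (simp add: free_algebra_def)

lemma one_in_free_algebra: "1 \<in> free_algebra X"
proof -
  have "Poly_Mapping.keys (1 :: ('a, 'b::field) ncpoly) = {0}"
    by simp
  then show ?thesis
    by (simp add: free_algebra_def zero_fmonoid_def)
qed

lemma add_in_free_algebra:
  "p \<in> free_algebra X \<Longrightarrow> q \<in> free_algebra X \<Longrightarrow> p + q \<in> free_algebra X"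
  unfolding free_algebra_def using Poly_Mapping.keys_add[of p q] by blast

lemma mult_in_free_algebra:
  "p \<in> free_algebra X \<Longrightarrow> q \<in> free_algebra X \<Longrightarrow> p * q \<in> free_algebra X"
  using Poly_Mapping.keys_mult[of p q]
  by (fastforce simp: free_algebra_def plus_fmonoid_def)

lemma uminus_in_free_algebra: "p \<in> free_algebra X \<Longrightarrow> - p \<in> free_algebra X"
  by (simp add: free_algebra_def in_keys_iff)


section \<open>First-order logic in the language of rings\<close>

datatype ring_term =
    RVar nat
  | RZero
  | ROne
  | RAdd ring_term ring_term
  | RMul ring_term ring_term

primrec ring_term_vars :: "ring_term \<Rightarrow> nat set" where
  "ring_term_vars (RVar n) = {n}"
| "ring_term_vars RZero = {}"
| "ring_term_vars ROne = {}"
| "ring_term_vars (RAdd s t) = ring_term_vars s \<union> ring_term_vars t"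
| "ring_term_vars (RMul s t) = ring_term_vars s \<union> ring_term_vars t"

primrec ring_term_val :: "(nat \<Rightarrow> 'a::ring_1) \<Rightarrow> ring_term \<Rightarrow> 'a" where
  "ring_term_val e (RVar n) = e n"
| "ring_term_val e RZero = 0"
| "ring_term_val e ROne = 1"
| "ring_term_val e (RAdd s t) = ring_term_val e s + ring_term_val e t"
| "ring_term_val e (RMul s t) = ring_term_val e s * ring_term_val e t"

datatype ring_fm =
    REq ring_term ring_term
  | RNeg ring_fm
  | RConj ring_fm ring_fm
  | RAll nat ring_fm

primrec ring_fm_vars :: "ring_fm \<Rightarrow> nat set" where
  "ring_fm_vars (REq s t) = ring_term_vars s \<union> ring_term_vars t"
| "ring_fm_vars (RNeg \<phi>) = ring_fm_vars \<phi>"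
| "ring_fm_vars (RConj \<phi> \<psi>) = ring_fm_vars \<phi> \<union> ring_fm_vars \<psi>"
| "ring_fm_vars (RAll n \<phi>) = ring_fm_vars \<phi> - {n}"

primrec ring_sat :: "'a::ring_1 set \<Rightarrow> (nat \<Rightarrow> 'a) \<Rightarrow> ring_fm \<Rightarrow> bool" where
  "ring_sat D e (REq s t) \<longleftrightarrow> ring_term_val e s = ring_term_val e t"
| "ring_sat D e (RNeg \<phi>) \<longleftrightarrow> \<not> ring_sat D e \<phi>"
| "ring_sat D e (RConj \<phi> \<psi>) \<longleftrightarrow> ring_sat D e \<phi> \<and> ring_sat D e \<psi>"
| "ring_sat D e (RAll n \<phi>) \<longleftrightarrow> (\<forall>a\<in>D. ring_sat D (e(n := a)) \<phi>)"

definition ring_models :: "'a::ring_1 set \<Rightarrow> ring_fm \<Rightarrow> bool" where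
  "ring_models D \<phi> \<longleftrightarrow> (\<forall>e. range e \<subseteq> D \<longrightarrow> ring_sat D e \<phi>)"

definition ring_elem_equiv :: "'a::ring_1 set \<Rightarrow> 'b::ring_1 set \<Rightarrow> bool" where
  "ring_elem_equiv D E \<longleftrightarrow>
     (\<forall>\<phi>. ring_fm_vars \<phi> = {} \<longrightarrow> ring_models D \<phi> = ring_models E \<phi>)"


section \<open>Hereditarily finite sets with urelements\<close>

datatype 'a hf = Atom 'a | HSet "'a hf fset"

primrec HF_level :: "'a set \<Rightarrow> nat \<Rightarrow> 'a hf set" where
  "HF_level A 0 = Atom ` A"
| "HF_level A (Suc n) = HF_level A n \<union> HSet ` {F. fset F \<subseteq> HF_level A n}"

definition HF :: "'a set \<Rightarrow> 'a hf set" where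
  "HF A = (\<Union>n. HF_level A n)"

fun hf_mem :: "'a hf \<Rightarrow> 'a hf \<Rightarrow> bool" where
  "hf_mem x (Atom a) \<longleftrightarrow> False"
| "hf_mem x (HSet F) \<longleftrightarrow> x |\<in>| F"

lemma HF_level_mono: "m \<le> n \<Longrightarrow> HF_level A m \<subseteq> HF_level A n"
  by (induction n rule: dec_induct) auto

lemma HF_UNIV: "HF UNIV = UNIV"
proof -
  have "\<exists>n. x \<in> HF_level UNIV n" for x :: "'a hf"
  proof (induction x)
    case (Atom a)
    have "Atom a \<in> HF_level UNIV 0" by simp
    then show ?case by blast
  next
    case (HSet F)
    then obtain f where f: "\<And>y. y \<in> fset F \<Longrightarrow> y \<in> HF_level UNIV (f y)"
      by metis
    define N where "N = Max (f ` fset F)"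
    have "fset F \<subseteq> HF_level UNIV N"
    proof
      fix y assume y: "y \<in> fset F"
      then have "f y \<le> N" by (simp add: N_def)
      then show "y \<in> HF_level UNIV N" using f[OF y] HF_level_mono by blast
    qed
    then have "HSet F \<in> HF_level UNIV (Suc N)" by simp
    then show ?case by blast
  qed
  then show ?thesis by (auto simp: HF_def)
qed


section \<open>First-order logic of the two-sorted structure of a field and its hereditarily finite sets\<close>

text \<open>
  Variables of the field sort and of the set sort are numbered independently; a field term used
  as an argument of membership denotes the corresponding atom, since membership is a relation on
  the union of the two sorts and the elements of the field belong to the second sort.
\<close>

datatype hf_obj = FieldObj ring_term | SetObj nat

datatype hf_fm =
    HFieldEq ring_term ring_term
  | HSetEq nat nat
  | HMem hf_obj hf_obj
  | HNeg hf_fm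
  | HConj hf_fm hf_fm
  | HAllField nat hf_fm
  | HAllSet nat hf_fm

primrec hf_obj_field_vars :: "hf_obj \<Rightarrow> nat set" where
  "hf_obj_field_vars (FieldObj t) = ring_term_vars t"
| "hf_obj_field_vars (SetObj n) = {}"

primrec hf_obj_set_vars :: "hf_obj \<Rightarrow> nat set" where
  "hf_obj_set_vars (FieldObj t) = {}"
| "hf_obj_set_vars (SetObj n) = {n}"

primrec hf_fm_field_vars :: "hf_fm \<Rightarrow> nat set" where
  "hf_fm_field_vars (HFieldEq s t) = ring_term_vars s \<union> ring_term_vars t"
| "hf_fm_field_vars (HSetEq m n) = {}"
| "hf_fm_field_vars (HMem x y) = hf_obj_field_vars x \<union> hf_obj_field_vars y"
| "hf_fm_field_vars (HNeg \<phi>) = hf_fm_field_vars \<phi>"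
| "hf_fm_field_vars (HConj \<phi> \<psi>) = hf_fm_field_vars \<phi> \<union> hf_fm_field_vars \<psi>"
| "hf_fm_field_vars (HAllField n \<phi>) = hf_fm_field_vars \<phi> - {n}"
| "hf_fm_field_vars (HAllSet n \<phi>) = hf_fm_field_vars \<phi>"

primrec hf_fm_set_vars :: "hf_fm \<Rightarrow> nat set" where
  "hf_fm_set_vars (HFieldEq s t) = {}"
| "hf_fm_set_vars (HSetEq m n) = {m, n}"
| "hf_fm_set_vars (HMem x y) = hf_obj_set_vars x \<union> hf_obj_set_vars y"
| "hf_fm_set_vars (HNeg \<phi>) = hf_fm_set_vars \<phi>"
| "hf_fm_set_vars (HConj \<phi> \<psi>) = hf_fm_set_vars \<phi> \<union> hf_fm_set_vars \<psi>"
| "hf_fm_set_vars (HAllField n \<phi>) = hf_fm_set_vars \<phi>"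
| "hf_fm_set_vars (HAllSet n \<phi>) = hf_fm_set_vars \<phi> - {n}"

primrec hf_obj_val :: "(nat \<Rightarrow> 'k::field) \<Rightarrow> (nat \<Rightarrow> 'k hf) \<Rightarrow> hf_obj \<Rightarrow> 'k hf" where
  "hf_obj_val e s (FieldObj t) = Atom (ring_term_val e t)"
| "hf_obj_val e s (SetObj n) = s n"

primrec hf_sat :: "(nat \<Rightarrow> 'k::field) \<Rightarrow> (nat \<Rightarrow> 'k hf) \<Rightarrow> hf_fm \<Rightarrow> bool" where
  "hf_sat e s (HFieldEq t u) \<longleftrightarrow> ring_term_val e t = ring_term_val e u"
| "hf_sat e s (HSetEq m n) \<longleftrightarrow> s m = s n"
| "hf_sat e s (HMem x y) \<longleftrightarrow> hf_mem (hf_obj_val e s x) (hf_obj_val e s y)"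
| "hf_sat e s (HNeg \<phi>) \<longleftrightarrow> \<not> hf_sat e s \<phi>"
| "hf_sat e s (HConj \<phi> \<psi>) \<longleftrightarrow> hf_sat e s \<phi> \<and> hf_sat e s \<psi>"
| "hf_sat e s (HAllField n \<phi>) \<longleftrightarrow> (\<forall>a. hf_sat (e(n := a)) s \<phi>)"
| "hf_sat e s (HAllSet n \<phi>) \<longleftrightarrow> (\<forall>S \<in> HF UNIV. hf_sat e (s(n := S)) \<phi>)"

definition hf_models :: "'k::field itself \<Rightarrow> hf_fm \<Rightarrow> bool" where
  "hf_models K \<phi> \<longleftrightarrow>
     (\<forall>(e :: nat \<Rightarrow> 'k) (s :: nat \<Rightarrow> 'k hf). range s \<subseteq> HF UNIV \<longrightarrow> hf_sat e s \<phi>)"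

definition hf_elem_equiv :: "'k1::field itself \<Rightarrow> 'k2::field itself \<Rightarrow> bool" where
  "hf_elem_equiv K1 K2 \<longleftrightarrow>
     (\<forall>\<phi>. hf_fm_field_vars \<phi> = {} \<and> hf_fm_set_vars \<phi> = {} \<longrightarrow>
          hf_models K1 \<phi> = hf_models K2 \<phi>)"

end

theory Submission
  imports Defs HOL.Vector_Spaces "HOL-Library.Function_Algebras"
begin

text \<open>
  For \<open>t\<close> outside the scalars, a non-zero element \<open>q\<close> is divisible on the left by \<open>t - a\<close> for finitely
  many scalars \<open>a\<close> only, and every finite set of scalars occurs; as the scalars are the units and zero,
  quantification over finite relations on the field can be expressed in the free algebra.  A hereditarily
  finite set is coded by a node of a finite graph on the field, well-foundedness and equality (as
  bisimilarity) of codes being expressible by quantifying over finite relations.  Conversely, the elements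
  of the free algebra over a definable set of letters are values of terms, which are hereditarily finite
  sets, and the coefficients of the value of a term are computed by finite derivations.  The rank is the least \<open>n\<close>
  such that \<open>n\<close> elements generate a proper right ideal that is complementary to the scalars;
  derivations at a character give the lower bound.
\<close>

subsection \<open>Coefficients and degree\<close>

text \<open>The elements \<open>t - a\<close> and \<open>t - a'\<close> commute and differ by a
  scalar that is non-zero for \<open>a \<noteq> a'\<close>, so divisibility by them behaves as in a
  polynomial ring in \<open>t\<close> although the algebra is not commutative; finiteness of the set
  of roots and interpolation come from this. Interpolation uses up new scalars, and the nodes of
  graphs are named by field elements, so the coding requires both fields to be infinite; one is
  assumed to be, and a sentence transfers this to the other. The two structures have different
  element types, and what is compared is one sentence evaluated in both. Definability is therefore a
  property of a pair of predicates, one per structure, with a common formula, and most formulas are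
  never written out. Infinite sets of letters may differ in cardinality, which excludes an
  isomorphism even over one field; a back-and-forth argument with finitely many letters at a time
  shows that only the rank matters. This gives the freedom to take hereditarily finite sets as
  letters, namely numerals or all sets, which one formula defines over both fields.\<close>

abbreviation cst :: "'k \<Rightarrow> ('x, 'k::field) ncpoly" where
  "cst a \<equiv> Poly_Mapping.single 0 a"

abbreviation coeff :: "('x, 'k::field) ncpoly \<Rightarrow> 'x list \<Rightarrow> 'k" where
  "coeff p w \<equiv> Poly_Mapping.lookup p (FWord w)"

abbreviation var :: "'x \<Rightarrow> ('x, 'k::field) ncpoly" where
  "var x \<equiv> Poly_Mapping.single (FWord [x]) 1"

lemma ncpoly_eqI:
  assumes "\<And>w. coeff p w = coeff q w" shows "p = q"
  by (rule poly_mapping_eqI) (metis assms fmonoid.exhaust)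

lemma plus_FWord [simp]: "FWord u + FWord v = FWord (u @ v)"
  by (simp add: plus_fmonoid_def)

lemma zero_eq_FWord_iff [simp]: "0 = FWord w \<longleftrightarrow> w = []" "FWord w = 0 \<longleftrightarrow> w = []"
  by (auto simp: zero_fmonoid_def)

lemma coeff_single [simp]: "coeff (Poly_Mapping.single (FWord u) a) w = (if u = w then a else 0)"
  by (simp add: lookup_single when_def)

lemma coeff_cst [simp]: "coeff (cst a) w = (if w = [] then a else 0)"
  by (simp add: lookup_single when_def)

lemma coeff_one [simp]: "coeff 1 w = (if w = [] then 1 else 0)"
  by (simp add: lookup_one when_def)

lemma ncpoly_expand:
  "p = (\<Sum>w\<in>Poly_Mapping.keys p. Poly_Mapping.single w (Poly_Mapping.lookup p w))"
  by (rule poly_mapping_eqI)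
    (simp add: lookup_sum lookup_single when_def sum.delta' in_keys_iff)

lemma free_algebra_induct [consumes 1, case_names zero single add]:
  assumes "p \<in> free_algebra X" and "P 0"
    and single: "\<And>w a. set w \<subseteq> X \<Longrightarrow> P (Poly_Mapping.single (FWord w) a)"
    and add: "\<And>p q. p \<in> free_algebra X \<Longrightarrow> q \<in> free_algebra X \<Longrightarrow> P p \<Longrightarrow> P q \<Longrightarrow> P (p + q)"
  shows "P p"
proof -
  let ?s = "\<lambda>W. \<Sum>w\<in>W. Poly_Mapping.single w (Poly_Mapping.lookup p w)"
  have "?s W \<in> free_algebra X \<and> P (?s W)" if "finite W" "W \<subseteq> Poly_Mapping.keys p" for W
    using that
  proof (induction W)
    case empty
    show ?case using assms(2) by (simp add: zero_in_free_algebra)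
  next
    case (insert w W)
    have *: "set (letters w) \<subseteq> X"
      using insert.prems assms(1) by (auto simp: free_algebra_def)
    then have "Poly_Mapping.single w (Poly_Mapping.lookup p w) \<in> free_algebra X"
      by (auto simp: free_algebra_def)
    moreover have "P (Poly_Mapping.single w (Poly_Mapping.lookup p w))"
      using single[OF *] by simp
    ultimately show ?case using insert by (simp add: add_in_free_algebra add)
  qed
  from this[of "Poly_Mapping.keys p"] show ?thesis
    using ncpoly_expand[of p] by simp
qed

lemma in_free_algebra_UNIV [simp]: "p \<in> free_algebra UNIV"
  by (simp add: free_algebra_def)

lemmas ncpoly_induct [case_names zero single add] =
  free_algebra_induct[OF in_free_algebra_UNIV, simplified]

text \<open>Both sides are bilinear, which leaves two monomials; there the only cut of
  \<open>w\<close> that can contribute is the one after the length of the left word.\<close>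

lemma coeff_mult:
  fixes p q :: "('x, 'k::field) ncpoly"
  shows "coeff (p * q) w = (\<Sum>i\<le>length w. coeff p (take i w) * coeff q (drop i w))"
proof (induction p rule: ncpoly_induct)
  case (single u a)
  show ?case
  proof (induction q rule: ncpoly_induct)
    case (single v b)
    have *: "u = take i w \<and> v = drop i w \<longleftrightarrow> i = length u \<and> u @ v = w" if "i \<le> length w" for i
      using that by (metis append_eq_conv_conj append_take_drop_id length_take min.absorb2)
    have "(if u = take i w then a else 0) * (if v = drop i w then b else 0)
      = (if i = length u then if u @ v = w then a * b else 0 else 0)" if "i \<le> length w" for i
      using *[OF that] by (simp only: if_distrib[where f = "\<lambda>x. x * _"] if_distrib[where f = "\<lambda>x. _ * x"]
        mult_zero_left mult_zero_right) presburger
    then have "(\<Sum>i\<le>length w. (if u = take i w then a else 0) * (if v = drop i w then b else 0))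
      = (\<Sum>i\<le>length w. if i = length u then if u @ v = w then a * b else 0 else 0)"
      by (intro sum.cong) auto
    also have "\<dots> = (if u @ v = w then a * b else 0)"
      by (simp only: sum.delta finite_atMost) auto
    finally show ?case by (simp add: mult_single)
  qed (simp_all add: algebra_simps lookup_add sum.distrib)
qed (simp_all add: algebra_simps lookup_add sum.distrib)

lemma coeff_mult_Nil [simp]: "coeff (p * q) [] = coeff p [] * coeff q []"
  by (simp add: coeff_mult)

lemma coeff_cst_mult [simp]: "coeff (cst a * p) w = a * coeff p w"
proof -
  have "coeff (cst a * p) w = (\<Sum>i\<le>length w. if i = 0 then a * coeff p w else 0)"
    unfolding coeff_mult by (rule sum.cong) (auto simp: coeff_cst take_eq_Nil)
  then show ?thesis by simp
qed

lemma coeff_mult_cst [simp]: "coeff (p * cst a) w = coeff p w * a"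
proof -
  have "coeff (p * cst a) w = (\<Sum>i\<le>length w. if i = length w then coeff p w * a else 0)"
    unfolding coeff_mult by (rule sum.cong) auto
  then show ?thesis by simp
qed

lemma cst_commute: "p * cst a = cst a * p"
  by (rule ncpoly_eqI) simp

lemma coeff_var_mult [simp]:
  "coeff (var x * p) [] = 0"
  "coeff (var x * p) (y # w) = (if x = y then coeff p w else 0)"
proof -
  have "coeff (var x * p) (y # w)
    = (\<Sum>i\<le>Suc (length w). if i = 1 then if x = y then coeff p w else 0 else 0)"
    unfolding coeff_mult length_Cons
  proof (rule sum.cong)
    show "coeff (var x) (take i (y # w)) * coeff p (drop i (y # w))
      = (if i = 1 then if x = y then coeff p w else 0 else 0)" if "i \<in> {..Suc (length w)}" for i
      using that by (cases i) (auto simp: take_Cons split: nat.splits)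
  qed simp
  then show "coeff (var x * p) (y # w) = (if x = y then coeff p w else 0)"
    by (simp only: sum.delta finite_atMost) auto
qed simp

lemma cst_in_free_algebra [simp]: "cst a \<in> free_algebra X"
  by (simp add: free_algebra_def zero_fmonoid_def)

lemma var_in_free_algebra: "x \<in> X \<Longrightarrow> var x \<in> free_algebra X"
  by (simp add: free_algebra_def)

lemma minus_in_free_algebra:
  "p \<in> free_algebra X \<Longrightarrow> q \<in> free_algebra X \<Longrightarrow> p - q \<in> free_algebra X"
  using add_in_free_algebra[OF _ uminus_in_free_algebra, of p X q] by simp

lemma sum_in_free_algebra:
  "(\<And>i. i \<in> I \<Longrightarrow> f i \<in> free_algebra X) \<Longrightarrow> sum f I \<in> free_algebra X"
  by (induction I rule: infinite_finite_induct) (simp_all add: zero_in_free_algebra add_in_free_algebra)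

lemmas free_algebra_closed =
  zero_in_free_algebra one_in_free_algebra add_in_free_algebra mult_in_free_algebra
  uminus_in_free_algebra minus_in_free_algebra cst_in_free_algebra var_in_free_algebra
  sum_in_free_algebra

lemma cst_add: "cst a + cst b = cst (a + b)"
  and cst_diff: "cst a - cst b = cst (a - b)"
  and cst_mult: "cst a * cst b = cst (a * b)"
  and cst_uminus: "- cst a = cst (- a)"
  by (simp_all add: single_add single_diff mult_single single_uminus)

lemma inj_cst: "inj (cst :: 'k \<Rightarrow> ('x, 'k::field) ncpoly)"
  by (simp add: inj_single)

lemma cst_inverse_mult: "a \<noteq> 0 \<Longrightarrow> cst (inverse a) * (cst a * p) = p"
  by (simp add: mult.assoc[symmetric] cst_mult)

text \<open>The inserted \<open>0\<close> gives the zero polynomial degree 0, so that degree 0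
  describes all scalars, zero included.\<close>

definition deg :: "('x, 'k::field) ncpoly \<Rightarrow> nat" where
  "deg p = Max (insert 0 ((length \<circ> letters) ` Poly_Mapping.keys p))"

lemma coeff_nonzero_le_deg: "coeff p w \<noteq> 0 \<Longrightarrow> length w \<le> deg p"
  unfolding deg_def by (rule Max_ge) (auto simp: in_keys_iff intro!: rev_image_eqI)

lemma deg_attained:
  assumes "p \<noteq> 0" obtains w where "coeff p w \<noteq> 0" and "length w = deg p"
proof -
  have "deg p \<in> insert 0 ((length \<circ> letters) ` Poly_Mapping.keys p)"
    unfolding deg_def by (rule Max_in) auto
  moreover obtain w where w: "coeff p w \<noteq> 0"
    using assms ncpoly_eqI[of p 0] by auto
  ultimately consider "deg p = 0" | v where "v \<in> Poly_Mapping.keys p" "deg p = length (letters v)"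
    by auto
  then show ?thesis
  proof cases
    case 1
    then show ?thesis using that[OF w] coeff_nonzero_le_deg[OF w] by simp
  next
    case 2
    then show ?thesis using that[of "letters v"] by (simp add: in_keys_iff)
  qed
qed

text \<open>Every cut of \<open>u @ v\<close> other than the one after \<open>u\<close> makes one of
  the parts longer than the degree of its factor; a single cut survives and nothing cancels in top
  degree.\<close>

lemma coeff_mult_top:
  assumes "length u = deg p" and "length v = deg q"
  shows "coeff (p * q) (u @ v) = coeff p u * coeff q v"
proof -
  have "coeff p (take i (u @ v)) * coeff q (drop i (u @ v)) = 0"
    if "i \<le> length (u @ v)" "i \<noteq> length u" for i
  proof (cases "i < length u")
    case True
    then have "coeff q (drop i (u @ v)) = 0"
      using coeff_nonzero_le_deg[of q "drop i (u @ v)"] assms by fastforce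
    then show ?thesis by simp
  next
    case False
    then have "coeff p (take i (u @ v)) = 0"
      using coeff_nonzero_le_deg[of p "take i (u @ v)"] assms that by fastforce
    then show ?thesis by simp
  qed
  then have "coeff (p * q) (u @ v)
    = (\<Sum>i\<le>length (u @ v). if i = length u then coeff p u * coeff q v else 0)"
    unfolding coeff_mult by (intro sum.cong) auto
  then show ?thesis by simp
qed

lemma deg_mult_ge:
  assumes "p \<noteq> 0" and "q \<noteq> 0"
  shows "p * q \<noteq> 0" and "deg p + deg q \<le> deg (p * q)"
proof -
  obtain u v where u: "coeff p u \<noteq> 0" "length u = deg p" and v: "coeff q v \<noteq> 0" "length v = deg q"
    using assms by (metis deg_attained)
  then have *: "coeff (p * q) (u @ v) \<noteq> 0" by (simp add: coeff_mult_top)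
  then show "p * q \<noteq> 0" by auto
  show "deg p + deg q \<le> deg (p * q)"
    using coeff_nonzero_le_deg[OF *] u v by simp
qed

lemma deg_zero_cst: "deg p = 0 \<longleftrightarrow> p \<in> range cst"
proof
  assume "deg p = 0"
  then have "p = cst (coeff p [])"
    using coeff_nonzero_le_deg[of p] by (intro ncpoly_eqI) fastforce
  then show "p \<in> range cst" by blast
next
  assume "p \<in> range cst"
  then obtain a where "p = cst a" by blast
  then show "deg p = 0" by (simp add: deg_def zero_fmonoid_def)
qed

text \<open>Degrees add up in products, so a right invertible element has degree 0. The inverse of a
  scalar is a scalar and lies over every set of letters, which is why \<open>p\<close> may lie
  outside \<open>free_algebra X\<close>. This is the first-order definition of the field.\<close>

lemma right_invertible_iff:
  fixes p :: "('x, 'k::field) ncpoly"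
  shows "(p = 0 \<or> (\<exists>u\<in>free_algebra X. p * u = 1)) \<longleftrightarrow> p \<in> range cst"
proof
  assume "p = 0 \<or> (\<exists>u\<in>free_algebra X. p * u = 1)"
  then consider "p = 0" | u where "p * u = 1" by blast
  then show "p \<in> range cst"
  proof cases
    case 1
    then show ?thesis using single_zero[of 0] by (metis (no_types) rangeI)
  next
    case 2
    then have "p \<noteq> 0" "u \<noteq> 0" by auto
    then have "deg p \<le> deg (p * u)" using deg_mult_ge(2)[of p u] by simp
    then show ?thesis using 2 deg_zero_cst[of p] deg_zero_cst[of "1 :: ('x, 'k) ncpoly"]
      by (metis le_zero_eq range_eqI single_one)
  qed
next
  assume "p \<in> range cst"
  then obtain a where a: "p = cst a" by blast
  show "p = 0 \<or> (\<exists>u\<in>free_algebra X. p * u = 1)"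
  proof (cases "a = 0")
    case False
    then have "p * cst (inverse a) = 1" by (simp add: a cst_mult)
    then show ?thesis using cst_in_free_algebra by blast
  qed (simp add: a)
qed

text \<open>A factorisation of a non-zero scalar would make \<open>t - cst a\<close> invertible,
  hence scalar, and \<open>t\<close> with it. Uniqueness of residues modulo \<open>t - cst a\<close>
  rests on this.\<close>

lemma not_cst_mult:
  fixes t :: "('x, 'k::field) ncpoly"
  assumes "t \<notin> range cst" and "c \<noteq> 0"
  shows "(t - cst a) * u \<noteq> cst c"
proof
  assume *: "(t - cst a) * u = cst c"
  have "t - cst a \<noteq> 0" using assms(1) by auto
  moreover have "(t - cst a) * (u * cst (inverse c)) = 1"
    using * assms(2) by (simp add: mult.assoc[symmetric] cst_mult)
  ultimately have "t - cst a \<in> range cst"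
    using right_invertible_iff[of "t - cst a" UNIV] by auto
  then obtain b where "t - cst a = cst b" by blast
  then have "t = cst (b + a)" by (metis add_diff_cancel diff_add_cancel cst_add)
  then show False using assms(1) by blast
qed

subsection \<open>Closed and open formulas\<close>

lemma finite_ring_term_vars: "finite (ring_term_vars t)"
  by (induction t) auto

lemma finite_ring_fm_vars: "finite (ring_fm_vars \<phi>)"
  by (induction \<phi>) (auto simp: finite_ring_term_vars)

lemma ring_models_RAll: "ring_models D (RAll n \<phi>) \<longleftrightarrow> ring_models D \<phi>"
proof
  assume *: "ring_models D (RAll n \<phi>)"
  show "ring_models D \<phi>"
    unfolding ring_models_def
  proof (intro allI impI)
    fix e :: "nat \<Rightarrow> 'a" assume e: "range e \<subseteq> D"
    with * have "\<forall>a\<in>D. ring_sat D (e(n := a)) \<phi>" by (simp add: ring_models_def)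
    moreover have "e n \<in> D" using e by auto
    ultimately show "ring_sat D e \<phi>" by (metis fun_upd_triv)
  qed
next
  assume "ring_models D \<phi>"
  then show "ring_models D (RAll n \<phi>)"
    by (auto simp: ring_models_def image_subset_iff)
qed

lemma ring_models_foldr_RAll: "ring_models D (foldr RAll ns \<phi>) \<longleftrightarrow> ring_models D \<phi>"
  by (induction ns) (simp_all add: ring_models_RAll)

text \<open>Validity ranges over all assignments into the structure, so passing to the universal
  closure changes nothing, and equivalence for sentences extends to formulas with free
  variables.\<close>

lemma ring_elem_equiv_models:
  assumes "ring_elem_equiv D E"
  shows "ring_models D \<phi> \<longleftrightarrow> ring_models E \<phi>"
proof -
  obtain ns where ns: "set ns = ring_fm_vars \<phi>"
    using finite_list[OF finite_ring_fm_vars] by blast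
  have "ring_fm_vars (foldr RAll ns \<phi>) = ring_fm_vars \<phi> - set ns" for ns
    by (induction ns) auto
  then have "ring_fm_vars (foldr RAll ns \<phi>) = {}" by (simp add: ns)
  then have "ring_models D (foldr RAll ns \<phi>) \<longleftrightarrow> ring_models E (foldr RAll ns \<phi>)"
    using assms by (simp add: ring_elem_equiv_def)
  then show ?thesis by (simp only: ring_models_foldr_RAll)
qed

lemma ring_elem_equivI:
  assumes "\<And>\<phi>. ring_fm_vars \<phi> = {} \<Longrightarrow> ring_models D \<phi> \<longleftrightarrow> ring_models E \<phi>"
  shows "ring_elem_equiv D E"
  using assms by (simp add: ring_elem_equiv_def)

definition RDisj :: "ring_fm \<Rightarrow> ring_fm \<Rightarrow> ring_fm" where
  "RDisj \<phi> \<psi> = RNeg (RConj (RNeg \<phi>) (RNeg \<psi>))"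

definition RImp :: "ring_fm \<Rightarrow> ring_fm \<Rightarrow> ring_fm" where
  "RImp \<phi> \<psi> = RNeg (RConj \<phi> (RNeg \<psi>))"

definition REx :: "nat \<Rightarrow> ring_fm \<Rightarrow> ring_fm" where
  "REx n \<phi> = RNeg (RAll n (RNeg \<phi>))"

lemma ring_sat_derived [simp]:
  "ring_sat D e (RDisj \<phi> \<psi>) \<longleftrightarrow> ring_sat D e \<phi> \<or> ring_sat D e \<psi>"
  "ring_sat D e (RImp \<phi> \<psi>) \<longleftrightarrow> (ring_sat D e \<phi> \<longrightarrow> ring_sat D e \<psi>)"
  "ring_sat D e (REx n \<phi>) \<longleftrightarrow> (\<exists>a\<in>D. ring_sat D (e(n := a)) \<phi>)"
  by (auto simp: RDisj_def RImp_def REx_def)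

lemma finite_hf_obj_vars: "finite (hf_obj_field_vars x)" "finite (hf_obj_set_vars x)"
  by (cases x; simp add: finite_ring_term_vars)+

lemma finite_hf_fm_vars: "finite (hf_fm_field_vars \<phi>)" "finite (hf_fm_set_vars \<phi>)"
  by (induction \<phi>) (auto simp: finite_ring_term_vars finite_hf_obj_vars)

lemma hf_sat_HAllSet [simp]:
  "hf_sat e s (HAllSet n \<phi>) \<longleftrightarrow> (\<forall>S. hf_sat e (s(n := S)) \<phi>)"
  by (simp add: HF_UNIV)

declare hf_sat.simps(7) [simp del]

lemma hf_models_iff:
  "hf_models TYPE('k::field) \<phi> \<longleftrightarrow> (\<forall>(e :: nat \<Rightarrow> 'k) s. hf_sat e s \<phi>)"
  by (simp add: hf_models_def HF_UNIV)

lemma hf_models_HAll: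
  "hf_models TYPE('k::field) (HAllField n \<phi>) \<longleftrightarrow> hf_models TYPE('k) \<phi>"
  "hf_models TYPE('k::field) (HAllSet n \<phi>) \<longleftrightarrow> hf_models TYPE('k) \<phi>"
  unfolding hf_models_iff by (auto, (metis fun_upd_triv)+)

lemma hf_models_foldr:
  "hf_models TYPE('k::field) (foldr HAllField ms (foldr HAllSet ns \<phi>)) \<longleftrightarrow> hf_models TYPE('k) \<phi>"
proof -
  have "hf_models TYPE('k) (foldr HAllField ms \<psi>) \<longleftrightarrow> hf_models TYPE('k) \<psi>" for \<psi>
    by (induction ms) (simp_all add: hf_models_HAll)
  moreover have "hf_models TYPE('k) (foldr HAllSet ns \<phi>) \<longleftrightarrow> hf_models TYPE('k) \<phi>"
    by (induction ns) (simp_all add: hf_models_HAll)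
  ultimately show ?thesis by simp
qed

lemma hf_elem_equiv_models:
  assumes "hf_elem_equiv TYPE('k1::field) TYPE('k2::field)"
  shows "hf_models TYPE('k1) \<phi> \<longleftrightarrow> hf_models TYPE('k2) \<phi>"
proof -
  obtain ms where ms: "set ms = hf_fm_field_vars \<phi>"
    using finite_list[OF finite_hf_fm_vars(1)] by blast
  obtain ns where ns: "set ns = hf_fm_set_vars \<phi>"
    using finite_list[OF finite_hf_fm_vars(2)] by blast
  let ?\<psi> = "foldr HAllField ms (foldr HAllSet ns \<phi>)"
  have "hf_fm_field_vars (foldr HAllSet ns \<phi>) = hf_fm_field_vars \<phi>"
    "hf_fm_set_vars (foldr HAllSet ns \<phi>) = hf_fm_set_vars \<phi> - set ns" for ns
    by (induction ns) auto
  moreover have "hf_fm_field_vars (foldr HAllField ms \<psi>) = hf_fm_field_vars \<psi> - set ms"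
    "hf_fm_set_vars (foldr HAllField ms \<psi>) = hf_fm_set_vars \<psi>" for ms \<psi>
    by (induction ms) auto
  ultimately have "hf_fm_field_vars ?\<psi> = {}" "hf_fm_set_vars ?\<psi> = {}"
    by (simp_all add: ms ns)
  then have "hf_models TYPE('k1) ?\<psi> \<longleftrightarrow> hf_models TYPE('k2) ?\<psi>"
    using assms by (simp add: hf_elem_equiv_def)
  then show ?thesis by (simp only: hf_models_foldr)
qed

definition HDisj :: "hf_fm \<Rightarrow> hf_fm \<Rightarrow> hf_fm" where
  "HDisj \<phi> \<psi> = HNeg (HConj (HNeg \<phi>) (HNeg \<psi>))"

definition HImp :: "hf_fm \<Rightarrow> hf_fm \<Rightarrow> hf_fm" where
  "HImp \<phi> \<psi> = HNeg (HConj \<phi> (HNeg \<psi>))"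

definition HIff :: "hf_fm \<Rightarrow> hf_fm \<Rightarrow> hf_fm" where
  "HIff \<phi> \<psi> = HConj (HImp \<phi> \<psi>) (HImp \<psi> \<phi>)"

definition HExField :: "nat \<Rightarrow> hf_fm \<Rightarrow> hf_fm" where
  "HExField n \<phi> = HNeg (HAllField n (HNeg \<phi>))"

definition HExSet :: "nat \<Rightarrow> hf_fm \<Rightarrow> hf_fm" where
  "HExSet n \<phi> = HNeg (HAllSet n (HNeg \<phi>))"

lemma hf_sat_derived [simp]:
  "hf_sat e s (HDisj \<phi> \<psi>) \<longleftrightarrow> hf_sat e s \<phi> \<or> hf_sat e s \<psi>"
  "hf_sat e s (HImp \<phi> \<psi>) \<longleftrightarrow> (hf_sat e s \<phi> \<longrightarrow> hf_sat e s \<psi>)"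
  "hf_sat e s (HIff \<phi> \<psi>) \<longleftrightarrow> (hf_sat e s \<phi> \<longleftrightarrow> hf_sat e s \<psi>)"
  "hf_sat e s (HExField n \<phi>) \<longleftrightarrow> (\<exists>a. hf_sat (e(n := a)) s \<phi>)"
  "hf_sat e s (HExSet n \<phi>) \<longleftrightarrow> (\<exists>S. hf_sat e (s(n := S)) \<phi>)"
  by (auto simp: HDisj_def HImp_def HIff_def HExField_def HExSet_def)

subsection \<open>The rank of a free algebra\<close>

text \<open>Right ideals are chosen because, for fixed \<open>n\<close>, an element of the ideal is
  a sum of \<open>n\<close> products and thus expressible by a formula; a two-sided ideal would
  involve sums of unbounded length.\<close>

definition Fin_codim :: "('x, 'k::field) ncpoly set \<Rightarrow> nat \<Rightarrow> bool" where
  "Fin_codim D n \<longleftrightarrow> (\<exists>a. range a \<subseteq> D \<and>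
     (\<nexists>b. range b \<subseteq> D \<and> 1 = (\<Sum>i<n. a i * b i)) \<and>
     (\<forall>p\<in>D. \<exists>c b. range b \<subseteq> D \<and> p = cst c + (\<Sum>i<n. a i * b i)))"

lemma coeff_var_mult_Nil: "coeff (\<Sum>i\<in>I. var (f i) * b i) [] = 0"
  by (induction I rule: infinite_finite_induct) (simp_all add: lookup_add)

text \<open>The letters generate the polynomials without constant term, since every non-empty word
  begins with a letter.\<close>

lemma Fin_codim_if_card:
  fixes X :: "'x set"
  assumes "finite X" and "card X \<le> n"
  shows "Fin_codim (free_algebra X :: ('x, 'k::field) ncpoly set) n"
proof -
  obtain f where f: "bij_betw f {..<card X} X"
    using assms(1) by (metis ex_bij_betw_nat_finite atLeast0LessThan)
  \<comment> \<open>Padding with zeros allows \<open>n\<close> to exceed the number of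
    letters.\<close>
  define a :: "nat \<Rightarrow> ('x, 'k) ncpoly" where "a i = (if i < card X then var (f i) else 0)" for i
  have a: "range a \<subseteq> free_algebra X"
    using f by (auto simp: a_def bij_betw_def intro!: free_algebra_closed)
  have sum_a: "(\<Sum>i<n. a i * b i) = (\<Sum>i<card X. var (f i) * b i)" for b
  proof -
    have "(\<Sum>i<n. a i * b i) = (\<Sum>i<card X. a i * b i)"
      using assms(2) by (intro sum.mono_neutral_right) (auto simp: a_def)
    then show ?thesis by (simp add: a_def)
  qed
  have "1 \<noteq> (\<Sum>i<n. a i * b i)" for b
    using coeff_var_mult_Nil[of f b "{..<card X}"] unfolding sum_a
    by (metis coeff_one zero_neq_one)
  moreover have "\<exists>c b. range b \<subseteq> free_algebra X \<and> p = cst c + (\<Sum>i<n. a i * b i)"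
    if "p \<in> free_algebra X" for p
    using that
  proof (induction rule: free_algebra_induct)
    case zero
    show ?case by (rule exI[of _ 0], rule exI[of _ "\<lambda>_. 0"]) (simp add: zero_in_free_algebra)
  next
    case (add p q)
    then obtain c b c' b' where b: "range b \<subseteq> free_algebra X" "range b' \<subseteq> free_algebra X"
      and "p = cst c + (\<Sum>i<n. a i * b i)" "q = cst c' + (\<Sum>i<n. a i * b' i)"
      by blast
    then have "p + q = cst (c + c') + (\<Sum>i<n. a i * (b i + b' i))"
      by (simp add: single_add distrib_left sum.distrib)
    moreover have "range (\<lambda>i. b i + b' i) \<subseteq> free_algebra X"
      using b by (auto simp: image_subset_iff free_algebra_closed)
    ultimately show ?case by (intro exI[of _ "c + c'"] exI[of _ "\<lambda>i. b i + b' i"] conjI)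
  next
    case (single w k)
    show ?case
    proof (cases w)
      case Nil
      then show ?thesis
        by (intro exI[of _ k] exI[of _ "\<lambda>_. 0"]) (simp add: zero_in_free_algebra zero_fmonoid_def)
    next
      case (Cons x v)
      then have "x \<in> f ` {..<card X}" using single f by (simp add: bij_betw_def)
      then obtain j where j: "j < card X" "f j = x" by blast
      let ?b = "\<lambda>i. if i = j then Poly_Mapping.single (FWord v) k else 0"
      have "(\<Sum>i<card X. var (f i) * ?b i) = (\<Sum>i<card X. if i = j then var (f j) * Poly_Mapping.single (FWord v) k else 0)"
        by (rule sum.cong) auto
      also have "\<dots> = Poly_Mapping.single (FWord w) k"
        using j Cons by (simp add: mult_single)
      finally have "Poly_Mapping.single (FWord w) k = cst 0 + (\<Sum>i<n. a i * ?b i)"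
        by (simp add: sum_a)
      moreover have "range ?b \<subseteq> free_algebra X"
        using single Cons by (auto simp: free_algebra_def)
      ultimately show ?thesis by (intro exI[of _ 0] exI[of _ ?b] conjI)
    qed
  qed
  ultimately show ?thesis unfolding Fin_codim_def using a by blast
qed

section \<open>Characters of the free algebra and derivations at a character\<close>

lemma sum_fun_apply: "(\<Sum>i\<in>I. F i) x = (\<Sum>i\<in>I. F i x)"
  by (induction I rule: infinite_finite_induct) simp_all

definition lin_ext :: "('x list \<Rightarrow> 'k) \<Rightarrow> ('x, 'k::field) ncpoly \<Rightarrow> 'k" where
  "lin_ext g p = (\<Sum>w\<in>Poly_Mapping.keys p. Poly_Mapping.lookup p w * g (letters w))"

lemma lin_ext_superset:
  assumes "finite W" and "Poly_Mapping.keys p \<subseteq> W"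
  shows "lin_ext g p = (\<Sum>w\<in>W. Poly_Mapping.lookup p w * g (letters w))"
  unfolding lin_ext_def using assms
  by (intro sum.mono_neutral_left) (auto simp: in_keys_iff)

lemma lin_ext_add [simp]: "lin_ext g (p + q) = lin_ext g p + lin_ext g q"
proof -
  let ?W = "Poly_Mapping.keys p \<union> Poly_Mapping.keys q"
  have "Poly_Mapping.keys (p + q) \<subseteq> ?W" by (rule Poly_Mapping.keys_add)
  then show ?thesis
    by (simp add: lin_ext_superset[of ?W] lookup_add distrib_right sum.distrib)
qed

lemma lin_ext_zero [simp]: "lin_ext g 0 = 0"
  by (simp add: lin_ext_def)

lemma lin_ext_sum: "lin_ext g (sum f I) = (\<Sum>i\<in>I. lin_ext g (f i))"
  by (induction I rule: infinite_finite_induct) simp_all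

lemma lin_ext_single [simp]: "lin_ext g (Poly_Mapping.single (FWord w) a) = a * g w"
  by (simp add: lin_ext_def)

lemma lin_ext_cst [simp]: "lin_ext g (cst a) = a * g []"
  using lin_ext_single[of g "[]" a] by (simp add: zero_fmonoid_def)

lemma lin_ext_diff [simp]: "lin_ext g (p - q) = lin_ext g p - lin_ext g q"
  using lin_ext_add[of g "p - q" q] by (simp add: algebra_simps)

text \<open>The algebra homomorphism to the field with value \<open>l x\<close> at the letter
  \<open>x\<close>.\<close>

definition chi :: "('x \<Rightarrow> 'k) \<Rightarrow> ('x, 'k::field) ncpoly \<Rightarrow> 'k" where
  "chi l = lin_ext (\<lambda>w. prod_list (map l w))"

text \<open>The partial derivative in the letter \<open>x\<close>, evaluated at the point
  \<open>l\<close>: the Leibniz rule with all remaining letters replaced by their values.\<close>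

primrec word_deriv :: "('x \<Rightarrow> 'k) \<Rightarrow> 'x \<Rightarrow> 'x list \<Rightarrow> 'k::field" where
  "word_deriv l x [] = 0"
| "word_deriv l x (y # w) =
     (if x = y then prod_list (map l w) else 0) + l y * word_deriv l x w"

definition deriv_at :: "('x \<Rightarrow> 'k) \<Rightarrow> 'x \<Rightarrow> ('x, 'k::field) ncpoly \<Rightarrow> 'k" where
  "deriv_at l x = lin_ext (word_deriv l x)"

lemma word_deriv_append:
  "word_deriv l x (u @ v) = word_deriv l x u * prod_list (map l v) + prod_list (map l u) * word_deriv l x v"
  by (induction u) (auto simp: algebra_simps)

lemma chi_mult: "chi l (p * q) = chi l p * chi l q"
proof (induction p rule: ncpoly_induct)
  case (single u a)
  show ?case
    by (induction q rule: ncpoly_induct) (auto simp: chi_def mult_single algebra_simps)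
qed (simp_all add: chi_def algebra_simps)

lemma deriv_at_mult: "deriv_at l x (p * q) = deriv_at l x p * chi l q + chi l p * deriv_at l x q"
proof (induction p rule: ncpoly_induct)
  case (single u a)
  show ?case
    by (induction q rule: ncpoly_induct)
      (auto simp: chi_def deriv_at_def mult_single word_deriv_append algebra_simps)
qed (simp_all add: chi_def deriv_at_def algebra_simps)

text \<open>The ideal \<open>I\<close> turns out to be the kernel of a character
  \<open>chi l\<close>. At this character the gradient of \<open>a i * b i\<close> is a multiple of
  that of \<open>a i\<close>, so the gradients of elements of \<open>I\<close> lie in the span of
  \<open>n\<close> vectors. They include the unit vectors of all letters in \<open>X\<close>, hence
  \<open>card X \<le> n\<close>.\<close>

lemma card_if_Fin_codim:
  fixes X :: "'x set"
  assumes "Fin_codim (free_algebra X :: ('x, 'k::field) ncpoly set) n"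
  shows "finite X \<and> card X \<le> n"
proof -
  let ?D = "free_algebra X :: ('x, 'k) ncpoly set"
  obtain a where a: "range a \<subseteq> ?D"
    and one: "\<nexists>b. range b \<subseteq> ?D \<and> 1 = (\<Sum>i<n. a i * b i)"
    and gen: "\<forall>p\<in>?D. \<exists>c b. range b \<subseteq> ?D \<and> p = cst c + (\<Sum>i<n. a i * b i)"
    using assms unfolding Fin_codim_def by (elim exE conjE) (rule that)
  define I where "I = {\<Sum>i<n. a i * b i | b. range b \<subseteq> ?D}"
  have I_sub: "I \<subseteq> ?D"
    using a by (auto simp: I_def image_subset_iff intro!: free_algebra_closed)
  have I_add: "p + q \<in> I" if p: "p \<in> I" and q: "q \<in> I" for p q
  proof -
    obtain b where "range b \<subseteq> ?D" "p = (\<Sum>i<n. a i * b i)"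
      using p unfolding I_def by blast
    moreover obtain b' where "range b' \<subseteq> ?D" "q = (\<Sum>i<n. a i * b' i)"
      using q unfolding I_def by blast
    ultimately have "p + q = (\<Sum>i<n. a i * (b i + b' i))" "range (\<lambda>i. b i + b' i) \<subseteq> ?D"
      by (simp_all add: distrib_left sum.distrib image_subset_iff add_in_free_algebra)
    then show ?thesis unfolding I_def by (intro CollectI exI[of _ "\<lambda>i. b i + b' i"] conjI)
  qed
  have I_mult: "p * q \<in> I" if p: "p \<in> I" and q: "q \<in> ?D" for p q
  proof -
    obtain b where "range b \<subseteq> ?D" "p = (\<Sum>i<n. a i * b i)"
      using p unfolding I_def by blast
    then have "p * q = (\<Sum>i<n. a i * (b i * q))" "range (\<lambda>i. b i * q) \<subseteq> ?D"
      using q by (simp_all add: sum_distrib_right mult.assoc image_subset_iff mult_in_free_algebra)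
    then show ?thesis unfolding I_def by (intro CollectI exI[of _ "\<lambda>i. b i * q"] conjI)
  qed
  have cst_I: "c = 0" if "cst c \<in> I" for c
  proof (rule ccontr)
    assume "c \<noteq> 0"
    then have "1 \<in> I"
      using I_mult[OF that cst_in_free_algebra[of "inverse c"]] by (simp add: cst_mult)
    then show False using one unfolding I_def by blast
  qed
  have gen': "\<exists>c. p - cst c \<in> I" if "p \<in> ?D" for p
  proof -
    obtain c b where "range b \<subseteq> ?D" "p = cst c + (\<Sum>i<n. a i * b i)" using gen \<open>p \<in> ?D\<close> by blast
    then have "p - cst c \<in> I" unfolding I_def by (intro CollectI exI[of _ b]) simp
    then show ?thesis ..
  qed
  \<comment> \<open>The scalars to which the letters are congruent modulo \<open>I\<close> are the
    values of the character.\<close>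
  then have "\<forall>x\<in>X. \<exists>c. var x - cst c \<in> I" by (simp add: var_in_free_algebra)
  then obtain l where l: "\<And>x. x \<in> X \<Longrightarrow> var x - cst (l x) \<in> I" by metis
  have zero_I: "0 \<in> I"
    unfolding I_def by (rule CollectI, rule exI[of _ "\<lambda>_. 0"]) (auto simp: zero_in_free_algebra)
  have cst_mult_I: "cst c * p \<in> I" if "p \<in> I" for c p
    using I_mult[OF that cst_in_free_algebra[of c]] by (simp add: cst_commute)
  have word_I: "Poly_Mapping.single (FWord w) k - cst (k * prod_list (map l w)) \<in> I"
    if "set w \<subseteq> X" for w k
    using that
  proof (induction w)
    case Nil
    show ?case using zero_I by (simp add: zero_fmonoid_def)
  next
    case (Cons x w)
    let ?m = "Poly_Mapping.single (FWord w) k :: ('x, 'k) ncpoly"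
    have "?m \<in> ?D" using Cons.prems by (auto simp: free_algebra_def)
    \<comment> \<open>In \<open>x w - l x c = (x - l x) w + l x (w - c)\<close> the first summand
      has its element of \<open>I\<close> on the left, and in the second the scalar commutes, so a
      right ideal suffices.\<close>
    then have "(var x - cst (l x)) * ?m \<in> I" using I_mult l Cons.prems by simp
    moreover have "cst (l x) * (?m - cst (k * prod_list (map l w))) \<in> I"
      using cst_mult_I Cons by simp
    ultimately have "(var x - cst (l x)) * ?m + cst (l x) * (?m - cst (k * prod_list (map l w))) \<in> I"
      by (rule I_add)
    moreover have "(var x - cst (l x)) * ?m + cst (l x) * (?m - cst (k * prod_list (map l w)))
      = Poly_Mapping.single (FWord (x # w)) k - cst (k * prod_list (map l (x # w)))"
      by (simp add: algebra_simps mult_single)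
    ultimately show ?case by simp
  qed
  have "p - cst (chi l p) \<in> I" if "p \<in> ?D" for p
    using that
  proof (induction rule: free_algebra_induct)
    case zero
    show ?case using zero_I by (simp add: chi_def)
  next
    case (single w k)
    then show ?case using word_I by (simp add: chi_def)
  next
    case (add p q)
    have "p + q - cst (chi l (p + q)) = (p - cst (chi l p)) + (q - cst (chi l q))"
      by (simp add: chi_def single_add)
    then show ?case using I_add[OF add.IH] by metis
  qed
  then have chi_I: "chi l p = 0" if "p \<in> I" for p
  proof -
    \<comment> \<open>Both \<open>p\<close> and \<open>p - cst (chi l p)\<close> lie in
      \<open>I\<close>, hence so does the scalar \<open>chi l p\<close>, which is then zero.\<close>
    have "cst (- 1) * (p - cst (chi l p)) \<in> I"
      using \<open>\<And>p. p \<in> ?D \<Longrightarrow> p - cst (chi l p) \<in> I\<close> that I_sub cst_mult_I by blast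
    from I_add[OF that this] have "cst (chi l p) \<in> I"
      by (simp add: single_uminus)
    then show ?thesis by (rule cst_I)
  qed
  have a_I: "a i \<in> I" if "i < n" for i
  proof -
    have "(\<Sum>j<n. a j * (if j = i then 1 else 0)) = (\<Sum>j<n. if j = i then a i else 0)"
      by (rule sum.cong) auto
    then have "a i = (\<Sum>j<n. a j * (if j = i then 1 else 0))" using that by simp
    then show ?thesis
      unfolding I_def by (intro CollectI exI[of _ "\<lambda>j. if j = i then 1 else 0"])
        (auto simp: zero_in_free_algebra one_in_free_algebra)
  qed
  interpret vs: vector_space "\<lambda>(c :: 'k) (f :: 'x \<Rightarrow> 'k). (\<lambda>x. c * f x)"
    by standard (auto simp: algebra_simps)
  define d where "d p = (\<lambda>x. deriv_at l x p)" for p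
  have d_I: "d p \<in> vs.span (d ` a ` {..<n})" if "p \<in> I" for p
  proof -
    obtain b where b: "p = (\<Sum>i<n. a i * b i)" using \<open>p \<in> I\<close> unfolding I_def by blast
    have "d p = (\<lambda>x. \<Sum>i<n. chi l (b i) * d (a i) x)"
    proof
      fix x
      have "d p x = (\<Sum>i<n. deriv_at l x (a i * b i))"
        by (simp add: d_def b deriv_at_def lin_ext_sum)
      \<comment> \<open>The other Leibniz term has the factor
        \<open>chi l (a i) = 0\<close>.\<close>
      also have "\<dots> = (\<Sum>i<n. chi l (b i) * d (a i) x)"
        by (rule sum.cong) (simp_all add: deriv_at_mult chi_I a_I d_def)
      finally show "d p x = (\<Sum>i<n. chi l (b i) * d (a i) x)" .
    qed
    also have "\<dots> = (\<Sum>i<n. (\<lambda>x. chi l (b i) * d (a i) x))"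
      by (simp add: fun_eq_iff sum_fun_apply)
    also have "\<dots> \<in> vs.span (d ` a ` {..<n})"
      by (intro vs.span_sum vs.span_scale vs.span_base) auto
    finally show ?thesis .
  qed
  define u where "u x = (\<lambda>y. if y = x then 1 else 0 :: 'k)" for x :: 'x
  have "d (var x - cst (l x)) = u x" for x
    by (auto simp: d_def deriv_at_def u_def)
  then have span: "u ` X \<subseteq> vs.span (d ` a ` {..<n})"
    using d_I l by (metis image_subsetI)
  have indep: "vs.independent (u ` X)"
    unfolding vs.independent_explicit_module
  proof (intro allI impI)
    fix A f g
    assume A: "finite A" "A \<subseteq> u ` X" "(\<Sum>h\<in>A. (\<lambda>y. f h * h y)) = 0" "g \<in> A"
    then obtain x where x: "g = u x" by blast
    have sum_apply: "(\<Sum>h\<in>A. (\<lambda>y. f h * h y)) x = (\<Sum>h\<in>A. f h * h x)"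
      by (rule sum_fun_apply)
    have "f h * h x = (if h = g then f g else 0)" if "h \<in> A" for h
      using that A(2) by (auto simp: x u_def split: if_splits)
    then have "(\<Sum>h\<in>A. f h * h x) = (\<Sum>h\<in>A. if h = g then f g else 0)"
      by (rule sum.cong[OF refl])
    then show "f g = 0" using A sum_apply by simp
  qed
  have inj: "inj u" by (rule injI) (metis u_def zero_neq_one)
  from vs.independent_span_bound[OF _ indep span]
  have "finite (u ` X)" "card (u ` X) \<le> card (d ` a ` {..<n})" by auto
  moreover have "card (d ` a ` {..<n}) \<le> n"
    by (metis card_image_le card_lessThan finite_imageI finite_lessThan image_image order_trans)
  ultimately show ?thesis
    using inj by (metis card_image finite_imageD inj_on_subset order_trans subset_UNIV)
qed

section \<open>Sentences that express the rank\<close>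

definition RConst :: "nat \<Rightarrow> nat \<Rightarrow> ring_fm" where
  "RConst m v = RDisj (REq (RVar v) RZero) (REx m (REq (RMul (RVar v) (RVar m)) ROne))"

lemma ring_sat_RConst [simp]:
  fixes X :: "'x set" and e :: "nat \<Rightarrow> ('x, 'k::field) ncpoly"
  shows "v < m \<Longrightarrow> ring_sat (free_algebra X) e (RConst m v) \<longleftrightarrow> e v \<in> range cst"
  using right_invertible_iff[of "e v" X] by (simp add: RConst_def)

text \<open>The value of \<open>RVar v\<close> is to be a right combination of the variables below
  the first argument. The last summand is split off: \<open>m\<close> holds its right factor and
  \<open>Suc m\<close> the rest of the sum, and deeper levels bind only larger variables.\<close>

primrec RCombination :: "nat \<Rightarrow> nat \<Rightarrow> nat \<Rightarrow> ring_fm" where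
  "RCombination 0 m v = REq (RVar v) RZero"
| "RCombination (Suc n) m v = REx m (REx (Suc m) (RConj
     (REq (RVar v) (RAdd (RVar (Suc m)) (RMul (RVar n) (RVar m))))
     (RCombination n (Suc (Suc m)) (Suc m))))"

lemma ring_sat_RCombination:
  fixes X :: "'x set" and e :: "nat \<Rightarrow> ('x, 'k::field) ncpoly"
  assumes "n \<le> m" and "v < m" and "\<And>i. i < n \<Longrightarrow> e i \<in> free_algebra X"
  shows "ring_sat (free_algebra X) e (RCombination n m v) \<longleftrightarrow>
    (\<exists>b. range b \<subseteq> free_algebra X \<and> e v = (\<Sum>i<n. e i * b i))"
  using assms
proof (induction n arbitrary: m v e)
  case 0
  have "\<exists>b :: nat \<Rightarrow> ('x, 'k) ncpoly. range b \<subseteq> free_algebra X"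
    by (rule exI[of _ "\<lambda>_. 0"]) (simp add: zero_in_free_algebra)
  then show ?case by simp
next
  case (Suc n)
  let ?D = "free_algebra X :: ('x, 'k) ncpoly set"
  have "ring_sat ?D e (RCombination (Suc n) m v) \<longleftrightarrow>
    (\<exists>c\<in>?D. \<exists>d\<in>?D. e v = d + e n * c \<and> (\<exists>b. range b \<subseteq> ?D \<and> d = (\<Sum>i<n. e i * b i)))"
  proof -
    have "ring_sat ?D (e(m := c, Suc m := d)) (RCombination n (Suc (Suc m)) (Suc m)) \<longleftrightarrow>
      (\<exists>b. range b \<subseteq> ?D \<and> d = (\<Sum>i<n. e i * b i))" for c d
      using Suc.prems by (subst Suc.IH) auto
    then show ?thesis using Suc.prems by simp
  qed
  also have "\<dots> \<longleftrightarrow> (\<exists>b. range b \<subseteq> ?D \<and> e v = (\<Sum>i<Suc n. e i * b i))" (is "?L \<longleftrightarrow> ?R")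
  proof
    assume ?L
    then obtain c b where "c \<in> ?D" "range b \<subseteq> ?D" "e v = (\<Sum>i<n. e i * b i) + e n * c" by blast
    then show ?R by (intro exI[of _ "b(n := c)"]) auto
  next
    assume ?R
    then obtain b where b: "range b \<subseteq> ?D" "e v = (\<Sum>i<n. e i * b i) + e n * b n" by auto
    moreover have "(\<Sum>i<n. e i * b i) \<in> ?D"
      using Suc.prems(3) b(1) by (intro free_algebra_closed) auto
    ultimately show ?L by blast
  qed
  finally show ?case .
qed

text \<open>The variables below \<open>n\<close> are free and stand for the generators. Validity
  quantifies over them universally, hence the negation: validity then means that no choice of
  generators works.\<close>

definition RNotCodim :: "nat \<Rightarrow> ring_fm" where
  "RNotCodim n = RNeg (RConj
     (RNeg (REx n (RConj (REq (RVar n) ROne) (RCombination n (Suc n) n))))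
     (RAll n (REx (n + 1) (REx (n + 2) (RConj (RConst (n + 3) (n + 1)) (RConj
        (REq (RVar n) (RAdd (RVar (n + 1)) (RVar (n + 2))))
        (RCombination n (n + 3) (n + 2))))))))"

lemma ring_models_RNotCodim:
  fixes X :: "'x set"
  shows "ring_models (free_algebra X :: ('x, 'k::field) ncpoly set) (RNotCodim n) \<longleftrightarrow>
    \<not> Fin_codim (free_algebra X :: ('x, 'k) ncpoly set) n"
proof -
  let ?D = "free_algebra X :: ('x, 'k) ncpoly set"
  define Q where "Q e \<longleftrightarrow> (\<nexists>b. range b \<subseteq> ?D \<and> 1 = (\<Sum>i<n. e i * b i)) \<and>
     (\<forall>p\<in>?D. \<exists>c b. range b \<subseteq> ?D \<and> p = cst c + (\<Sum>i<n. e i * b i))" for e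
  have "ring_sat ?D e (RNotCodim n) \<longleftrightarrow> \<not> Q e" if e: "range e \<subseteq> ?D" for e
  proof -
    have "e i \<in> ?D" for i using e by blast
    then have "(\<Sum>i<n. e i * b i) \<in> ?D" if "range b \<subseteq> ?D" for b
      using that by (intro free_algebra_closed) auto
    then have *: "(\<exists>q\<in>?D. p = c + q \<and> (\<exists>b. range b \<subseteq> ?D \<and> q = (\<Sum>i<n. e i * b i)))
      \<longleftrightarrow> (\<exists>b. range b \<subseteq> ?D \<and> p = c + (\<Sum>i<n. e i * b i))" for p c
      by blast
    have "ring_sat ?D e (RNotCodim n) \<longleftrightarrow> \<not>
     ((\<nexists>b. range b \<subseteq> ?D \<and> 1 = (\<Sum>i<n. e i * b i)) \<and>
     (\<forall>p\<in>?D. \<exists>c\<in>?D. c \<in> range cst \<and> (\<exists>q\<in>?D. p = c + q \<and> (\<exists>b. range b \<subseteq> ?D \<and> q = (\<Sum>i<n. e i * b i)))))"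
      using \<open>\<And>i. e i \<in> ?D\<close>
      by (simp add: RNotCodim_def ring_sat_RCombination one_in_free_algebra del: RCombination.simps)
    moreover have "(\<exists>c\<in>?D. c \<in> range cst \<and> P c) \<longleftrightarrow> (\<exists>c. P (cst c))" for P
      using cst_in_free_algebra by blast
    ultimately show ?thesis by (simp only: Q_def *)
  qed
  moreover have "Fin_codim ?D n \<longleftrightarrow> (\<exists>a. range a \<subseteq> ?D \<and> Q a)"
    by (simp only: Fin_codim_def Q_def)
  ultimately show ?thesis unfolding ring_models_def by blast
qed

text \<open>A formula says for each \<open>n\<close> that there are more than \<open>n\<close>
  letters; the instances \<open>card X\<close> and \<open>card Y\<close> determine the rank.\<close>

theorem ring_elem_equiv_card:
  fixes X :: "'x set" and Y :: "'y set"
  assumes "ring_elem_equiv (free_algebra X :: ('x, 'k1::field) ncpoly set)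
    (free_algebra Y :: ('y, 'k2::field) ncpoly set)"
  shows "(finite X \<and> finite Y \<and> card X = card Y) \<or> (infinite X \<and> infinite Y)"
proof -
  have "finite X \<and> card X \<le> n \<longleftrightarrow> finite Y \<and> card Y \<le> n" for n
    using ring_elem_equiv_models[OF assms, of "RNotCodim n"]
      Fin_codim_if_card[of X n, where 'k = 'k1] Fin_codim_if_card[of Y n, where 'k = 'k2]
      card_if_Fin_codim[of X n, where 'k = 'k1] card_if_Fin_codim[of Y n, where 'k = 'k2]
    unfolding ring_models_RNotCodim by blast
  from this[of "card X"] this[of "card Y"] show ?thesis by auto
qed

subsection \<open>Renaming letters\<close>

definition lmap :: "('x \<Rightarrow> 'y) \<Rightarrow> ('x, 'k::field) ncpoly \<Rightarrow> ('y, 'k) ncpoly" where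
  "lmap f p = (\<Sum>w\<in>Poly_Mapping.keys p.
     Poly_Mapping.single (FWord (map f (letters w))) (Poly_Mapping.lookup p w))"

lemma lmap_add [simp]: "lmap f (p + q) = lmap f p + lmap f q"
  unfolding lmap_def by (rule setsum_keys_plus_distrib) (simp_all add: single_add)

lemma lmap_zero [simp]: "lmap f 0 = 0"
  by (simp add: lmap_def)

lemma lmap_single [simp]:
  "lmap f (Poly_Mapping.single (FWord w) a) = Poly_Mapping.single (FWord (map f w)) a"
  by (simp add: lmap_def)

lemma lmap_one [simp]: "lmap f 1 = 1"
  using lmap_single[of f "[]" 1] by (simp add: zero_fmonoid_def[symmetric])

lemma lmap_mult [simp]: "lmap f (p * q) = lmap f p * lmap f q"
proof (induction p rule: ncpoly_induct)
  case (single u a)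
  show ?case
    by (induction q rule: ncpoly_induct) (auto simp: mult_single algebra_simps)
qed (simp_all add: algebra_simps)

lemma lmap_in_free_algebra: "p \<in> free_algebra X \<Longrightarrow> lmap f p \<in> free_algebra (f ` X)"
proof (induction rule: free_algebra_induct)
  case (single w a)
  then show ?case by (auto simp: free_algebra_def)
qed (simp_all add: zero_in_free_algebra add_in_free_algebra)

lemma lmap_cong:
  assumes "p \<in> free_algebra X" and "\<And>x. x \<in> X \<Longrightarrow> f x = g x"
  shows "lmap f p = lmap g p"
  using assms(1)
proof (induction rule: free_algebra_induct)
  case (single w a)
  then have "map f w = map g w" using assms(2) by auto
  then show ?case by (simp only: lmap_single)
qed simp_all

lemma lmap_inverse:
  assumes "p \<in> free_algebra X" and "\<And>x. x \<in> X \<Longrightarrow> g (f x) = x"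
  shows "lmap g (lmap f p) = p"
  using assms(1)
proof (induction rule: free_algebra_induct)
  case (single w a)
  then have "map g (map f w) = w" using assms(2) by (induction w) auto
  then show ?case by simp
qed simp_all

lemma free_algebra_mono: "X \<subseteq> Y \<Longrightarrow> free_algebra X \<subseteq> free_algebra Y"
  by (auto simp: free_algebra_def)

text \<open>This is what lets the back-and-forth work with finite sets of letters.\<close>

lemma free_algebra_finite_letters:
  assumes "p \<in> free_algebra X"
  obtains X0 where "finite X0" and "X0 \<subseteq> X" and "p \<in> free_algebra X0"
proof (rule that)
  let ?X0 = "\<Union>w\<in>Poly_Mapping.keys p. set (letters w)"
  show "finite ?X0" by simp
  show "?X0 \<subseteq> X" using assms by (auto simp: free_algebra_def)
  show "p \<in> free_algebra ?X0" by (auto simp: free_algebra_def)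
qed

section \<open>Back-and-forth between sets of letters of the same rank\<close>

definition same_rank :: "'x set \<Rightarrow> 'y set \<Rightarrow> bool" where
  "same_rank X Y \<longleftrightarrow> (finite X \<and> finite Y \<and> card X = card Y) \<or> (infinite X \<and> infinite Y)"

lemma same_rank_sym: "same_rank X Y \<Longrightarrow> same_rank Y X"
  by (auto simp: same_rank_def)

text \<open>One step of the back-and-forth. With finite sets of equal size, a used-up
  \<open>Y\<close> would leave no letter of \<open>X\<close> outside the domain; with infinite sets
  a finite image cannot exhaust \<open>Y\<close>.\<close>

lemma extend_injection:
  assumes XY: "same_rank X Y" and fin: "finite X1" "X1 \<subseteq> X"
    and X0: "finite X0" "X0 \<subseteq> X" and f: "inj_on f X0" "f ` X0 \<subseteq> Y"
  shows "\<exists>f'. (\<forall>x\<in>X0. f' x = f x) \<and> inj_on f' (X0 \<union> X1) \<and> f' ` (X0 \<union> X1) \<subseteq> Y"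
  using fin
proof (induction X1)
  case empty
  then show ?case using f by auto
next
  case (insert x X1)
  then obtain f' where f': "\<forall>x\<in>X0. f' x = f x" "inj_on f' (X0 \<union> X1)" "f' ` (X0 \<union> X1) \<subseteq> Y"
    by auto
  show ?case
  proof (cases "x \<in> X0 \<union> X1")
    case True
    then have "X0 \<union> insert x X1 = X0 \<union> X1" by auto
    then show ?thesis using f' by metis
  next
    case False
    have "f' ` (X0 \<union> X1) \<noteq> Y"
    proof
      assume eq: "f' ` (X0 \<union> X1) = Y"
      have fin1: "finite (X0 \<union> X1)" using insert.hyps X0 by simp
      then have "finite Y" using eq by blast
      then have "finite X" "card X = card Y" using XY by (auto simp: same_rank_def)
      moreover have "card Y = card (X0 \<union> X1)" using eq f'(2) card_image by blast
      moreover have "X0 \<union> X1 \<subset> X" using False X0 insert.prems by auto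
      ultimately show False by (metis psubset_card_mono less_irrefl)
    qed
    then obtain y where y: "y \<in> Y" "y \<notin> f' ` (X0 \<union> X1)" using f'(3) by blast
    have "(f'(x := y)) ` (X0 \<union> insert x X1) \<subseteq> Y" using f'(3) y by auto
    moreover have "inj_on (f'(x := y)) (X0 \<union> insert x X1)"
      using f'(2) y(2) False by (auto simp: inj_on_def)
    moreover have "\<forall>x'\<in>X0. (f'(x := y)) x' = f x'" using f'(1) False by auto
    ultimately show ?thesis by blast
  qed
qed

lemma lmap_ring_term_val:
  assumes "\<And>v. v \<in> ring_term_vars t \<Longrightarrow> e' v = lmap f (e v)"
  shows "ring_term_val e' t = lmap f (ring_term_val e t)"
  using assms by (induction t) auto

lemma ring_term_val_in_free_algebra:
  "(\<And>v. v \<in> ring_term_vars t \<Longrightarrow> e v \<in> free_algebra X) \<Longrightarrow> ring_term_val e t \<in> free_algebra X"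
  by (induction t) (auto intro: free_algebra_closed)

text \<open>An Ehrenfeucht-Fraisse argument: the assignments correspond under an injection of
  finitely many letters, and each quantifier enlarges it by the finitely many letters of the new
  element. So infinite sets of letters may differ in cardinality.\<close>

lemma ring_sat_same_rank:
  fixes e :: "nat \<Rightarrow> ('x, 'k::field) ncpoly" and e' :: "nat \<Rightarrow> ('y, 'k) ncpoly"
  assumes XY: "same_rank X Y"
    and "finite X0" "X0 \<subseteq> X" "inj_on f X0" "f ` X0 \<subseteq> Y"
    and "\<And>v. v \<in> ring_fm_vars \<phi> \<Longrightarrow> e v \<in> free_algebra X0 \<and> e' v = lmap f (e v)"
  shows "ring_sat (free_algebra X) e \<phi> \<longleftrightarrow> ring_sat (free_algebra Y) e' \<phi>"
  using assms(2-)
proof (induction \<phi> arbitrary: e e' X0 f)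
  case (REq s t)
  have "ring_term_val e' s = lmap f (ring_term_val e s)" "ring_term_val e' t = lmap f (ring_term_val e t)"
    using REq.prems(5) by (simp_all add: lmap_ring_term_val)
  moreover have "ring_term_val e s \<in> free_algebra X0" "ring_term_val e t \<in> free_algebra X0"
    using REq.prems(5) by (simp_all add: ring_term_val_in_free_algebra)
  moreover have "inv_into X0 f (f x) = x" if "x \<in> X0" for x
    using that REq.prems(3) by simp
  ultimately show ?case by simp (metis lmap_inverse)
next
  case (RNeg \<phi>)
  have "ring_sat (free_algebra X) e \<phi> \<longleftrightarrow> ring_sat (free_algebra Y) e' \<phi>"
    by (rule RNeg.IH[OF RNeg.prems(1-4)]) (simp add: RNeg.prems(5))
  then show ?case by simp
next
  case (RConj \<phi> \<psi>)
  have "ring_sat (free_algebra X) e \<phi> \<longleftrightarrow> ring_sat (free_algebra Y) e' \<phi>"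
    by (rule RConj.IH(1)[OF RConj.prems(1-4)]) (simp add: RConj.prems(5))
  moreover have "ring_sat (free_algebra X) e \<psi> \<longleftrightarrow> ring_sat (free_algebra Y) e' \<psi>"
    by (rule RConj.IH(2)[OF RConj.prems(1-4)]) (simp add: RConj.prems(5))
  ultimately show ?case by simp
next
  case (RAll n \<phi>)
  have ext: "ring_sat (free_algebra X) (e(n := a)) \<phi> \<longleftrightarrow> ring_sat (free_algebra Y) (e'(n := lmap g a)) \<phi>"
    if "finite X1" "X0 \<subseteq> X1" "X1 \<subseteq> X" "inj_on g X1" "g ` X1 \<subseteq> Y" "\<forall>x\<in>X0. g x = f x" "a \<in> free_algebra X1"
    for X1 g a
  proof (rule RAll.IH[OF that(1,3-5)])
    fix v assume "v \<in> ring_fm_vars \<phi>"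
    then have v: "v = n \<or> e v \<in> free_algebra X0 \<and> e' v = lmap f (e v)" using RAll.prems(5)[of v] by auto
    have "lmap f (e v) = lmap g (e v)" if "e v \<in> free_algebra X0"
      using lmap_cong[OF that, of f g] \<open>\<forall>x\<in>X0. g x = f x\<close> by simp
    then show "(e(n := a)) v \<in> free_algebra X1 \<and> (e'(n := lmap g a)) v = lmap g ((e(n := a)) v)"
      using v \<open>a \<in> free_algebra X1\<close> free_algebra_mono[OF \<open>X0 \<subseteq> X1\<close>] by auto
  qed
  show ?case
  proof
    assume *: "ring_sat (free_algebra X) e (RAll n \<phi>)"
    have "ring_sat (free_algebra Y) (e'(n := b)) \<phi>" if b: "b \<in> free_algebra Y" for b
    proof -
      obtain Y1 where Y1: "finite Y1" "Y1 \<subseteq> Y" "b \<in> free_algebra Y1"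
        using b free_algebra_finite_letters by blast
      \<comment> \<open>The letters of \<open>b\<close> lie on the side of \<open>Y\<close>, so the
        inverse of \<open>f\<close> is extended to \<open>h\<close> and then turned round;
        \<open>?g\<close> extends \<open>f\<close> again.\<close>
      have "inj_on (inv_into X0 f) (f ` X0)" "inv_into X0 f ` (f ` X0) \<subseteq> X"
        using RAll.prems by (auto simp: inj_on_inv_into)
      then obtain h where h: "\<forall>y\<in>f ` X0. h y = inv_into X0 f y" "inj_on h (f ` X0 \<union> Y1)"
        "h ` (f ` X0 \<union> Y1) \<subseteq> X"
        using extend_injection[OF same_rank_sym[OF XY] Y1(1,2), of "f ` X0" "inv_into X0 f"] RAll.prems
        by blast
      let ?Z = "f ` X0 \<union> Y1"
      let ?g = "inv_into ?Z h"
      have hf: "h (f x) = x" if "x \<in> X0" for x using h(1) that RAll.prems(3) by simp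
      have g: "\<forall>x\<in>X0. ?g x = f x"
      proof
        fix x assume "x \<in> X0"
        then show "?g x = f x" using hf h(2) inv_into_f_f[of h ?Z "f x"] by simp
      qed
      have sub: "X0 \<subseteq> h ` ?Z" using hf by force
      have fin: "finite (h ` ?Z)" using Y1 RAll.prems by simp
      have inj: "inj_on ?g (h ` ?Z)" by (simp add: inj_on_inv_into)
      have img: "?g ` (h ` ?Z) \<subseteq> Y" using h(2) Y1(2) RAll.prems(4) by auto
      have "b \<in> free_algebra ?Z" using Y1(3) free_algebra_mono[of Y1 ?Z] by blast
      then have hb: "lmap h b \<in> free_algebra (h ` ?Z)" "lmap ?g (lmap h b) = b"
        using lmap_in_free_algebra[of b ?Z h] lmap_inverse[of b ?Z ?g h] h(2) by auto
      then have "lmap h b \<in> free_algebra X" using h(3) free_algebra_mono by blast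
      then show ?thesis using ext[OF fin sub h(3) inj img g hb(1)] * hb(2) by simp
    qed
    then show "ring_sat (free_algebra Y) e' (RAll n \<phi>)" by simp
  next
    assume *: "ring_sat (free_algebra Y) e' (RAll n \<phi>)"
    have "ring_sat (free_algebra X) (e(n := a)) \<phi>" if a: "a \<in> free_algebra X" for a
    proof -
      obtain X1 where X1: "finite X1" "X1 \<subseteq> X" "a \<in> free_algebra X1"
        using a free_algebra_finite_letters by blast
      then obtain g where g: "\<forall>x\<in>X0. g x = f x" "inj_on g (X0 \<union> X1)" "g ` (X0 \<union> X1) \<subseteq> Y"
        using extend_injection[OF XY X1(1,2) RAll.prems(1-4)] by blast
      have fin: "finite (X0 \<union> X1)" "X0 \<union> X1 \<subseteq> X" "a \<in> free_algebra (X0 \<union> X1)"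
        using X1 RAll.prems free_algebra_mono[of X1 "X0 \<union> X1"] by auto
      have "lmap g a \<in> free_algebra Y"
        using lmap_in_free_algebra[OF fin(3)] g(3) free_algebra_mono by blast
      then show ?thesis using ext[OF fin(1) _ fin(2) g(2,3,1) fin(3)] * by simp
    qed
    then show "ring_sat (free_algebra X) e (RAll n \<phi>)" by simp
  qed
qed

text \<open>Without free variables the back-and-forth starts from the empty injection and imposes no
  relation between the two assignments.\<close>

lemma ring_models_closed:
  fixes X :: "'x set" and e :: "nat \<Rightarrow> ('x, 'k::field) ncpoly"
  assumes "ring_fm_vars \<phi> = {}" and "range e \<subseteq> free_algebra X"
  shows "ring_models (free_algebra X :: ('x, 'k::field) ncpoly set) \<phi> \<longleftrightarrow> ring_sat (free_algebra X) e \<phi>"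
proof -
  have "ring_sat (free_algebra X) e \<phi> \<longleftrightarrow> ring_sat (free_algebra X) e' \<phi>" for e' :: "nat \<Rightarrow> ('x, 'k) ncpoly"
    by (rule ring_sat_same_rank[of X X "{}" id]) (auto simp: same_rank_def assms)
  then show ?thesis using assms(2) unfolding ring_models_def by blast
qed

theorem ring_elem_equiv_same_rank:
  fixes X :: "'x set" and Y :: "'y set"
  assumes "same_rank X Y"
  shows "ring_elem_equiv (free_algebra X :: ('x, 'k::field) ncpoly set) (free_algebra Y :: ('y, 'k) ncpoly set)"
proof (rule ring_elem_equivI)
  fix \<phi> assume closed: "ring_fm_vars \<phi> = {}"
  have "ring_models (free_algebra X :: ('x, 'k) ncpoly set) \<phi> \<longleftrightarrow> ring_sat (free_algebra X) (\<lambda>_. 0 :: ('x, 'k) ncpoly) \<phi>"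
    by (rule ring_models_closed[OF closed]) (auto simp: zero_in_free_algebra)
  also have "\<dots> \<longleftrightarrow> ring_sat (free_algebra Y) (\<lambda>_. 0 :: ('y, 'k) ncpoly) \<phi>"
    by (rule ring_sat_same_rank[OF assms, of "{}"]) (auto simp: closed)
  also have "\<dots> \<longleftrightarrow> ring_models (free_algebra Y :: ('y, 'k) ncpoly set) \<phi>"
    by (rule ring_models_closed[OF closed, symmetric]) (auto simp: zero_in_free_algebra)
  finally show "ring_models (free_algebra X :: ('x, 'k) ncpoly set) \<phi>
      \<longleftrightarrow> ring_models (free_algebra Y :: ('y, 'k) ncpoly set) \<phi>" .
qed

subsection \<open>Definability over hereditarily finite sets\<close>

text \<open>
  One formula defines \<open>P\<close> over one field and \<open>Q\<close> over the other.  Quantifying over the renaming \<open>f\<close> replaces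
  syntactic substitution; infinitely many variables remain unused, hence fresh ones exist.
\<close>

definition hf_def2 ::
  "((nat \<Rightarrow> 'k1::field hf) \<Rightarrow> bool) \<Rightarrow> ((nat \<Rightarrow> 'k2::field hf) \<Rightarrow> bool) \<Rightarrow> bool" where
  "hf_def2 P Q \<longleftrightarrow> (\<forall>f. infinite (- range f) \<longrightarrow>
     (\<exists>\<phi>. (\<forall>e s. hf_sat e s \<phi> = P (\<lambda>i. s (f i))) \<and> (\<forall>e s. hf_sat e s \<phi> = Q (\<lambda>i. s (f i)))))"

lemma hf_def2I:
  assumes "\<And>f. infinite (- range f) \<Longrightarrow> \<exists>\<phi>. (\<forall>e s. hf_sat e s \<phi> = P (\<lambda>i. s (f i)))
    \<and> (\<forall>e s. hf_sat e s \<phi> = Q (\<lambda>i. s (f i)))"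
  shows "hf_def2 P Q"
  using assms by (simp add: hf_def2_def)

lemma hf_def2E:
  assumes "hf_def2 P Q" and "infinite (- range f)"
  obtains \<phi> where "\<And>e s. hf_sat e s \<phi> = P (\<lambda>i. s (f i))" "\<And>e s. hf_sat e s \<phi> = Q (\<lambda>i. s (f i))"
  using assms unfolding hf_def2_def by blast

lemma hf_def2_rename:
  assumes "hf_def2 P Q"
  shows "hf_def2 (\<lambda>s. P (\<lambda>i. s (h i))) (\<lambda>s. Q (\<lambda>i. s (h i)))"
proof (rule hf_def2I, goal_cases)
  case f: (1 f)
  have "- range f \<subseteq> - range (\<lambda>i. f (h i))" by auto
  then have "infinite (- range (\<lambda>i. f (h i)))" using f by (rule infinite_super)
  then show ?case
    by (rule hf_def2E[OF assms]) blast
qed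

lemma hf_def2_not:
  assumes "hf_def2 P Q" shows "hf_def2 (\<lambda>s. \<not> P s) (\<lambda>s. \<not> Q s)"
proof (rule hf_def2I, goal_cases)
  case (1 f)
  from 1 obtain \<phi> where \<phi>: "\<And>e s. hf_sat e s \<phi> = P (\<lambda>i. s (f i))" "\<And>e s. hf_sat e s \<phi> = Q (\<lambda>i. s (f i))"
    using hf_def2E[OF assms] by blast
  show ?case
    by (rule exI[of _ "HNeg \<phi>"]) (simp add: \<phi>)
qed

lemma hf_def2_conj:
  assumes "hf_def2 P Q" and "hf_def2 P' Q'"
  shows "hf_def2 (\<lambda>s. P s \<and> P' s) (\<lambda>s. Q s \<and> Q' s)"
proof (rule hf_def2I, goal_cases)
  case f: (1 f)
  obtain \<phi> where \<phi>: "\<And>e s. hf_sat e s \<phi> = P (\<lambda>i. s (f i))" "\<And>e s. hf_sat e s \<phi> = Q (\<lambda>i. s (f i))"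
    using hf_def2E[OF assms(1) f] by blast
  obtain \<psi> where \<psi>: "\<And>e s. hf_sat e s \<psi> = P' (\<lambda>i. s (f i))" "\<And>e s. hf_sat e s \<psi> = Q' (\<lambda>i. s (f i))"
    using hf_def2E[OF assms(2) f] by blast
  show ?case
    by (rule exI[of _ "HConj \<phi> \<psi>"]) (simp add: \<phi> \<psi>)
qed

lemma obtain_fresh:
  fixes f :: "nat \<Rightarrow> nat"
  assumes "infinite (- range f)" obtains m where "\<And>i. f i \<noteq> m"
proof -
  have "- range f \<noteq> {}" using assms by auto
  then obtain m where "m \<notin> range f" by blast
  then show ?thesis by (intro that[of m]) auto
qed

text \<open>As with de Bruijn indices, the quantified element sits at index 0 and the environment is
  shifted; the bound variable \<open>m\<close> of the formula is put in front of the
  renaming.\<close>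

lemma hf_def2_ex:
  assumes "hf_def2 (\<lambda>s. P (\<lambda>i. s (Suc i)) (s 0)) (\<lambda>s. Q (\<lambda>i. s (Suc i)) (s 0))"
  shows "hf_def2 (\<lambda>s. \<exists>x. P s x) (\<lambda>s. \<exists>x. Q s x)"
proof (rule hf_def2I, goal_cases)
  case f: (1 f)
  then obtain m where m: "\<And>i. f i \<noteq> m" by (rule obtain_fresh) blast
  define g where "g = case_nat m f"
  have "- range f \<subseteq> insert m (- range g)"
    by (auto simp: g_def split: nat.splits)
  then have g: "infinite (- range g)" using f by (metis finite_insert infinite_super)
  obtain \<phi> where \<phi>: "\<And>e s. hf_sat e s \<phi> = P (\<lambda>i. s (g (Suc i))) (s (g 0))"
    "\<And>e s. hf_sat e s \<phi> = Q (\<lambda>i. s (g (Suc i))) (s (g 0))"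
    using hf_def2E[OF assms g] by blast
  show ?case
    by (rule exI[of _ "HExSet m \<phi>"]) (simp add: \<phi> g_def m)
qed

lemma hf_def2_disj:
  assumes "hf_def2 P Q" and "hf_def2 P' Q'"
  shows "hf_def2 (\<lambda>s. P s \<or> P' s) (\<lambda>s. Q s \<or> Q' s)"
  using hf_def2_not[OF hf_def2_conj[OF hf_def2_not[OF assms(1)] hf_def2_not[OF assms(2)]]] by simp

lemma hf_def2_imp:
  assumes "hf_def2 P Q" and "hf_def2 P' Q'"
  shows "hf_def2 (\<lambda>s. P s \<longrightarrow> P' s) (\<lambda>s. Q s \<longrightarrow> Q' s)"
  using hf_def2_not[OF hf_def2_conj[OF assms(1) hf_def2_not[OF assms(2)]]] by simp

lemma hf_def2_iff:
  assumes "hf_def2 P Q" and "hf_def2 P' Q'"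
  shows "hf_def2 (\<lambda>s. P s \<longleftrightarrow> P' s) (\<lambda>s. Q s \<longleftrightarrow> Q' s)"
  using hf_def2_conj[OF hf_def2_imp[OF assms] hf_def2_imp[OF assms(2,1)]]
  by (simp add: iff_conv_conj_imp)

lemma hf_def2_all:
  assumes "hf_def2 (\<lambda>s. P (\<lambda>i. s (Suc i)) (s 0)) (\<lambda>s. Q (\<lambda>i. s (Suc i)) (s 0))"
  shows "hf_def2 (\<lambda>s. \<forall>x. P s x) (\<lambda>s. \<forall>x. Q s x)"
  using hf_def2_not[OF hf_def2_ex[of "\<lambda>s x. \<not> P s x" "\<lambda>s x. \<not> Q s x", OF hf_def2_not[OF assms]]]
  by simp

text \<open>The language has no function symbols on the set sort, so a function counts as definable
  if its graph is; its value sits at index 0.\<close>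

definition hf_term2 ::
  "((nat \<Rightarrow> 'k1::field hf) \<Rightarrow> 'k1 hf) \<Rightarrow> ((nat \<Rightarrow> 'k2::field hf) \<Rightarrow> 'k2 hf) \<Rightarrow> bool" where
  "hf_term2 f g \<longleftrightarrow> hf_def2 (\<lambda>s. s 0 = f (\<lambda>i. s (Suc i))) (\<lambda>s. s 0 = g (\<lambda>i. s (Suc i)))"

lemma hf_term2_var: "hf_term2 (\<lambda>s. s i) (\<lambda>s. s i)"
  unfolding hf_term2_def
proof (rule hf_def2I, goal_cases)
  case (1 f)
  show ?case
    by (rule exI[of _ "HSetEq (f 0) (f (Suc i))"]) simp
qed

lemma hf_def2_subst:
  assumes "hf_term2 f g" and "hf_def2 (\<lambda>s. P (\<lambda>i. s (Suc i)) (s 0)) (\<lambda>s. Q (\<lambda>i. s (Suc i)) (s 0))"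
  shows "hf_def2 (\<lambda>s. P s (f s)) (\<lambda>s. Q s (g s))"
  using hf_def2_ex[of "\<lambda>s x. x = f s \<and> P s x" "\<lambda>s x. x = g s \<and> Q s x",
      OF hf_def2_conj[OF assms(1)[unfolded hf_term2_def] assms(2)]] by simp

lemma hf_def2_rel1:
  assumes "hf_def2 (\<lambda>s. R (s 0)) (\<lambda>s. R' (s 0))" and "hf_term2 f f'"
  shows "hf_def2 (\<lambda>s. R (f s)) (\<lambda>s. R' (f' s))"
  by (rule hf_def2_subst[of _ _ "\<lambda>s. R" "\<lambda>s. R'", OF assms(2,1)])

lemma hf_term2_shift:
  assumes "hf_term2 f f'"
  shows "hf_term2 (\<lambda>s. f (\<lambda>i. s (h i))) (\<lambda>s. f' (\<lambda>i. s (h i)))"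
  using hf_def2_rename[OF assms[unfolded hf_term2_def], of "case_nat 0 (\<lambda>i. Suc (h i))"]
  by (simp add: hf_term2_def)

lemma hf_def2_rel2:
  assumes "hf_def2 (\<lambda>s. R (s 0) (s 1)) (\<lambda>s. R' (s 0) (s 1))" and "hf_term2 f f'" and "hf_term2 g g'"
  shows "hf_def2 (\<lambda>s. R (f s) (g s)) (\<lambda>s. R' (f' s) (g' s))"
proof -
  \<comment> \<open>The substituted argument must be at index 0, so the variables are swapped;
    \<open>1 - i\<close> sends all larger indices to 0 as well, but \<open>R\<close> reads only 0
    and 1.\<close>
  have "hf_def2 (\<lambda>s. R (s (Suc 0)) (s 0)) (\<lambda>s. R' (s (Suc 0)) (s 0))"
    using hf_def2_rename[OF assms(1), of "\<lambda>i. 1 - i"] by simp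
  then have "hf_def2 (\<lambda>s. R (s 0) (g (\<lambda>i. s (Suc i)))) (\<lambda>s. R' (s 0) (g' (\<lambda>i. s (Suc i))))"
    by (rule hf_def2_subst[of _ _ "\<lambda>s. R (s 0)" "\<lambda>s. R' (s 0)", OF hf_term2_shift[OF assms(3)]])
  then show ?thesis
    by (rule hf_def2_subst[of _ _ "\<lambda>s x. R x (g s)" "\<lambda>s x. R' x (g' s)", OF assms(2)])
qed

lemma hf_def2_rel3:
  assumes "hf_def2 (\<lambda>s. R (s 0) (s 1) (s 2)) (\<lambda>s. R' (s 0) (s 1) (s 2))"
    and "hf_term2 f f'" and "hf_term2 g g'" and "hf_term2 h h'"
  shows "hf_def2 (\<lambda>s. R (f s) (g s) (h s)) (\<lambda>s. R' (f' s) (g' s) (h' s))"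
proof -
  have "hf_def2 (\<lambda>s. R (s (Suc (Suc 0))) (s (Suc 0)) (s 0)) (\<lambda>s. R' (s (Suc (Suc 0))) (s (Suc 0)) (s 0))"
    using hf_def2_rename[OF assms(1), of "\<lambda>i. 2 - i"] by (simp add: numeral_2_eq_2)
  then have "hf_def2 (\<lambda>s. R (s (Suc 0)) (s 0) (h (\<lambda>i. s (Suc (Suc i)))))
      (\<lambda>s. R' (s (Suc 0)) (s 0) (h' (\<lambda>i. s (Suc (Suc i)))))"
    by (rule hf_def2_subst[of _ _ "\<lambda>s. R (s (Suc 0)) (s 0)" "\<lambda>s. R' (s (Suc 0)) (s 0)",
          OF hf_term2_shift[OF hf_term2_shift[OF assms(4)]]])
  then have "hf_def2 (\<lambda>s. R (s 0) (g (\<lambda>i. s (Suc i))) (h (\<lambda>i. s (Suc i))))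
      (\<lambda>s. R' (s 0) (g' (\<lambda>i. s (Suc i))) (h' (\<lambda>i. s (Suc i))))"
    by (rule hf_def2_subst[of _ _ "\<lambda>s x. R (s 0) x (h (\<lambda>i. s (Suc i)))" "\<lambda>s x. R' (s 0) x (h' (\<lambda>i. s (Suc i)))",
          OF hf_term2_shift[OF assms(3)]])
  then show ?thesis
    by (rule hf_def2_subst[of _ _ "\<lambda>s x. R x (g s) (h s)" "\<lambda>s x. R' x (g' s) (h' s)", OF assms(2)])
qed

lemma hf_term2_fun2:
  assumes "hf_def2 (\<lambda>s. s 2 = F (s 0) (s 1)) (\<lambda>s. s 2 = F' (s 0) (s 1))"
    and "hf_term2 f f'" and "hf_term2 g g'"
  shows "hf_term2 (\<lambda>s. F (f s) (g s)) (\<lambda>s. F' (f' s) (g' s))"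
  unfolding hf_term2_def
  using hf_def2_rel3[of "\<lambda>x y z. z = F x y" "\<lambda>x y z. z = F' x y", OF assms(1)
      hf_term2_shift[OF assms(2)] hf_term2_shift[OF assms(3)] hf_term2_var[of 0]] .

lemma hf_def2_eq_term: "hf_def2 (\<lambda>s. s i = s j) (\<lambda>s. s i = s j)"
  using hf_def2_rename[OF hf_term2_var[of 0, unfolded hf_term2_def], of "case_nat i (\<lambda>_. j)"] by simp

lemma hf_def2_eq:
  assumes "hf_term2 f f'" "hf_term2 g g'"
  shows "hf_def2 (\<lambda>s. f s = g s) (\<lambda>s. f' s = g' s)"
  by (rule hf_def2_rel2[of "(=)" "(=)", OF hf_def2_eq_term assms])

lemma hf_def2_mem:
  assumes "hf_term2 f f'" "hf_term2 g g'"
  shows "hf_def2 (\<lambda>s. hf_mem (f s) (g s)) (\<lambda>s. hf_mem (f' s) (g' s))"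
proof (rule hf_def2_rel2[OF _ assms], rule hf_def2I, goal_cases)
  case (1 f)
  show ?case
    by (rule exI[of _ "HMem (SetObj (f 0)) (SetObj (f 1))"]) simp
qed

section \<open>Atoms and field arithmetic inside the set sort\<close>

definition is_atom :: "'k hf \<Rightarrow> bool" where
  "is_atom x \<longleftrightarrow> x \<in> range Atom"

text \<open>The default outside the atoms makes the operation total; the empty set is definable, so
  the graph stays definable.\<close>

fun hf_lift2 :: "('k \<Rightarrow> 'k \<Rightarrow> 'k) \<Rightarrow> 'k hf \<Rightarrow> 'k hf \<Rightarrow> 'k hf" where
  "hf_lift2 F (Atom a) (Atom b) = Atom (F a b)"
| "hf_lift2 F _ _ = HSet {||}"

text \<open>Equality between the two sorts is not atomic: an atom is identified by the sets containing it.\<close>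

definition HIsAtom :: "ring_term \<Rightarrow> nat \<Rightarrow> nat \<Rightarrow> hf_fm" where
  "HIsAtom t m i = HAllSet m (HIff (HMem (FieldObj t) (SetObj m)) (HMem (SetObj i) (SetObj m)))"

lemma hf_sat_HIsAtom [simp]:
  "i \<noteq> m \<Longrightarrow> hf_sat e s (HIsAtom t m i) \<longleftrightarrow> s i = Atom (ring_term_val e t)"
proof -
  have "(\<forall>S. hf_mem x S \<longleftrightarrow> hf_mem y S) \<longleftrightarrow> y = x" for x y :: "'a hf"
    using spec[of "\<lambda>S. hf_mem x S \<longleftrightarrow> hf_mem y S" "HSet {|x|}"] by auto
  then show "i \<noteq> m \<Longrightarrow> ?thesis" by (simp add: HIsAtom_def)
qed

lemma hf_def2_is_atom:
  assumes "hf_term2 f f'"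
  shows "hf_def2 (\<lambda>s. is_atom (f s)) (\<lambda>s. is_atom (f' s))"
proof (rule hf_def2_rel1[OF _ assms], rule hf_def2I, goal_cases)
  case (1 f)
  from 1 obtain m where "\<And>i. f i \<noteq> m" by (rule obtain_fresh) blast
  then show ?case
    by (intro exI[of _ "HExField 0 (HIsAtom (RVar 0) m (f 0))"]) (auto simp: is_atom_def)
qed

lemma hf_term2_lift2_aux:
  assumes F: "\<And>e. ring_term_val e T = F (e 0) (e 1)" and F': "\<And>e. ring_term_val e T = F' (e 0) (e 1)"
    and "hf_term2 f f'" "hf_term2 g g'"
  shows "hf_term2 (\<lambda>s. hf_lift2 F (f s) (g s)) (\<lambda>s. hf_lift2 F' (f' s) (g' s))"
proof (rule hf_term2_fun2[OF _ assms(3,4)], rule hf_def2I, goal_cases)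
  case (1 f)
  from 1 obtain m where m: "\<And>i. f i \<noteq> m" by (rule obtain_fresh) blast
  let ?AA = "HExField 0 (HExField 1 (HConj (HIsAtom (RVar 0) m (f 0)) (HConj (HIsAtom (RVar 1) m (f 1))
     (HIsAtom T m (f 2)))))"
  let ?AN = "HNeg (HExField 0 (HExField 1 (HConj (HIsAtom (RVar 0) m (f 0)) (HIsAtom (RVar 1) m (f 1)))))"
  let ?N = "HConj (HNeg (HExField 0 (HIsAtom (RVar 0) m (f 2)))) (HAllSet m (HNeg (HMem (SetObj m) (SetObj (f 2)))))"
  have *: "(\<exists>a. x = Atom a \<and> (\<exists>b. y = Atom b \<and> z = Atom (F a b)))
      \<or> \<not> ((\<exists>a. x = Atom a) \<and> (\<exists>b. y = Atom b)) \<and> (\<nexists>a. z = Atom a) \<and> (\<forall>S. \<not> hf_mem S z)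
      \<longleftrightarrow> z = hf_lift2 F x y" for F x y and z :: "'c hf"
    by (cases x; cases y; cases z) auto
  show ?case
    by (rule exI[of _ "HDisj ?AA (HConj ?AN ?N)"]) (simp add: m F F' * del: not_ex de_Morgan_conj)
qed

lemma hf_term2_add:
  assumes "hf_term2 f f'" "hf_term2 g g'"
  shows "hf_term2 (\<lambda>s. hf_lift2 (+) (f s) (g s)) (\<lambda>s. hf_lift2 (+) (f' s) (g' s))"
  by (rule hf_term2_lift2_aux[of "RAdd (RVar 0) (RVar 1)", OF _ _ assms]) simp_all

lemma hf_term2_mult:
  assumes "hf_term2 f f'" "hf_term2 g g'"
  shows "hf_term2 (\<lambda>s. hf_lift2 (*) (f s) (g s)) (\<lambda>s. hf_lift2 (*) (f' s) (g' s))"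
  by (rule hf_term2_lift2_aux[of "RMul (RVar 0) (RVar 1)", OF _ _ assms]) simp_all

lemma hf_term2_const_atom:
  assumes "\<And>e. ring_term_val e T = a" "\<And>e. ring_term_val e T = b"
  shows "hf_term2 (\<lambda>s. Atom a) (\<lambda>s. Atom b)"
  unfolding hf_term2_def
proof (rule hf_def2I, goal_cases)
  case (1 f)
  from 1 obtain m where "\<And>i. f i \<noteq> m" by (rule obtain_fresh) blast
  then show ?case
    by (intro exI[of _ "HIsAtom T m (f 0)"]) (simp add: assms)
qed

lemma hf_term2_zero: "hf_term2 (\<lambda>s. Atom 0) (\<lambda>s. Atom 0)"
  by (rule hf_term2_const_atom[of RZero]) simp_all

lemma hf_term2_one: "hf_term2 (\<lambda>s. Atom 1) (\<lambda>s. Atom 1)"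
  by (rule hf_term2_const_atom[of ROne]) simp_all

lemmas hf_def2_intros = hf_def2_not hf_def2_conj hf_def2_disj hf_def2_imp hf_def2_iff
  hf_def2_ex hf_def2_all hf_def2_eq hf_def2_mem hf_def2_is_atom
lemmas hf_term2_intros = hf_term2_var hf_term2_add hf_term2_mult hf_term2_zero hf_term2_one

section \<open>Insertion, pairs and numerals\<close>

definition hinsert :: "'k hf \<Rightarrow> 'k hf \<Rightarrow> 'k hf" where
  "hinsert x y = HSet (finsert x (case y of Atom a \<Rightarrow> {||} | HSet F \<Rightarrow> F))"

lemma hf_mem_hinsert [simp]: "hf_mem z (hinsert x y) \<longleftrightarrow> z = x \<or> hf_mem z y"
  by (cases y) (auto simp: hinsert_def)

lemma not_is_atom_hinsert [simp]: "\<not> is_atom (hinsert x y)"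
  by (auto simp: hinsert_def is_atom_def)

lemma hf_eqI:
  assumes "\<not> is_atom x" "\<not> is_atom y" "\<And>z. hf_mem z x \<longleftrightarrow> hf_mem z y" shows "x = y"
  using assms by (cases x; cases y) (auto simp: is_atom_def)

lemma hf_term2_empty: "hf_term2 (\<lambda>s. HSet {||}) (\<lambda>s. HSet {||})"
proof -
  have *: "z = HSet {||} \<longleftrightarrow> \<not> is_atom z \<and> (\<forall>S. \<not> hf_mem S z)" for z :: "'c hf"
    by (cases z) (auto simp: is_atom_def)
  show ?thesis
    unfolding hf_term2_def * by (intro hf_def2_intros hf_term2_intros)
qed

lemma hf_term2_hinsert:
  assumes "hf_term2 f f'" "hf_term2 g g'"
  shows "hf_term2 (\<lambda>s. hinsert (f s) (g s)) (\<lambda>s. hinsert (f' s) (g' s))"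
proof (rule hf_term2_fun2[OF _ assms])
  have *: "z = hinsert x y \<longleftrightarrow> \<not> is_atom z \<and> (\<forall>u. hf_mem u z \<longleftrightarrow> u = x \<or> hf_mem u y)" for x y z :: "'c hf"
    using hf_eqI[of z "hinsert x y"] by auto
  show "hf_def2 (\<lambda>s :: nat \<Rightarrow> 'a hf. s 2 = hinsert (s 0) (s 1)) (\<lambda>s :: nat \<Rightarrow> 'b hf. s 2 = hinsert (s 0) (s 1))"
    unfolding * by (intro hf_def2_intros hf_term2_intros)
qed

text \<open>The Kuratowski pair.\<close>

definition hpair :: "'k hf \<Rightarrow> 'k hf \<Rightarrow> 'k hf" where
  "hpair x y = hinsert (hinsert x (HSet {||})) (hinsert (hinsert x (hinsert y (HSet {||}))) (HSet {||}))"

lemma hinsert_singleton_iff: "hinsert x (HSet {||}) = hinsert y (HSet {||}) \<longleftrightarrow> x = y"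
  by (auto simp: hinsert_def)

lemma hinsert_doubleton_iff:
  "hinsert x (hinsert y (HSet {||})) = hinsert u (hinsert v (HSet {||})) \<longleftrightarrow>
    x = u \<and> y = v \<or> x = v \<and> y = u" (is "?l = ?r \<longleftrightarrow> _")
proof -
  have "?l = ?r \<longleftrightarrow> (\<forall>z. hf_mem z ?l \<longleftrightarrow> hf_mem z ?r)"
    using hf_eqI[of ?l ?r] by (metis not_is_atom_hinsert)
  also have "\<dots> \<longleftrightarrow> (\<forall>z. z = x \<or> z = y \<longleftrightarrow> z = u \<or> z = v)" by simp
  finally show ?thesis by metis
qed

lemma hinsert_absorb [simp]: "hinsert x (hinsert x y) = hinsert x y"
  by (simp add: hinsert_def)

lemma hpair_eq_iff [simp]: "hpair x y = hpair x' y' \<longleftrightarrow> x = x' \<and> y = y'"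
proof
  have single: "hinsert x (HSet {||}) = hinsert u (hinsert v (HSet {||})) \<longleftrightarrow> u = x \<and> v = x" for u v x :: "'a hf"
    using hinsert_doubleton_iff[of x x u v] by auto
  have single': "hinsert u (hinsert v (HSet {||})) = hinsert x (HSet {||}) \<longleftrightarrow> u = x \<and> v = x" for u v x :: "'a hf"
    using single[of x u v] by auto
  assume "hpair x y = hpair x' y'"
  then show "x = x' \<and> y = y'"
    unfolding hpair_def hinsert_doubleton_iff hinsert_singleton_iff single single' by metis
qed simp

lemma hf_term2_hpair:
  "hf_term2 f f' \<Longrightarrow> hf_term2 g g' \<Longrightarrow> hf_term2 (\<lambda>s. hpair (f s) (g s)) (\<lambda>s. hpair (f' s) (g' s))"
  unfolding hpair_def by (intro hf_term2_hinsert hf_term2_empty)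

text \<open>Zermelo's numerals; they serve as tags of codes and as letters.\<close>

primrec hnum :: "nat \<Rightarrow> 'k hf" where
  "hnum 0 = HSet {||}"
| "hnum (Suc n) = hinsert (hnum n) (HSet {||})"

lemma hnum_eq_iff [simp]: "hnum m = hnum n \<longleftrightarrow> m = n"
proof (induction m arbitrary: n)
  case 0
  then show ?case by (cases n) (auto simp: hinsert_def)
next
  case (Suc m)
  then show ?case by (cases n) (auto simp: hinsert_def)
qed

lemma hf_term2_hnum: "hf_term2 (\<lambda>s. hnum n) (\<lambda>s. hnum n)"
  by (induction n) (simp_all add: hf_term2_empty hf_term2_hinsert)

subsection \<open>Interpreting the free algebra in the hereditarily finite sets\<close>

text \<open>Every rule has exactly two premises; one with a single premise is entered with
  \<open>p = q\<close>.\<close>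

inductive derivable :: "('j \<Rightarrow> bool) \<Rightarrow> ('j \<Rightarrow> 'j \<Rightarrow> 'j \<Rightarrow> bool) \<Rightarrow> 'j \<Rightarrow> bool" for ax rl where
  axiom: "ax y \<Longrightarrow> derivable ax rl y"
| rule: "rl y p q \<Longrightarrow> derivable ax rl p \<Longrightarrow> derivable ax rl q \<Longrightarrow> derivable ax rl y"

definition derivation_set ::
  "('k hf \<Rightarrow> bool) \<Rightarrow> ('k hf \<Rightarrow> 'k hf \<Rightarrow> 'k hf \<Rightarrow> bool) \<Rightarrow> 'k hf \<Rightarrow> bool" where
  "derivation_set ax rl S \<longleftrightarrow> (\<forall>r y. hf_mem (hpair r y) S \<longrightarrow> ax y \<or> (\<exists>p q. rl y p q
     \<and> (\<exists>r'. hf_mem r' r \<and> hf_mem (hpair r' p) S) \<and> (\<exists>r'. hf_mem r' r \<and> hf_mem (hpair r' q) S)))"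

text \<open>
  Each judgement of a finite derivation is paired with a hereditarily finite rank, and the
  ranks of its premises belong to its own rank; well-foundedness of membership then replaces
  the well-foundedness of derivation trees.
\<close>

lemma derivable_iff:
  "derivable ax rl y \<longleftrightarrow> (\<exists>S r. derivation_set ax rl S \<and> hf_mem (hpair r y) S)"
proof
  assume "derivable ax rl y"
  then show "\<exists>S r. derivation_set ax rl S \<and> hf_mem (hpair r y) S"
  proof induction
    case (axiom y)
    then show ?case
      by (intro exI[of _ "hinsert (hpair (HSet {||}) y) (HSet {||})"] exI[of _ "HSet {||}"])
        (simp add: derivation_set_def)
  next
    case (rule y p q)
    then obtain S1 r1 S2 r2 where S1: "derivation_set ax rl S1" "hf_mem (hpair r1 p) S1"
      and S2: "derivation_set ax rl S2" "hf_mem (hpair r2 q) S2" by blast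
    let ?r = "hinsert r1 (hinsert r2 (HSet {||}))"
    obtain F1 F2 where F: "S1 = HSet F1" "S2 = HSet F2" using S1(2) S2(2) by (cases S1; cases S2) auto
    let ?S = "hinsert (hpair ?r y) (HSet (F1 |\<union>| F2))"
    have mem: "hf_mem z ?S \<longleftrightarrow> z = hpair ?r y \<or> hf_mem z S1 \<or> hf_mem z S2" for z
      by (auto simp: F)
    \<comment> \<open>An entry asks only for the existence of premises in the set, so the old
      entries stay justified in the union.\<close>
    have "derivation_set ax rl ?S"
      unfolding derivation_set_def mem
    proof (intro allI impI, goal_cases)
      case (1 r z)
      then consider "r = ?r" "z = y" | "hf_mem (hpair r z) S1" | "hf_mem (hpair r z) S2" by auto
      then show ?case
      proof cases
        case 1
        have "hf_mem r1 r" "hf_mem r2 r" by (simp_all add: 1)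
        then show ?thesis using 1(2) rule.hyps(1) S1(2) S2(2) by blast
      next
        case 2
        then show ?thesis using S1(1) unfolding derivation_set_def by blast
      next
        case 3
        then show ?thesis using S2(1) unfolding derivation_set_def by blast
      qed
    qed
    then show ?case using mem by blast
  qed
next
  assume "\<exists>S r. derivation_set ax rl S \<and> hf_mem (hpair r y) S"
  then obtain S r where S: "derivation_set ax rl S" and "hf_mem (hpair r y) S" by blast
  from this(2) show "derivable ax rl y"
  proof (induction r arbitrary: y)
    case (Atom a)
    have "\<not> hf_mem x (Atom a)" for x :: "'a hf" by simp
    then show ?case using S Atom.prems unfolding derivation_set_def by (meson derivable.axiom)
  next
    case (HSet F)
    have IH: "derivable ax rl p" if "hf_mem r' (HSet F)" "hf_mem (hpair r' p) S" for r' p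
      using that HSet.IH[of r' p] by simp
    from S HSet.prems have "ax y \<or> (\<exists>p q. rl y p q
     \<and> (\<exists>r'. hf_mem r' (HSet F) \<and> hf_mem (hpair r' p) S) \<and> (\<exists>r'. hf_mem r' (HSet F) \<and> hf_mem (hpair r' q) S))"
      unfolding derivation_set_def by blast
    then show ?case
    proof
      assume "ax y" then show ?thesis by (rule derivable.axiom)
    next
      assume "\<exists>p q. rl y p q
        \<and> (\<exists>r'. hf_mem r' (HSet F) \<and> hf_mem (hpair r' p) S) \<and> (\<exists>r'. hf_mem r' (HSet F) \<and> hf_mem (hpair r' q) S)"
      then obtain p q where "rl y p q" "derivable ax rl p" "derivable ax rl q" using IH by blast
      then show ?thesis by (rule derivable.rule)
    qed
  qed
qed

lemma hf_def2_derivable: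
  assumes ax: "hf_def2 (\<lambda>s. ax (s 0)) (\<lambda>s. ax' (s 0))"
    and rl: "hf_def2 (\<lambda>s. rl (s 0) (s 1) (s 2)) (\<lambda>s. rl' (s 0) (s 1) (s 2))"
    and "hf_term2 f f'"
  shows "hf_def2 (\<lambda>s. derivable ax rl (f s)) (\<lambda>s. derivable ax' rl' (f' s))"
proof (rule hf_def2_rel1[OF _ assms(3)])
  show "hf_def2 (\<lambda>s. derivable ax rl (s 0)) (\<lambda>s. derivable ax' rl' (s 0))"
    unfolding derivable_iff derivation_set_def
    by (intro hf_def2_intros hf_term2_intros hf_term2_hpair hf_def2_rel1[OF ax] hf_def2_rel3[OF rl])
qed

section \<open>Terms and the calculus of their coefficients\<close>

lemma hpair_neq_empty [simp]: "hpair x y \<noteq> HSet {||}" "HSet {||} \<noteq> hpair x y"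
  by (auto simp: hpair_def hinsert_def)

text \<open>Letters are arbitrary hereditarily finite sets, so that any definable set of these can
  serve as a free basis.\<close>

datatype 'k trm = TC 'k | TL "'k hf" | TA "'k trm" "'k trm" | TM "'k trm" "'k trm"

definition enc_const :: "'k hf \<Rightarrow> 'k hf" where "enc_const c = hpair (hnum 0) c"
definition enc_letter :: "'k hf \<Rightarrow> 'k hf" where "enc_letter g = hpair (hnum 1) g"
definition enc_sum :: "'k hf \<Rightarrow> 'k hf \<Rightarrow> 'k hf" where "enc_sum x y = hpair (hnum 2) (hpair x y)"
definition enc_prod :: "'k hf \<Rightarrow> 'k hf \<Rightarrow> 'k hf" where "enc_prod x y = hpair (hnum 3) (hpair x y)"

lemmas enc_defs = enc_const_def enc_letter_def enc_sum_def enc_prod_def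

lemma hf_term2_enc:
  "hf_term2 f f' \<Longrightarrow> hf_term2 (\<lambda>s. enc_const (f s)) (\<lambda>s. enc_const (f' s))"
  "hf_term2 f f' \<Longrightarrow> hf_term2 (\<lambda>s. enc_letter (f s)) (\<lambda>s. enc_letter (f' s))"
  "hf_term2 f f' \<Longrightarrow> hf_term2 g g' \<Longrightarrow> hf_term2 (\<lambda>s. enc_sum (f s) (g s)) (\<lambda>s. enc_sum (f' s) (g' s))"
  "hf_term2 f f' \<Longrightarrow> hf_term2 g g' \<Longrightarrow> hf_term2 (\<lambda>s. enc_prod (f s) (g s)) (\<lambda>s. enc_prod (f' s) (g' s))"
  unfolding enc_defs by (intro hf_term2_hpair hf_term2_hnum; assumption)+

primrec enc :: "'k trm \<Rightarrow> 'k hf" where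
  "enc (TC a) = enc_const (Atom a)"
| "enc (TL g) = enc_letter g"
| "enc (TA t u) = enc_sum (enc t) (enc u)"
| "enc (TM t u) = enc_prod (enc t) (enc u)"

lemma enc_eq_iff [simp]: "enc t = enc u \<longleftrightarrow> t = u"
proof (induction t arbitrary: u)
  case (TC a) then show ?case by (cases u) (auto simp: enc_defs simp del: hnum.simps)
next
  case (TL g) then show ?case by (cases u) (auto simp: enc_defs simp del: hnum.simps)
next
  case (TA t1 t2) then show ?case by (cases u) (auto simp: enc_defs simp del: hnum.simps)
next
  case (TM t1 t2) then show ?case by (cases u) (auto simp: enc_defs simp del: hnum.simps)
qed

primrec enc_list :: "'k hf list \<Rightarrow> 'k hf" where
  "enc_list [] = HSet {||}"
| "enc_list (x # xs) = hpair x (enc_list xs)"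

lemma enc_list_eq_iff [simp]: "enc_list xs = enc_list ys \<longleftrightarrow> xs = ys"
proof (induction xs arbitrary: ys)
  case Nil then show ?case by (cases ys) auto
next
  case (Cons x xs) then show ?case by (cases ys) auto
qed

lemma enc_list_eq_hpair_iff:
  "enc_list zs = hpair x y \<longleftrightarrow> (\<exists>xs. zs = x # xs \<and> y = enc_list xs)"
  "hpair x y = enc_list zs \<longleftrightarrow> (\<exists>xs. zs = x # xs \<and> y = enc_list xs)"
  by (cases zs; auto)+

lemma enc_list_eq_empty_iff: "enc_list zs = HSet {||} \<longleftrightarrow> zs = []"
  by (cases zs) auto

primrec trm_val :: "'k trm \<Rightarrow> ('k hf, 'k::field) ncpoly" where
  "trm_val (TC a) = cst a"
| "trm_val (TL g) = var g"
| "trm_val (TA t u) = trm_val t + trm_val u"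
| "trm_val (TM t u) = trm_val t * trm_val u"

primrec trm_letters :: "'k trm \<Rightarrow> 'k hf set" where
  "trm_letters (TC a) = {}"
| "trm_letters (TL g) = {g}"
| "trm_letters (TA t u) = trm_letters t \<union> trm_letters u"
| "trm_letters (TM t u) = trm_letters t \<union> trm_letters u"

primrec trm_size :: "'k trm \<Rightarrow> nat" where
  "trm_size (TC a) = 1"
| "trm_size (TL g) = 1"
| "trm_size (TA t u) = trm_size t + trm_size u + 1"
| "trm_size (TM t u) = trm_size t + trm_size u + 1"

lemma is_atom_Atom [simp]: "is_atom (Atom a)"
  by (simp add: is_atom_def)

text \<open>
  The judgement \<open>coeff_judgement w ts a\<close> says that \<open>a\<close> is the coefficient at the word \<open>w\<close> of the
  product of the list \<open>ts\<close> of terms; the rules decompose the first factor.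
\<close>

definition coeff_judgement :: "'k hf \<Rightarrow> 'k hf \<Rightarrow> 'k hf \<Rightarrow> 'k hf" where
  "coeff_judgement w ts a = hpair w (hpair ts a)"

lemma coeff_judgement_eq_iff [simp]:
  "coeff_judgement w ts a = coeff_judgement w' ts' a' \<longleftrightarrow> w = w' \<and> ts = ts' \<and> a = a'"
  by (simp add: coeff_judgement_def)

definition coeff_axiom :: "'k::field hf \<Rightarrow> bool" where
  "coeff_axiom y \<longleftrightarrow> y = coeff_judgement (HSet {||}) (HSet {||}) (Atom 1)"

text \<open>A product is unfolded into two entries of the list of factors, so that no sum over the
  cuts of the word occurs. In the clauses with value \<open>Atom 0\<close> the coefficient of the
  premise is discarded; the premise certifies that the remaining word and list are genuine
  codes.\<close>

definition coeff_rule :: "'k::field hf set \<Rightarrow> 'k hf \<Rightarrow> 'k hf \<Rightarrow> 'k hf \<Rightarrow> bool" where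
  "coeff_rule G y p q \<longleftrightarrow>
     (\<exists>x w a. y = coeff_judgement (hpair x w) (HSet {||}) (Atom 0)
        \<and> p = coeff_judgement w (HSet {||}) a \<and> q = p)
   \<or> (\<exists>c w ts a. is_atom c \<and> y = coeff_judgement w (hpair (enc_const c) ts) (hf_lift2 (*) c a)
        \<and> p = coeff_judgement w ts a \<and> q = p)
   \<or> (\<exists>g w ts a. g \<in> G \<and> y = coeff_judgement (hpair g w) (hpair (enc_letter g) ts) a
        \<and> p = coeff_judgement w ts a \<and> q = p)
   \<or> (\<exists>g w ts a. g \<in> G \<and> \<not> (\<exists>v. w = hpair g v)
        \<and> y = coeff_judgement w (hpair (enc_letter g) ts) (Atom 0)
        \<and> p = coeff_judgement w ts a \<and> q = p)
   \<or> (\<exists>t u w ts a b. y = coeff_judgement w (hpair (enc_sum t u) ts) (hf_lift2 (+) a b)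
        \<and> p = coeff_judgement w (hpair t ts) a \<and> q = coeff_judgement w (hpair u ts) b)
   \<or> (\<exists>t u w ts a. y = coeff_judgement w (hpair (enc_prod t u) ts) a
        \<and> p = coeff_judgement w (hpair t (hpair u ts)) a \<and> q = p)"

abbreviation has_coeff :: "'k::field hf set \<Rightarrow> 'k hf \<Rightarrow> 'k hf \<Rightarrow> 'k hf \<Rightarrow> bool" where
  "has_coeff G w ts a \<equiv> derivable coeff_axiom (coeff_rule G) (coeff_judgement w ts a)"

lemma hf_term2_coeff_judgement:
  "hf_term2 f f' \<Longrightarrow> hf_term2 g g' \<Longrightarrow> hf_term2 h h' \<Longrightarrow>
   hf_term2 (\<lambda>s. coeff_judgement (f s) (g s) (h s)) (\<lambda>s. coeff_judgement (f' s) (g' s) (h' s))"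
  unfolding coeff_judgement_def by (intro hf_term2_hpair)

lemma hf_def2_has_coeff:
  assumes G: "hf_def2 (\<lambda>s. s 0 \<in> G) (\<lambda>s. s 0 \<in> G')"
    and "hf_term2 f f'" "hf_term2 g g'" "hf_term2 h h'"
  shows "hf_def2 (\<lambda>s. has_coeff G (f s) (g s) (h s)) (\<lambda>s. has_coeff G' (f' s) (g' s) (h' s))"
proof (rule hf_def2_derivable[OF _ _ hf_term2_coeff_judgement[OF assms(2-4)]])
  show "hf_def2 (\<lambda>s :: nat \<Rightarrow> 'a hf. coeff_axiom (s 0)) (\<lambda>s :: nat \<Rightarrow> 'b hf. coeff_axiom (s 0))"
    unfolding coeff_axiom_def
    by (intro hf_def2_intros hf_term2_intros hf_term2_coeff_judgement hf_term2_empty)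
  show "hf_def2 (\<lambda>s. coeff_rule G (s 0) (s 1) (s 2)) (\<lambda>s. coeff_rule G' (s 0) (s 1) (s 2))"
    unfolding coeff_rule_def
    by (intro hf_def2_intros hf_term2_intros hf_term2_coeff_judgement hf_term2_empty hf_term2_hpair
        hf_term2_enc hf_def2_rel1[of "\<lambda>x. x \<in> G" "\<lambda>x. x \<in> G'", OF G])
qed

text \<open>Besides the correct value, the induction yields that a derivable judgement is about
  codes of a word and of terms over \<open>G\<close>; this later makes the set of codes
  definable.\<close>

lemma has_coeff_sound:
  assumes "derivable coeff_axiom (coeff_rule G) y"
  shows "\<exists>w ts. y = coeff_judgement (enc_list w) (enc_list (map enc ts))
      (Atom (coeff (prod_list (map trm_val ts)) w)) \<and> (\<forall>t\<in>set ts. trm_letters t \<subseteq> G)"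
  using assms
proof induction
  case (axiom y)
  then show ?case
    by (intro exI[of _ "[]"]) (simp add: coeff_axiom_def)
next
  case (rule y p q)
  let ?J = "\<lambda>w ts. coeff_judgement (enc_list w) (enc_list (map enc ts))
      (Atom (coeff (prod_list (map trm_val ts)) w))"
  let ?G = "\<lambda>ts. \<forall>t\<in>set ts. trm_letters t \<subseteq> G"
  obtain w ts w' ts' where p: "p = ?J w ts" "?G ts" and q: "q = ?J w' ts'" "?G ts'"
    using rule.IH by blast
  from rule.hyps(1) consider
      (nil) x where "y = coeff_judgement (hpair x (enc_list w)) (HSet {||}) (Atom 0)" "ts = []"
    | (const) c where "y = coeff_judgement (enc_list w) (hpair (enc_const (Atom c)) (enc_list (map enc ts)))
          (Atom (c * coeff (prod_list (map trm_val ts)) w))"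
    | (letter) g where "g \<in> G" "y = coeff_judgement (hpair g (enc_list w))
          (hpair (enc_letter g) (enc_list (map enc ts))) (Atom (coeff (prod_list (map trm_val ts)) w))"
    | (other) g where "g \<in> G" "\<not> (\<exists>v. enc_list w = hpair g v)"
          "y = coeff_judgement (enc_list w) (hpair (enc_letter g) (enc_list (map enc ts))) (Atom 0)"
    | (sum) t u us where "ts = t # us" "ts' = u # us" "w' = w"
          "y = coeff_judgement (enc_list w) (hpair (enc_sum (enc t) (enc u)) (enc_list (map enc us)))
            (Atom (coeff (prod_list (map trm_val ts)) w + coeff (prod_list (map trm_val ts')) w))"
    | (prod) t u us where "ts = t # u # us"
          "y = coeff_judgement (enc_list w) (hpair (enc_prod (enc t) (enc u)) (enc_list (map enc us)))
            (Atom (coeff (prod_list (map trm_val ts)) w))"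
    unfolding coeff_rule_def p(1) q(1)
  proof (elim disjE exE conjE, goal_cases)
    case (1 x v a)
    show ?case by (rule nil[of x]) (use 1(7,8) in \<open>simp_all add: enc_list_eq_empty_iff\<close>)
  next
    case (2 c v us a)
    obtain c' where "c = Atom c'" using 2(7) by (auto simp: is_atom_def)
    show ?case by (rule const[of c']) (use 2(8,9) \<open>c = Atom c'\<close> in auto)
  next
    case (3 g v us a)
    show ?case by (rule letter[of g]) (use 3(7-9) in simp_all)
  next
    case (4 g v us a)
    show ?case by (rule other[of g]) (use 4(7-10) in simp_all)
  next
    case (5 t u v us a b)
    from 5(8,9) obtain t' u' us' us'' where *: "ts = t' # us'" "t = enc t'" "us = enc_list (map enc us')"
      "ts' = u' # us''" "u = enc u'" "us = enc_list (map enc us'')"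
      by (auto simp: enc_list_eq_hpair_iff map_eq_Cons_conv)
    \<comment> \<open>Injectivity of \<open>enc\<close> forces the two premises to share the
      remaining factors.\<close>
    then have "map enc us'' = map enc us'" by simp
    then have "us'' = us'" by (rule map_injective) (simp add: inj_on_def)
    show ?case by (rule sum[of t' us' u']) (use 5(7-9) * \<open>us'' = us'\<close> in auto)
  next
    case (6 t u v us a)
    from 6(8) obtain t' u' us' where *: "ts = t' # u' # us'" "t = enc t'" "u = enc u'" "us = enc_list (map enc us')"
      by (auto simp: enc_list_eq_hpair_iff map_eq_Cons_conv)
    show ?case by (rule prod[of t' u' us']) (use 6(7,8) * in auto)
  qed
  then show ?case
  proof cases
    case nil
    then show ?thesis by (intro exI[of _ "x # w"] exI[of _ "[]"]) simp
  next
    case const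
    then show ?thesis using p(2) by (intro exI[of _ w] exI[of _ "TC c # ts"]) simp
  next
    case letter
    then show ?thesis using p(2)
      by (intro exI[of _ "g # w"] exI[of _ "TL g # ts"]) simp
  next
    case other
    then have "coeff (var g * r) w = 0" for r by (cases w) auto
    with other show ?thesis using p(2) by (intro exI[of _ w] exI[of _ "TL g # ts"]) simp
  next
    case sum
    then show ?thesis using p(2) q(2)
      by (intro exI[of _ w] exI[of _ "TA t u # us"]) (simp add: distrib_right lookup_add)
  next
    case prod
    then show ?thesis using p(2)
      by (intro exI[of _ w] exI[of _ "TM t u # us"]) (simp add: mult.assoc)
  qed
qed

lemma has_coeff_intros:
  "has_coeff G (HSet {||}) (HSet {||}) (Atom 1)"
  "has_coeff G w (HSet {||}) a \<Longrightarrow> has_coeff G (hpair x w) (HSet {||}) (Atom 0)"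
  "has_coeff G w ts a \<Longrightarrow> has_coeff G w (hpair (enc_const (Atom c)) ts) (hf_lift2 (*) (Atom c) a)"
  "has_coeff G w ts a \<Longrightarrow> g \<in> G \<Longrightarrow> has_coeff G (hpair g w) (hpair (enc_letter g) ts) a"
  "has_coeff G w ts a \<Longrightarrow> g \<in> G \<Longrightarrow> \<nexists>v. w = hpair g v \<Longrightarrow> has_coeff G w (hpair (enc_letter g) ts) (Atom 0)"
  "has_coeff G w (hpair t ts) a \<Longrightarrow> has_coeff G w (hpair u ts) b \<Longrightarrow> has_coeff G w (hpair (enc_sum t u) ts) (hf_lift2 (+) a b)"
  "has_coeff G w (hpair t (hpair u ts)) a \<Longrightarrow> has_coeff G w (hpair (enc_prod t u) ts) a"
  subgoal by (rule derivable.axiom) (simp add: coeff_axiom_def)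
  subgoal by (rule derivable.rule[where p = "coeff_judgement w (HSet {||}) a" and q = "coeff_judgement w (HSet {||}) a"])
      (simp_all add: coeff_rule_def enc_defs del: hnum.simps)
  subgoal by (rule derivable.rule[where p = "coeff_judgement w ts a" and q = "coeff_judgement w ts a"])
      (simp_all add: coeff_rule_def enc_defs del: hnum.simps)
  subgoal by (rule derivable.rule[where p = "coeff_judgement w ts a" and q = "coeff_judgement w ts a"])
      (simp_all add: coeff_rule_def enc_defs del: hnum.simps)
  subgoal by (rule derivable.rule[where p = "coeff_judgement w ts a" and q = "coeff_judgement w ts a"])
      (simp_all add: coeff_rule_def enc_defs del: hnum.simps)
  subgoal by (rule derivable.rule[where p = "coeff_judgement w (hpair t ts) a" and q = "coeff_judgement w (hpair u ts) b"])
      (simp_all add: coeff_rule_def enc_defs del: hnum.simps)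
  subgoal by (rule derivable.rule[where p = "coeff_judgement w (hpair t (hpair u ts)) a"
          and q = "coeff_judgement w (hpair t (hpair u ts)) a"])
      (simp_all add: coeff_rule_def enc_defs del: hnum.simps)
  done

lemma has_coeff_complete:
  assumes "\<forall>t\<in>set ts. trm_letters t \<subseteq> G"
  shows "has_coeff G (enc_list w) (enc_list (map enc ts)) (Atom (coeff (prod_list (map trm_val ts)) w))"
  using assms
\<comment> \<open>Unfolding a product lowers the total size by the one counted for its node, a sum
  passes to one summand, a letter or constant removes a factor of positive size, and with no factors
  left the word is shortened.\<close>
proof (induction "sum_list (map trm_size ts) + length w" arbitrary: ts w rule: less_induct)
  case less
  show ?case
  proof (cases ts)
    case Nil
    show ?thesis
    proof (cases w)
      case Nil
      then show ?thesis using \<open>ts = []\<close> by (simp add: has_coeff_intros(1))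
    next
      case (Cons x v)
      have "has_coeff G (enc_list v) (enc_list (map enc [])) (Atom (coeff (prod_list (map trm_val [])) v))"
        by (rule less.hyps) (simp_all add: Cons Nil)
      then show ?thesis by (simp add: Nil Cons has_coeff_intros(2))
    qed
  next
    case (Cons t us)
    note ts = Cons
    have us: "\<forall>t\<in>set us. trm_letters t \<subseteq> G" using less.prems ts by simp
    have pos: "trm_size t > 0" by (cases t) auto
    have IH_us: "has_coeff G (enc_list v) (enc_list (map enc us)) (Atom (coeff (prod_list (map trm_val us)) v))"
      if "length v \<le> length w" for v
      by (rule less.hyps) (use us that ts pos in auto)
    show ?thesis
    proof (cases t)
      case (TC c)
      show ?thesis
        using has_coeff_intros(3)[OF IH_us, of w c] by (simp add: ts TC)
    next
      case (TL g)
      then have g: "g \<in> G" using less.prems ts by simp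
      show ?thesis
      proof (cases "\<exists>v. w = g # v")
        case True
        then obtain v where v: "w = g # v" by blast
        show ?thesis
          using has_coeff_intros(4)[OF IH_us g, of v] by (simp add: ts TL v)
      next
        case False
        then have *: "coeff (var g * r) w = 0" for r by (cases w) auto
        have "\<not> (\<exists>v. enc_list w = hpair g v)" using False by (cases w) auto
        then show ?thesis
          using has_coeff_intros(5)[OF IH_us g, of w] by (simp add: ts TL *)
      qed
    next
      case (TA t1 t2)
      have IH: "has_coeff G (enc_list w) (enc_list (map enc (t' # us))) (Atom (coeff (prod_list (map trm_val (t' # us))) w))"
        if "t' = t1 \<or> t' = t2" for t'
        by (rule less.hyps) (use less.prems us that ts TA in auto)
      show ?thesis
        using has_coeff_intros(6)[OF IH[of t1, simplified] IH[of t2, simplified]]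
        by (simp add: ts TA distrib_right lookup_add)
    next
      case (TM t1 t2)
      have IH: "has_coeff G (enc_list w) (enc_list (map enc (t1 # t2 # us)))
          (Atom (coeff (prod_list (map trm_val (t1 # t2 # us))) w))"
        by (rule less.hyps) (use less.prems us ts TM in auto)
      show ?thesis
        using has_coeff_intros(7)[OF IH[simplified]] by (simp add: ts TM mult.assoc)
    qed
  qed
qed

lemma has_coeff_singleton:
  assumes "trm_letters t \<subseteq> G"
  shows "has_coeff G w (hpair (enc t) (HSet {||})) a \<longleftrightarrow>
    (\<exists>v. w = enc_list v \<and> a = Atom (coeff (trm_val t) v))"
proof
  assume "has_coeff G w (hpair (enc t) (HSet {||})) a"
  from has_coeff_sound[OF this] obtain v ts where v: "w = enc_list v"
      "hpair (enc t) (HSet {||}) = enc_list (map enc ts)" "a = Atom (coeff (prod_list (map trm_val ts)) v)"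
    by auto
  then have "map enc ts = map enc [t]"
    by (metis enc_list.simps enc_list_eq_iff list.simps(8,9))
  then have "ts = [t]" by (rule map_injective) (simp add: inj_on_def)
  then show "\<exists>v. w = enc_list v \<and> a = Atom (coeff (trm_val t) v)" using v by auto
next
  assume "\<exists>v. w = enc_list v \<and> a = Atom (coeff (trm_val t) v)"
  then show "has_coeff G w (hpair (enc t) (HSet {||})) a"
    using has_coeff_complete[of "[t]" G] assms by auto
qed

text \<open>Only genuine codes receive a coefficient, and each receives one at the empty word; so
  the calculus itself recognises the codes.\<close>

definition is_code :: "'k::field hf set \<Rightarrow> 'k hf \<Rightarrow> bool" where
  "is_code G x \<longleftrightarrow> (\<exists>a. has_coeff G (HSet {||}) (hpair x (HSet {||})) a)"

definition code_equiv :: "'k::field hf set \<Rightarrow> 'k hf \<Rightarrow> 'k hf \<Rightarrow> bool" where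
  "code_equiv G x y \<longleftrightarrow> (\<forall>w a. has_coeff G w (hpair x (HSet {||})) a \<longleftrightarrow> has_coeff G w (hpair y (HSet {||})) a)"

definition codes :: "'k::field hf set \<Rightarrow> 'k hf \<Rightarrow> ('k hf, 'k) ncpoly \<Rightarrow> bool" where
  "codes G x p \<longleftrightarrow> (\<exists>t. trm_letters t \<subseteq> G \<and> x = enc t \<and> p = trm_val t)"

lemma is_code_iff: "is_code G x \<longleftrightarrow> (\<exists>p. codes G x p)"
proof
  assume "is_code G x"
  then obtain a where "has_coeff G (HSet {||}) (hpair x (HSet {||})) a" by (auto simp: is_code_def)
  from has_coeff_sound[OF this] show "\<exists>p. codes G x p"
    by (auto simp: codes_def enc_list_eq_hpair_iff map_eq_Cons_conv)
next
  assume "\<exists>p. codes G x p"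
  then obtain t where t: "trm_letters t \<subseteq> G" "x = enc t" by (auto simp: codes_def)
  have "has_coeff G (enc_list []) (hpair (enc t) (HSet {||})) (Atom (coeff (trm_val t) []))"
    using has_coeff_singleton[OF t(1)] by blast
  then show "is_code G x" unfolding is_code_def t(2) enc_list.simps by blast
qed

lemma code_equiv_iff:
  assumes "codes G x p" and "codes G y q"
  shows "code_equiv G x y \<longleftrightarrow> p = q"
proof
  obtain t u where t: "trm_letters t \<subseteq> G" "x = enc t" "p = trm_val t"
    and u: "trm_letters u \<subseteq> G" "y = enc u" "q = trm_val u"
    using assms by (auto simp: codes_def)
  note * = code_equiv_def t(2) u(2) has_coeff_singleton[OF t(1)] has_coeff_singleton[OF u(1)]
  show "p = q" if "code_equiv G x y"
  proof (rule ncpoly_eqI)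
    fix w
    have "\<exists>v. enc_list w = enc_list v \<and> Atom (coeff p w) = Atom (coeff q v)"
      using that unfolding * t(3) u(3) by blast
    then show "coeff p w = coeff q w" by auto
  qed
  show "code_equiv G x y" if "p = q"
    using that unfolding * t(3) u(3) by simp
qed

lemma codes_intros:
  "codes G (enc_const (Atom a)) (cst a)"
  "codes G x p \<Longrightarrow> codes G y q \<Longrightarrow> codes G (enc_sum x y) (p + q)"
  "codes G x p \<Longrightarrow> codes G y q \<Longrightarrow> codes G (enc_prod x y) (p * q)"
proof -
  show "codes G (enc_const (Atom a)) (cst a)"
    unfolding codes_def by (rule exI[of _ "TC a"]) simp
  assume "codes G x p" "codes G y q"
  then obtain t u where tu: "trm_letters t \<subseteq> G" "x = enc t" "p = trm_val t"
    "trm_letters u \<subseteq> G" "y = enc u" "q = trm_val u"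
    by (auto simp: codes_def)
  show "codes G (enc_sum x y) (p + q)"
    unfolding codes_def by (rule exI[of _ "TA t u"]) (simp add: tu)
  show "codes G (enc_prod x y) (p * q)"
    unfolding codes_def by (rule exI[of _ "TM t u"]) (simp add: tu)
qed

lemma ex_codes_iff: "(\<exists>x. codes G x p) \<longleftrightarrow> p \<in> free_algebra G"
proof
  assume "\<exists>x. codes G x p"
  then obtain t where "trm_letters t \<subseteq> G" "p = trm_val t" by (auto simp: codes_def)
  moreover have "trm_letters t \<subseteq> G \<Longrightarrow> trm_val t \<in> free_algebra G" for t
    by (induction t) (auto intro: free_algebra_closed var_in_free_algebra)
  ultimately show "p \<in> free_algebra G" by simp
next
  assume "p \<in> free_algebra G"
  then show "\<exists>x. codes G x p"
  proof (induction p rule: free_algebra_induct)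
    case zero
    show ?case using codes_intros(1)[of G 0] by auto
  next
    case (single w a)
    then show ?case
    proof (induction w)
      case Nil
      show ?case using codes_intros(1)[of G a] unfolding zero_fmonoid_def by blast
    next
      case (Cons g w)
      then obtain x where "codes G x (Poly_Mapping.single (FWord w) a)" by auto
      moreover have "codes G (enc_letter g) (var g)"
        unfolding codes_def using Cons.prems by (intro exI[of _ "TL g"]) simp
      ultimately have "codes G (enc_prod (enc_letter g) x) (var g * Poly_Mapping.single (FWord w) a)"
        by (rule codes_intros(3)[rotated])
      then show ?case by (auto simp: mult_single)
    qed
  next
    case (add p q)
    then show ?case using codes_intros(2) by blast
  qed
qed

text \<open>Ring operations become formal sums and products of codes; all computation is deferred to
  the comparison of coefficients in \<open>code_equiv\<close>.\<close>

primrec hf_of_ring_term :: "(nat \<Rightarrow> 'k::field hf) \<Rightarrow> ring_term \<Rightarrow> 'k hf" where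
  "hf_of_ring_term s (RVar n) = s n"
| "hf_of_ring_term s RZero = enc_const (Atom 0)"
| "hf_of_ring_term s ROne = enc_const (Atom 1)"
| "hf_of_ring_term s (RAdd t u) = enc_sum (hf_of_ring_term s t) (hf_of_ring_term s u)"
| "hf_of_ring_term s (RMul t u) = enc_prod (hf_of_ring_term s t) (hf_of_ring_term s u)"

lemma codes_hf_of_ring_term:
  assumes "\<And>n. n \<in> ring_term_vars t \<Longrightarrow> codes G (s n) (\<rho> n)"
  shows "codes G (hf_of_ring_term s t) (ring_term_val \<rho> t)"
  using assms codes_intros(1)[of G 0] codes_intros(1)[of G 1]
  by (induction t) (auto intro: codes_intros(2,3))

lemma hf_term2_hf_of_ring_term:
  "hf_term2 (\<lambda>s. hf_of_ring_term s t) (\<lambda>s. hf_of_ring_term s t)"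
  by (induction t) (simp_all, (intro hf_term2_intros hf_term2_enc; assumption)+)

lemma hf_def2_codes:
  assumes "hf_def2 (\<lambda>s. s 0 \<in> G) (\<lambda>s. s 0 \<in> G')"
  shows "hf_term2 f f' \<Longrightarrow> hf_def2 (\<lambda>s. is_code G (f s)) (\<lambda>s. is_code G' (f' s))"
    and "hf_term2 f f' \<Longrightarrow> hf_term2 g g' \<Longrightarrow> hf_def2 (\<lambda>s. code_equiv G (f s) (g s)) (\<lambda>s. code_equiv G' (f' s) (g' s))"
proof -
  have 1: "hf_def2 (\<lambda>s. is_code G (s 0)) (\<lambda>s. is_code G' (s 0))"
    unfolding is_code_def
    by (intro hf_def2_intros hf_term2_intros hf_term2_empty hf_term2_hpair hf_def2_has_coeff[OF assms])
  have 2: "hf_def2 (\<lambda>s. code_equiv G (s 0) (s 1)) (\<lambda>s. code_equiv G' (s 0) (s 1))"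
    unfolding code_equiv_def
    by (intro hf_def2_intros hf_term2_intros hf_term2_empty hf_term2_hpair hf_def2_has_coeff[OF assms])
  show "hf_term2 f f' \<Longrightarrow> hf_def2 (\<lambda>s. is_code G (f s)) (\<lambda>s. is_code G' (f' s))"
    by (rule hf_def2_rel1[OF 1])
  show "hf_term2 f f' \<Longrightarrow> hf_term2 g g' \<Longrightarrow> hf_def2 (\<lambda>s. code_equiv G (f s) (g s)) (\<lambda>s. code_equiv G' (f' s) (g' s))"
    by (rule hf_def2_rel2[OF 2])
qed

section \<open>Translating ring formulas into formulas about hereditarily finite sets\<close>

definition translates_ring_fm :: "'k::field hf set \<Rightarrow> ring_fm \<Rightarrow> hf_fm \<Rightarrow> bool" where
  "translates_ring_fm G \<psi> \<phi> \<longleftrightarrow> (\<forall>e s \<rho>. (\<forall>n\<in>ring_fm_vars \<psi>. codes G (s (2 * n)) (\<rho> n)) \<longrightarrow>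
     (hf_sat e s \<phi> \<longleftrightarrow> ring_sat (free_algebra G) \<rho> \<psi>))"

lemma translates_ring_fm_RConj:
  fixes G :: "'k::field hf set"
  assumes "translates_ring_fm G \<psi> \<phi>" and "translates_ring_fm G \<psi>' \<phi>'"
  shows "translates_ring_fm G (RConj \<psi> \<psi>') (HConj \<phi> \<phi>')"
  unfolding translates_ring_fm_def
proof (intro allI impI)
  fix e :: "nat \<Rightarrow> 'k" and s \<rho>
  assume "\<forall>m\<in>ring_fm_vars (RConj \<psi> \<psi>'). codes G (s (2 * m)) (\<rho> m)"
  then have "hf_sat e s \<phi> \<longleftrightarrow> ring_sat (free_algebra G) \<rho> \<psi>" "hf_sat e s \<phi>' \<longleftrightarrow> ring_sat (free_algebra G) \<rho> \<psi>'"
    using assms by (simp_all add: translates_ring_fm_def)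
  then show "hf_sat e s (HConj \<phi> \<phi>') \<longleftrightarrow> ring_sat (free_algebra G) \<rho> (RConj \<psi> \<psi>')"
    by simp
qed

text \<open>Quantification is relativised to codes. An element has many codes, but by the assumption
  on \<open>\<psi>\<close> the truth value depends only on the coded element, and every element over
  \<open>G\<close> has a code.\<close>

lemma translates_ring_fm_RAll:
  fixes G :: "'k::field hf set"
  assumes "translates_ring_fm G \<psi> \<phi>" and \<kappa>: "\<And>e s. hf_sat e s \<kappa> \<longleftrightarrow> is_code G (s (2 * n))"
  shows "translates_ring_fm G (RAll n \<psi>) (HAllSet (2 * n) (HImp \<kappa> \<phi>))"
  unfolding translates_ring_fm_def
proof (intro allI impI)
  fix e :: "nat \<Rightarrow> 'k" and s \<rho>
  assume *: "\<forall>m\<in>ring_fm_vars (RAll n \<psi>). codes G (s (2 * m)) (\<rho> m)"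
  have "hf_sat e (s(2 * n := x)) \<phi> \<longleftrightarrow> ring_sat (free_algebra G) (\<rho>(n := p)) \<psi>" if "codes G x p" for x p
    using assms(1) * that unfolding translates_ring_fm_def by auto
  then have "(\<forall>x. (\<exists>p. codes G x p) \<longrightarrow> hf_sat e (s(2 * n := x)) \<phi>) \<longleftrightarrow>
      (\<forall>p. (\<exists>x. codes G x p) \<longrightarrow> ring_sat (free_algebra G) (\<rho>(n := p)) \<psi>)"
    by blast
  then show "hf_sat e s (HAllSet (2 * n) (HImp \<kappa> \<phi>)) \<longleftrightarrow> ring_sat (free_algebra G) \<rho> (RAll n \<psi>)"
    by (simp add: \<kappa> is_code_iff ex_codes_iff Ball_def)
qed

lemma infinite_odd: "infinite (- range (\<lambda>i :: nat. 2 * i))"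
proof -
  have "range (\<lambda>i :: nat. 2 * i + 1) \<subseteq> - range (\<lambda>i :: nat. 2 * i)" by auto presburger
  moreover have "infinite (range (\<lambda>i :: nat. 2 * i + 1))"
    by (simp add: finite_image_iff inj_on_def)
  ultimately show ?thesis using infinite_super by blast
qed

text \<open>The codes of the ring variables occupy the even set variables; the odd ones supply bound
  variables for the formulas obtained from \<open>hf_def2\<close>, as doubling omits infinitely many
  indices.\<close>

lemma ex_translates_ring_fm:
  fixes G :: "'k1::field hf set" and G' :: "'k2::field hf set"
  assumes G: "hf_def2 (\<lambda>s. s 0 \<in> G) (\<lambda>s. s 0 \<in> G')"
  shows "\<exists>\<phi>. translates_ring_fm G \<psi> \<phi> \<and> translates_ring_fm G' \<psi> \<phi>"
proof (induction \<psi>)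
  case (REq t u)
  have "hf_def2 (\<lambda>s. code_equiv G (hf_of_ring_term s t) (hf_of_ring_term s u))
      (\<lambda>s. code_equiv G' (hf_of_ring_term s t) (hf_of_ring_term s u))"
    by (intro hf_def2_codes[OF G] hf_term2_hf_of_ring_term)
  from hf_def2E[OF this infinite_odd] obtain \<phi> where
    \<phi>: "\<And>e s. hf_sat e s \<phi> \<longleftrightarrow> code_equiv G (hf_of_ring_term (\<lambda>i. s (2 * i)) t) (hf_of_ring_term (\<lambda>i. s (2 * i)) u)"
      "\<And>e s. hf_sat e s \<phi> \<longleftrightarrow> code_equiv G' (hf_of_ring_term (\<lambda>i. s (2 * i)) t) (hf_of_ring_term (\<lambda>i. s (2 * i)) u)"
    by blast
  have "translates_ring_fm G (REq t u) \<phi>" "translates_ring_fm G' (REq t u) \<phi>"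
    unfolding translates_ring_fm_def \<phi>
    by (simp_all add: code_equiv_iff[OF codes_hf_of_ring_term codes_hf_of_ring_term])
  then show ?case by blast
next
  case (RNeg \<psi>)
  then obtain \<phi> where "translates_ring_fm G \<psi> \<phi>" "translates_ring_fm G' \<psi> \<phi>" by blast
  then show ?case by (intro exI[of _ "HNeg \<phi>"]) (simp add: translates_ring_fm_def)
next
  case (RConj \<psi> \<psi>')
  then obtain \<phi> \<phi>' where "translates_ring_fm G \<psi> \<phi>" "translates_ring_fm G' \<psi> \<phi>"
    "translates_ring_fm G \<psi>' \<phi>'" "translates_ring_fm G' \<psi>' \<phi>'" by blast
  then show ?case by (intro exI[of _ "HConj \<phi> \<phi>'"] conjI translates_ring_fm_RConj)
next
  case (RAll n \<psi>)
  then obtain \<phi> where "translates_ring_fm G \<psi> \<phi>" "translates_ring_fm G' \<psi> \<phi>" by blast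
  moreover obtain \<kappa> where "\<And>e s. hf_sat e s \<kappa> \<longleftrightarrow> is_code G (s (2 * n))" "\<And>e s. hf_sat e s \<kappa> \<longleftrightarrow> is_code G' (s (2 * n))"
    using hf_def2E[OF hf_def2_codes(1)[OF G hf_term2_var[of n]] infinite_odd] by blast
  ultimately show ?case
    by (intro exI[of _ "HAllSet (2 * n) (HImp \<kappa> \<phi>)"] conjI translates_ring_fm_RAll)
qed

lemma ring_elem_equiv_definable_letters:
  fixes G :: "'k1::field hf set" and G' :: "'k2::field hf set"
  assumes "hf_elem_equiv TYPE('k1) TYPE('k2)" and G: "hf_def2 (\<lambda>s. s 0 \<in> G) (\<lambda>s. s 0 \<in> G')"
  shows "ring_elem_equiv (free_algebra G :: ('k1 hf, 'k1) ncpoly set) (free_algebra G' :: ('k2 hf, 'k2) ncpoly set)"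
proof (rule ring_elem_equivI)
  fix \<psi> assume closed: "ring_fm_vars \<psi> = {}"
  obtain \<phi> where \<phi>: "translates_ring_fm G \<psi> \<phi>" "translates_ring_fm G' \<psi> \<phi>"
    using ex_translates_ring_fm[OF G] by blast
  have *: "hf_models TYPE('k) \<phi> \<longleftrightarrow> ring_models (free_algebra H :: ('k hf, 'k) ncpoly set) \<psi>"
    if "translates_ring_fm H \<psi> \<phi>" for H :: "'k::field hf set"
  proof -
    have "hf_sat e s \<phi> \<longleftrightarrow> ring_sat (free_algebra H) \<rho> \<psi>" for e :: "nat \<Rightarrow> 'k" and s and \<rho> :: "nat \<Rightarrow> ('k hf, 'k) ncpoly"
      using that closed by (simp add: translates_ring_fm_def)
    moreover have "range (\<lambda>_. 0) \<subseteq> (free_algebra H :: ('k hf, 'k) ncpoly set)"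
      by (auto simp: zero_in_free_algebra)
    ultimately show ?thesis unfolding hf_models_iff ring_models_def by blast
  qed
  show "ring_models (free_algebra G :: ('k1 hf, 'k1) ncpoly set) \<psi>
      \<longleftrightarrow> ring_models (free_algebra G' :: ('k2 hf, 'k2) ncpoly set) \<psi>"
    using *[OF \<phi>(1)] *[OF \<phi>(2)] hf_elem_equiv_models[OF assms(1), of \<phi>] by simp
qed

section \<open>Definable sets of letters of every rank\<close>

lemma ring_elem_equiv_trans:
  "ring_elem_equiv D E \<Longrightarrow> ring_elem_equiv E F \<Longrightarrow> ring_elem_equiv D F"
  by (simp add: ring_elem_equiv_def)

lemma hf_def2_hnum_less: "hf_def2 (\<lambda>s. s 0 \<in> hnum ` {..<n}) (\<lambda>s. s 0 \<in> hnum ` {..<n})"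
proof (induction n)
  case 0
  have *: "x \<in> hnum ` {..<0} \<longleftrightarrow> x \<noteq> x" for x :: "'c hf" by simp
  show ?case unfolding * by (intro hf_def2_intros hf_term2_intros)
next
  case (Suc n)
  show ?case
    unfolding lessThan_Suc image_insert insert_iff by (intro hf_def2_intros hf_term2_intros hf_term2_hnum Suc.IH)
qed

text \<open>The rank lemma replaces \<open>X\<close> and \<open>Y\<close>, each over its own field,
  by sets of letters that one formula defines over both fields: the first \<open>card X\<close>
  numerals, or all hereditarily finite sets if the rank is infinite.\<close>

theorem ring_elem_equiv_if_hf_elem_equiv:
  fixes X :: "'x set" and Y :: "'y set"
  assumes XY: "same_rank X Y" and equiv: "hf_elem_equiv TYPE('k1::field) TYPE('k2::field)"
  shows "ring_elem_equiv (free_algebra X :: ('x, 'k1) ncpoly set) (free_algebra Y :: ('y, 'k2) ncpoly set)"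
proof -
  have "\<exists>(G :: 'k1 hf set) (G' :: 'k2 hf set). hf_def2 (\<lambda>s. s 0 \<in> G) (\<lambda>s. s 0 \<in> G') \<and> same_rank X G \<and> same_rank G' Y"
  proof (cases "finite X")
    case True
    have "same_rank X (hnum ` {..<card X})" "same_rank (hnum ` {..<card X}) Y"
      using XY True by (auto simp: same_rank_def card_image inj_on_def)
    then show ?thesis using hf_def2_hnum_less[of "card X"] by blast
  next
    case False
    \<comment> \<open>There are infinitely many numerals over any field, finite ones
      included.\<close>
    have "infinite (range (hnum :: nat \<Rightarrow> 'k hf))" for k :: "'k itself"
      by (simp add: finite_image_iff inj_on_def)
    then have "infinite (UNIV :: 'k1 hf set)" "infinite (UNIV :: 'k2 hf set)"
      by (metis infinite_super top_greatest)+
    then have "same_rank X (UNIV :: 'k1 hf set)" "same_rank (UNIV :: 'k2 hf set) Y"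
      using XY False by (auto simp: same_rank_def)
    moreover have "hf_def2 (\<lambda>s. s 0 = (s 0 :: 'k1 hf)) (\<lambda>s. s 0 = (s 0 :: 'k2 hf))"
      by (intro hf_def2_intros hf_term2_intros)
    then have "hf_def2 (\<lambda>s. s 0 \<in> (UNIV :: 'k1 hf set)) (\<lambda>s. s 0 \<in> (UNIV :: 'k2 hf set))" by simp
    ultimately show ?thesis by blast
  qed
  then obtain G :: "'k1 hf set" and G' :: "'k2 hf set" where
    G: "hf_def2 (\<lambda>s. s 0 \<in> G) (\<lambda>s. s 0 \<in> G')" "same_rank X G" "same_rank G' Y" by blast
  show ?thesis
    by (rule ring_elem_equiv_trans[OF ring_elem_equiv_same_rank[OF G(2)]
          ring_elem_equiv_trans[OF ring_elem_equiv_definable_letters[OF equiv G(1)]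
            ring_elem_equiv_same_rank[OF G(3)]]])
qed

subsection \<open>Finite graphs as hereditarily finite sets\<close>

text \<open>
  A node with a loop stands for the set of its other predecessors, every other node stands for
  the atom with the same name.
\<close>

inductive graph_decodes :: "('k \<times> 'k) set \<Rightarrow> 'k \<Rightarrow> 'k hf \<Rightarrow> bool" for E where
  atom: "(r, r) \<notin> E \<Longrightarrow> graph_decodes E r (Atom r)"
| set: "(r, r) \<in> E \<Longrightarrow>
    (\<forall>c. c \<noteq> r \<and> (c, r) \<in> E \<longrightarrow> (\<exists>y. hf_mem y (HSet F) \<and> graph_decodes E c y)) \<Longrightarrow>
    (\<forall>y. hf_mem y (HSet F) \<longrightarrow> (\<exists>c. c \<noteq> r \<and> (c, r) \<in> E \<and> graph_decodes E c y)) \<Longrightarrow>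
    graph_decodes E r (HSet F)"

lemma graph_decodes_Atom_iff: "graph_decodes E r (Atom a) \<longleftrightarrow> (r, r) \<notin> E \<and> r = a"
  by (auto elim: graph_decodes.cases intro: graph_decodes.intros)

lemma graph_decodes_HSet_iff:
  "graph_decodes E r (HSet F) \<longleftrightarrow> (r, r) \<in> E \<and>
    (\<forall>c. c \<noteq> r \<and> (c, r) \<in> E \<longrightarrow> (\<exists>y. y |\<in>| F \<and> graph_decodes E c y)) \<and>
    (\<forall>y. y |\<in>| F \<longrightarrow> (\<exists>c. c \<noteq> r \<and> (c, r) \<in> E \<and> graph_decodes E c y))"
  by (subst graph_decodes.simps) simp

lemma graph_decodes_loop_iff: "graph_decodes E r x \<Longrightarrow> (r, r) \<in> E \<longleftrightarrow> \<not> is_atom x"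
  by (cases x) (auto simp: graph_decodes_Atom_iff graph_decodes_HSet_iff is_atom_def)

lemma graph_decodes_children:
  assumes "graph_decodes E r x" and "(r, r) \<in> E"
  shows "c \<noteq> r \<Longrightarrow> (c, r) \<in> E \<Longrightarrow> \<exists>y. hf_mem y x \<and> graph_decodes E c y"
    and "hf_mem y x \<Longrightarrow> \<exists>c. c \<noteq> r \<and> (c, r) \<in> E \<and> graph_decodes E c y"
  using assms by (cases x; auto simp: graph_decodes_Atom_iff graph_decodes_HSet_iff)+

text \<open>A loopless node denotes the atom of its own name and is therefore related only to
  itself; nodes with loops are matched by the usual condition on proper predecessors.\<close>

definition bisimulation :: "('k \<times> 'k) set \<Rightarrow> ('k \<times> 'k) set \<Rightarrow> ('k \<times> 'k) set \<Rightarrow> bool" where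
  "bisimulation E E' B \<longleftrightarrow> (\<forall>m m'. (m, m') \<in> B \<longrightarrow> ((m, m) \<in> E \<longleftrightarrow> (m', m') \<in> E') \<and> ((m, m) \<in> E \<or> m = m') \<and>
     ((m, m) \<in> E \<longrightarrow>
        (\<forall>c. c \<noteq> m \<and> (c, m) \<in> E \<longrightarrow> (\<exists>c'. c' \<noteq> m' \<and> (c', m') \<in> E' \<and> (c, c') \<in> B)) \<and>
        (\<forall>c'. c' \<noteq> m' \<and> (c', m') \<in> E' \<longrightarrow> (\<exists>c. c \<noteq> m \<and> (c, m) \<in> E \<and> (c, c') \<in> B))))"

lemma bisimulationD:
  assumes "bisimulation E E' B" and "(m, m') \<in> B"
  shows "(m, m) \<in> E \<longleftrightarrow> (m', m') \<in> E'" and "(m, m) \<notin> E \<Longrightarrow> m = m'"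
    and "(m, m) \<in> E \<Longrightarrow> c \<noteq> m \<Longrightarrow> (c, m) \<in> E \<Longrightarrow> \<exists>c'. c' \<noteq> m' \<and> (c', m') \<in> E' \<and> (c, c') \<in> B"
    and "(m, m) \<in> E \<Longrightarrow> c' \<noteq> m' \<Longrightarrow> (c', m') \<in> E' \<Longrightarrow> \<exists>c. c \<noteq> m \<and> (c, m) \<in> E \<and> (c, c') \<in> B"
  using assms unfolding bisimulation_def by blast+

text \<open>By induction on the decoded set, related predecessors decode to equal members, and
  extensionality applies.\<close>

lemma bisimulation_graph_decodes:
  assumes "bisimulation E E' B"
    and "(r, r') \<in> B" and "graph_decodes E r x" and "graph_decodes E' r' x'"
  shows "x = x'"
  using assms(2-)
proof (induction x arbitrary: r r' x')
  case (Atom a)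
  then have "r = a" "(r, r) \<notin> E" by (auto simp: graph_decodes_Atom_iff)
  with bisimulationD[OF assms(1) Atom.prems(1)] have "r' = a" "(r', r') \<notin> E'" by auto
  then show ?case using Atom.prems(3) by (cases x') (auto simp: graph_decodes_Atom_iff graph_decodes_HSet_iff)
next
  case (HSet F)
  note B = bisimulationD[OF assms(1) HSet.prems(1)]
  have loop: "(r, r) \<in> E" using HSet.prems(2) by (simp add: graph_decodes_HSet_iff)
  then have loop': "(r', r') \<in> E'" using B(1) by simp
  note ch = graph_decodes_children[OF HSet.prems(2) loop]
  note ch' = graph_decodes_children[OF HSet.prems(3) loop']
  have "hf_mem y (HSet F) \<longleftrightarrow> hf_mem y x'" for y
  proof
    assume y: "hf_mem y (HSet F)"
    then obtain c where c: "c \<noteq> r" "(c, r) \<in> E" "graph_decodes E c y" using ch(2) by blast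
    then obtain c' where c': "c' \<noteq> r'" "(c', r') \<in> E'" "(c, c') \<in> B" using B(3) loop by blast
    then obtain y' where "hf_mem y' x'" "graph_decodes E' c' y'" using ch'(1) by blast
    moreover have "y = y'" using HSet.IH[OF _ c'(3) c(3)] y \<open>graph_decodes E' c' y'\<close> by simp
    ultimately show "hf_mem y x'" by simp
  next
    assume "hf_mem y x'"
    then obtain c' where c': "c' \<noteq> r'" "(c', r') \<in> E'" "graph_decodes E' c' y" using ch'(2) by blast
    then obtain c where c: "c \<noteq> r" "(c, r) \<in> E" "(c, c') \<in> B" using B(4) loop by blast
    then obtain y' where "hf_mem y' (HSet F)" "graph_decodes E c y'" using ch(1) by blast
    moreover have "y' = y" using HSet.IH[OF _ c(3) \<open>graph_decodes E c y'\<close> c'(3)] \<open>hf_mem y' (HSet F)\<close> by simp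
    ultimately show "hf_mem y (HSet F)" by simp
  qed
  moreover have "\<not> is_atom x'" using graph_decodes_loop_iff[OF HSet.prems(3)] loop' by simp
  ultimately show ?case by (intro hf_eqI) (auto simp: is_atom_def)
qed

lemma graph_decodes_unique:
  assumes "graph_decodes E r x" and "graph_decodes E r x'" shows "x = x'"
  by (rule bisimulation_graph_decodes[of E E Id, OF _ _ assms]) (auto simp: bisimulation_def)

lemma graph_decodes_eq_iff:
  assumes "finite E" "finite E'" and x: "graph_decodes E r x" and x': "graph_decodes E' r' x'"
  shows "x = x' \<longleftrightarrow> (\<exists>B. finite B \<and> (r, r') \<in> B \<and> bisimulation E E' B)"
proof
  assume eq: "x = x'"
  \<comment> \<open>A name without loop in either graph decodes to the same atom in both, so the
    relation of decoding to the same set may be infinite; restriction to \<open>V\<close> makes it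
    finite. The domains suffice because only predecessors are reached.\<close>
  define V where "V = insert r (insert r' (Domain E \<union> Domain E'))"
  define B where "B = {(m, m'). (\<exists>y. graph_decodes E m y \<and> graph_decodes E' m' y) \<and> m \<in> V \<and> m' \<in> V}"
  have "finite V" using assms(1,2) by (simp add: V_def finite_Domain)
  moreover have "B \<subseteq> V \<times> V" by (auto simp: B_def)
  ultimately have "finite B" by (meson finite_SigmaI finite_subset)
  moreover have "(r, r') \<in> B" using x x' eq by (auto simp: B_def V_def)
  moreover have "bisimulation E E' B"
    unfolding bisimulation_def
  proof (intro allI impI, goal_cases)
    case (1 m m')
    then obtain y where y: "graph_decodes E m y" "graph_decodes E' m' y" by (auto simp: B_def)
    have loop: "(m, m) \<in> E \<longleftrightarrow> (m', m') \<in> E'"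
      using y graph_decodes_loop_iff by metis
    moreover have "(m, m) \<in> E \<or> m = m'"
      using y by (cases y) (auto simp: graph_decodes_Atom_iff graph_decodes_HSet_iff)
    moreover have "\<exists>c'. c' \<noteq> m' \<and> (c', m') \<in> E' \<and> (c, c') \<in> B" if c: "(m, m) \<in> E" "c \<noteq> m" "(c, m) \<in> E" for c
    proof -
      obtain z where z: "hf_mem z y" "graph_decodes E c z"
        using graph_decodes_children(1)[OF y(1) c] by blast
      moreover obtain c' where "c' \<noteq> m'" "(c', m') \<in> E'" "graph_decodes E' c' z"
        using graph_decodes_children(2)[OF y(2) _ z(1)] loop c(1) by blast
      ultimately show ?thesis using c by (auto simp: B_def V_def)
    qed
    moreover have "\<exists>c. c \<noteq> m \<and> (c, m) \<in> E \<and> (c, c') \<in> B" if c: "(m, m) \<in> E" "c' \<noteq> m'" "(c', m') \<in> E'" for c'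
    proof -
      have "(m', m') \<in> E'" using loop c(1) by simp
      then obtain z where z: "hf_mem z y" "graph_decodes E' c' z"
        using graph_decodes_children(1)[OF y(2) _ c(2,3)] by blast
      moreover obtain c where "c \<noteq> m" "(c, m) \<in> E" "graph_decodes E c z"
        using graph_decodes_children(2)[OF y(1) c(1) z(1)] by blast
      ultimately show ?thesis using c by (auto simp: B_def V_def)
    qed
    ultimately show ?case
      by blast
  qed
  ultimately show "\<exists>B. finite B \<and> (r, r') \<in> B \<and> bisimulation E E' B" by blast
next
  assume "\<exists>B. finite B \<and> (r, r') \<in> B \<and> bisimulation E E' B"
  then show "x = x'" using bisimulation_graph_decodes[OF _ _ x x'] by blast
qed

definition ill_founded :: "('k \<times> 'k) set \<Rightarrow> 'k set \<Rightarrow> bool" where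
  "ill_founded E M \<longleftrightarrow> (\<forall>m\<in>M. (m, m) \<in> E \<and> (\<exists>c\<in>M. c \<noteq> m \<and> (c, m) \<in> E))"

lemma graph_decodes_ill_founded:
  assumes "graph_decodes E r x" and "ill_founded E M" shows "r \<notin> M"
  using assms(1)
proof (induction x arbitrary: r rule: hf.induct)
  case (Atom a)
  then show ?case using assms(2) by (auto simp: graph_decodes_Atom_iff ill_founded_def)
next
  case (HSet F)
  show ?case
  proof
    assume "r \<in> M"
    then obtain c where "c \<in> M" "c \<noteq> r" "(c, r) \<in> E" using assms(2) by (auto simp: ill_founded_def)
    moreover from this obtain y where "y |\<in>| F" "graph_decodes E c y"
      using HSet.prems by (auto simp: graph_decodes_HSet_iff)
    ultimately show False using HSet.IH by blast
  qed
qed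

text \<open>If \<open>r\<close> decodes to nothing, the set of all such nodes witnesses it: they
  carry loops and so are finitely many, and a looped node whose proper predecessors all decode would
  decode to the set of their values.\<close>

lemma ex_graph_decodes_iff:
  assumes "finite E"
  shows "(\<exists>x. graph_decodes E r x) \<longleftrightarrow> \<not> (\<exists>M. finite M \<and> r \<in> M \<and> ill_founded E M)"
proof
  assume "\<exists>x. graph_decodes E r x"
  then obtain x where "graph_decodes E r x" ..
  from graph_decodes_ill_founded[OF this] show "\<not> (\<exists>M. finite M \<and> r \<in> M \<and> ill_founded E M)" by auto
next
  assume no: "\<not> (\<exists>M. finite M \<and> r \<in> M \<and> ill_founded E M)"
  define M where "M = {m. \<nexists>x. graph_decodes E m x}"
  have loop: "(m, m) \<in> E" if "m \<in> M" for m
    using that graph_decodes.atom[of m E] by (auto simp: M_def)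
  have "M \<subseteq> Range E" using loop by blast
  then have "finite M" using finite_Range[OF assms] by (rule finite_subset)
  moreover have "\<exists>c\<in>M. c \<noteq> m \<and> (c, m) \<in> E" if m: "m \<in> M" for m
  proof (rule ccontr)
    let ?C = "{c. c \<noteq> m \<and> (c, m) \<in> E}"
    assume "\<not> ?thesis"
    then have "\<forall>c\<in>?C. \<exists>x. graph_decodes E c x" by (auto simp: M_def)
    from bchoice[OF this] obtain f where f: "\<forall>c\<in>?C. graph_decodes E c (f c)" ..
    have "?C \<subseteq> Domain E" by auto
    then have "finite (f ` ?C)" using finite_Domain[OF assms] by (intro finite_imageI) (rule finite_subset)
    then have F: "fset (Abs_fset (f ` ?C)) = f ` ?C" by (simp add: Abs_fset_inverse)
    have "graph_decodes E m (HSet (Abs_fset (f ` ?C)))"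
      using f loop[OF m] F by (auto simp: graph_decodes_HSet_iff)
    then show False using m by (auto simp: M_def)
  qed
  then have "ill_founded E M" using loop by (simp add: ill_founded_def)
  ultimately have "r \<notin> M" using no by blast
  then show "\<exists>x. graph_decodes E r x" by (simp add: M_def)
qed

section \<open>Every hereditarily finite set over an infinite field is given by a finite
  graph\<close>

lemma ex_finite_transitive:
  "\<exists>T. finite T \<and> x \<in> T \<and> (\<forall>z\<in>T. \<forall>y. hf_mem y z \<longrightarrow> y \<in> T)"
proof (induction x)
  case (Atom a)
  show ?case by (rule exI[of _ "{Atom a}"]) simp
next
  case (HSet F)
  then obtain T where T: "\<And>y. y |\<in>| F \<Longrightarrow> finite (T y) \<and> y \<in> T y \<and> (\<forall>z\<in>T y. \<forall>y'. hf_mem y' z \<longrightarrow> y' \<in> T y)"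
    by metis
  let ?T = "insert (HSet F) (\<Union>y\<in>fset F. T y)"
  have "finite ?T" using T by auto
  moreover have "\<forall>z\<in>?T. \<forall>y. hf_mem y z \<longrightarrow> y \<in> ?T"
    using T by fastforce
  ultimately show ?case by blast
qed

lemma hf_mem_irrefl: "\<not> hf_mem x x"
proof (induction x)
  case (HSet F)
  then show ?case using HSet.IH[of "HSet F"] by auto
qed simp

lemma ex_injection_into:
  assumes "finite S" and "infinite A"
  shows "\<exists>f. inj_on f S \<and> f ` S \<subseteq> A"
proof -
  obtain B where "finite B" "card B = card S" "B \<subseteq> A"
    using infinite_arbitrarily_large[OF assms(2)] by blast
  moreover from this obtain f where "bij_betw f S B" using finite_same_card_bij[OF assms(1)] by metis
  ultimately show ?thesis by (auto simp: bij_betw_def)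
qed

lemma ex_graph_decodes:
  assumes "infinite (UNIV :: 'k set)"
  shows "\<exists>E r. finite E \<and> graph_decodes E r (x :: 'k hf)"
proof -
  obtain T where T: "finite T" "x \<in> T" "\<And>z y. z \<in> T \<Longrightarrow> hf_mem y z \<Longrightarrow> y \<in> T"
    using ex_finite_transitive by metis
  have "finite (Atom -` T)" using T(1) by (intro finite_vimageI) (auto simp: inj_on_def)
  then have "infinite (- Atom -` T)" using assms by (metis Compl_eq_Diff_UNIV finite_Diff2)
  \<comment> \<open>Names of sets avoid the atoms of \<open>T\<close>, which keep their own names;
    an infinite field has room for this.\<close>
  then obtain g where g: "inj_on g T" "g ` T \<subseteq> - Atom -` T"
    using ex_injection_into[OF T(1)] by blast
  define \<nu> where "\<nu> z = (case z of Atom a \<Rightarrow> a | HSet _ \<Rightarrow> g z)" for z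
  have "inj_on \<nu> T"
  proof (rule inj_onI)
    fix y z assume "y \<in> T" "z \<in> T" "\<nu> y = \<nu> z"
    then show "y = z" using g
      by (cases y; cases z) (auto simp: \<nu>_def inj_on_def image_subset_iff)
  qed
  then have inj: "\<nu> y = \<nu> z \<longleftrightarrow> y = z" if "y \<in> T" "z \<in> T" for y z
    using that by (auto simp: inj_on_def)
  \<comment> \<open>The alternative \<open>y = z\<close> gives every set its loop, so that the empty
    set is not mistaken for an atom.\<close>
  define E where "E = {(\<nu> y, \<nu> z) | y z. y \<in> T \<and> z \<in> T \<and> \<not> is_atom z \<and> (hf_mem y z \<or> y = z)}"
  have "E \<subseteq> \<nu> ` T \<times> \<nu> ` T" by (auto simp: E_def)
  then have "finite E" using T(1) by (meson finite_SigmaI finite_imageI finite_subset)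
  have E_iff: "(\<nu> y, \<nu> z) \<in> E \<longleftrightarrow> \<not> is_atom z \<and> (hf_mem y z \<or> y = z)" if "y \<in> T" "z \<in> T" for y z
    using that by (auto simp: E_def inj)
  have "graph_decodes E (\<nu> z) z" if "z \<in> T" for z
    using that
  proof (induction z)
    case (Atom a)
    then have "\<nu> (Atom a) = a" "(a, a) \<notin> E" using E_iff[of "Atom a" "Atom a"] by (auto simp: \<nu>_def)
    then show ?case by (simp add: graph_decodes_Atom_iff)
  next
    case (HSet F)
    have "(\<nu> (HSet F), \<nu> (HSet F)) \<in> E" using HSet.prems by (simp add: E_iff is_atom_def image_iff)
    moreover have "\<exists>y. y |\<in>| F \<and> graph_decodes E c y" if c: "c \<noteq> \<nu> (HSet F)" "(c, \<nu> (HSet F)) \<in> E" for c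
    proof -
      obtain y where "c = \<nu> y" "y \<in> T" using c(2) by (auto simp: E_def)
      with c have "y |\<in>| F" using E_iff[OF _ HSet.prems, of y] by auto
      then show ?thesis using HSet.IH \<open>c = \<nu> y\<close> \<open>y \<in> T\<close> by blast
    qed
    moreover have "\<exists>c. c \<noteq> \<nu> (HSet F) \<and> (c, \<nu> (HSet F)) \<in> E \<and> graph_decodes E c y" if y: "y |\<in>| F" for y
    proof (intro exI conjI)
      have "hf_mem y (HSet F)" using y by simp
      then have yT: "y \<in> T" using T(3) HSet.prems by blast
      then show "graph_decodes E (\<nu> y) y" using HSet.IH y by blast
      show "(\<nu> y, \<nu> (HSet F)) \<in> E" using yT HSet.prems y by (simp add: E_iff is_atom_def image_iff)
      show "\<nu> y \<noteq> \<nu> (HSet F)" using yT HSet.prems y hf_mem_irrefl[of "HSet F"] by (auto simp: inj)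
    qed
    ultimately show ?case by (auto simp: graph_decodes_HSet_iff)
  qed
  then show ?thesis using \<open>finite E\<close> T(2) by blast
qed

subsection \<open>Coding finite relations\<close>

definition left_dvd :: "'a::ring_1 set \<Rightarrow> 'a \<Rightarrow> 'a \<Rightarrow> bool" where
  "left_dvd D d p \<longleftrightarrow> (\<exists>u\<in>D. p = d * u)"

abbreviation root_in :: "'x set \<Rightarrow> ('x, 'k::field) ncpoly \<Rightarrow> 'k \<Rightarrow> ('x, 'k) ncpoly \<Rightarrow> bool" where
  "root_in X t a p \<equiv> left_dvd (free_algebra X) (t - cst a) p"

lemma cst_eq_iff [simp]: "cst a = cst b \<longleftrightarrow> a = b"
  using inj_cst by (auto simp: inj_on_def)

text \<open>The two linear factors commute and differ by a non-zero scalar. The first fact gives one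
  direction; for the other, \<open>(a' - a) q = (t - a) q - (t - a') q\<close> plays the role of a
  Bezout identity.\<close>

lemma root_in_iff_mult:
  assumes t: "t \<in> free_algebra X" and q: "q \<in> free_algebra X" and "a' \<noteq> a"
  shows "root_in X t a' ((t - cst a) * q) \<longleftrightarrow> root_in X t a' q"
proof
  assume "root_in X t a' q"
  then obtain u where u: "u \<in> free_algebra X" "q = (t - cst a') * u" by (auto simp: left_dvd_def)
  have "t - cst a' = (t - cst a) + cst (a - a')" by (simp flip: cst_diff)
  then have comm: "(t - cst a) * (t - cst a') = (t - cst a') * (t - cst a)"
    by (simp only: distrib_left distrib_right cst_commute[of "t - cst a"])
  have "(t - cst a) * q = (t - cst a') * ((t - cst a) * u)"
    by (simp only: u(2) mult.assoc[symmetric] comm)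
  moreover have "(t - cst a) * u \<in> free_algebra X"
    by (intro free_algebra_closed t u)
  ultimately show "root_in X t a' ((t - cst a) * q)" unfolding left_dvd_def by blast
next
  assume "root_in X t a' ((t - cst a) * q)"
  then obtain v where v: "v \<in> free_algebra X" "(t - cst a) * q = (t - cst a') * v"
    by (auto simp: left_dvd_def)
  have "cst (a' - a) * q = (t - cst a') * (v - q)"
    using v(2) by (simp add: algebra_simps flip: cst_diff)
  then have "q = cst (inverse (a' - a)) * ((t - cst a') * (v - q))"
    using assms(3) cst_inverse_mult[of "a' - a" q] by simp
  also have "\<dots> = (t - cst a') * ((v - q) * cst (inverse (a' - a)))"
    by (metis cst_commute mult.assoc)
  finally have eq: "q = (t - cst a') * ((v - q) * cst (inverse (a' - a)))" .
  have "(v - q) * cst (inverse (a' - a)) \<in> free_algebra X"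
    by (intro free_algebra_closed v q)
  with eq show "root_in X t a' q" unfolding left_dvd_def by blast
qed

lemma root_in_self: "q \<in> free_algebra X \<Longrightarrow> root_in X t a ((t - cst a) * q)"
  by (auto simp: left_dvd_def)

lemma root_in_add: "root_in X t a p \<Longrightarrow> root_in X t a q \<Longrightarrow> root_in X t a (p + q)"
  unfolding left_dvd_def by (metis add_in_free_algebra distrib_left)

lemma root_in_mult: "root_in X t a p \<Longrightarrow> q \<in> free_algebra X \<Longrightarrow> root_in X t a (p * q)"
  unfolding left_dvd_def by (metis mult_in_free_algebra mult.assoc)

lemma root_in_diff: "root_in X t a p \<Longrightarrow> root_in X t a q \<Longrightarrow> root_in X t a (p - q)"
  unfolding left_dvd_def by (metis minus_in_free_algebra right_diff_distrib)

lemma root_in_cst_iff: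
  assumes "t \<notin> range cst" shows "root_in X t a (cst c) \<longleftrightarrow> c = 0"
proof
  show "root_in X t a (cst c) \<Longrightarrow> c = 0"
    using not_cst_mult[OF assms] unfolding left_dvd_def by metis
  show "c = 0 \<Longrightarrow> root_in X t a (cst c)"
    unfolding left_dvd_def by (intro bexI[of _ 0]) (simp_all add: zero_in_free_algebra)
qed

text \<open>As for a commutative polynomial: splitting off \<open>t - cst a\<close> lowers the
  degree, and every other root is still a root of the cofactor.\<close>

lemma finite_roots:
  fixes q :: "('x, 'k::field) ncpoly"
  assumes t: "t \<in> free_algebra X" "t \<notin> range cst" and q: "q \<in> free_algebra X" "q \<noteq> 0"
  shows "finite {a. root_in X t a q}"
  using q
proof (induction "deg q" arbitrary: q rule: less_induct)
  case less
  show ?case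
  proof (cases "\<exists>a. root_in X t a q")
    case True
    then obtain a u where u: "u \<in> free_algebra X" "q = (t - cst a) * u" by (auto simp: left_dvd_def)
    have "t - cst a \<noteq> 0" "deg (t - cst a) \<noteq> 0"
      using t(2) by (auto simp: deg_zero_cst) (metis cst_add diff_add_cancel rangeI)
    moreover have "u \<noteq> 0" using less.prems u(2) by auto
    ultimately have "deg u < deg q" using deg_mult_ge(2)[of "t - cst a" u] u(2) by simp
    then have "finite {a. root_in X t a u}" using less.hyps u(1) \<open>u \<noteq> 0\<close> by blast
    moreover have "{a. root_in X t a q} \<subseteq> insert a {a. root_in X t a u}"
      using root_in_iff_mult[OF t(1) u(1)] u(2) by blast
    ultimately show ?thesis using finite_subset by blast
  qed simp
qed

text \<open>Polynomials in \<open>t\<close> have this property, the residue modulo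
  \<open>t - cst a\<close> being the value at \<open>a\<close>. The definition keeps what
  interpolation uses of them.\<close>

definition has_residues :: "'x set \<Rightarrow> ('x, 'k::field) ncpoly \<Rightarrow> ('x, 'k) ncpoly \<Rightarrow> bool" where
  "has_residues X t p \<longleftrightarrow> p \<in> free_algebra X \<and> (\<forall>a. \<exists>b. root_in X t a (p - cst b))"

text \<open>
  A triple \<open>(q, p\<^sub>1, p\<^sub>2)\<close> with \<open>q \<noteq> 0\<close> codes the finite set of the pairs of residues of
  \<open>p\<^sub>1\<close> and \<open>p\<^sub>2\<close> modulo \<open>t - a\<close>, where \<open>a\<close> runs over the scalars such that \<open>t - a\<close> divides \<open>q\<close>.
\<close>

definition coded_rel where
  "coded_rel X t q p1 p2 = {(b, c). \<exists>a. root_in X t a q \<and> root_in X t a (p1 - cst b) \<and> root_in X t a (p2 - cst c)}"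

lemma residue_unique:
  assumes "t \<notin> range cst" and "root_in X t a (p - cst b)" and "root_in X t a (p - cst c)"
  shows "b = c"
proof -
  have "root_in X t a (cst (c - b))"
    using root_in_diff[OF assms(2,3)] by (simp flip: cst_diff)
  then show ?thesis using root_in_cst_iff[OF assms(1)] by simp
qed

lemma finite_coded_rel:
  fixes q :: "('x, 'k::field) ncpoly"
  assumes t: "t \<in> free_algebra X" "t \<notin> range cst" and q: "q \<in> free_algebra X" "q \<noteq> 0"
  shows "finite (coded_rel X t q p1 p2)"
proof -
  \<comment> \<open>Residues are unique, so each of the finitely many roots contributes at most one
    pair.\<close>
  let ?f = "\<lambda>a. (THE b. root_in X t a (p1 - cst b), THE c. root_in X t a (p2 - cst c))"
  have "coded_rel X t q p1 p2 \<subseteq> ?f ` {a. root_in X t a q}"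
  proof
    fix z assume "z \<in> coded_rel X t q p1 p2"
    then obtain a b c where z: "z = (b, c)" "root_in X t a q" "root_in X t a (p1 - cst b)" "root_in X t a (p2 - cst c)"
      by (auto simp: coded_rel_def)
    then have "?f a = z" using residue_unique[OF t(2)] by (auto intro!: the_equality)
    then show "z \<in> ?f ` {a. root_in X t a q}" using z(2) by blast
  qed
  then show ?thesis using finite_roots[OF t q] by (meson finite_imageI finite_subset)
qed

lemma has_residues_step:
  assumes t: "t \<in> free_algebra X" and q: "has_residues X t q"
  shows "has_residues X t ((t - cst a) * q)"
  unfolding has_residues_def
proof (intro conjI allI)
  show "(t - cst a) * q \<in> free_algebra X"
    using q by (intro free_algebra_closed t) (auto simp: has_residues_def)
  fix a'
  obtain b where b: "root_in X t a' (q - cst b)" using q by (auto simp: has_residues_def)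
  have qX: "q \<in> free_algebra X" using q by (simp add: has_residues_def)
  \<comment> \<open>Writing \<open>t - a\<close> as \<open>(t - a') + (a' - a)\<close> shows that
    the residue of \<open>q\<close> at \<open>a'\<close> gets multiplied by
    \<open>a' - a\<close>.\<close>
  have "root_in X t a' ((t - cst a') * q + (q - cst b) * cst (a' - a))"
    by (rule root_in_add[OF root_in_self[OF qX] root_in_mult[OF b cst_in_free_algebra]])
  moreover have "(t - cst a') * q + (q - cst b) * cst (a' - a) = (t - cst a) * q - cst ((a' - a) * b)"
  proof -
    have "(q - cst b) * cst (a' - a) = (cst a' - cst a) * q - cst ((a' - a) * b)"
      by (simp only: cst_commute[of "q - cst b"] cst_mult[symmetric] right_diff_distrib cst_diff)
    then show ?thesis by (simp only: left_diff_distrib) simp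
  qed
  ultimately show "\<exists>b. root_in X t a' ((t - cst a) * q - cst b)" by auto
qed

text \<open>An interpolation step in the manner of Newton: adding a scalar multiple of
  \<open>q\<close> changes the residue of \<open>p\<close> at \<open>a\<close>, where
  \<open>q\<close> does not vanish, and keeps it at all roots of \<open>q\<close>.\<close>

lemma has_residues_adjust:
  assumes q: "has_residues X t q" "\<not> root_in X t a q" and p: "has_residues X t p"
  shows "\<exists>p'. has_residues X t p' \<and> root_in X t a (p' - cst b) \<and>
    (\<forall>a' b'. root_in X t a' q \<longrightarrow> root_in X t a' (p' - cst b') = root_in X t a' (p - cst b'))"
proof -
  have qX: "q \<in> free_algebra X" and pX: "p \<in> free_algebra X" using q p by (auto simp: has_residues_def)
  obtain c where c: "root_in X t a (q - cst c)" using q by (auto simp: has_residues_def)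
  have "c \<noteq> 0" using c q(2) by auto
  obtain d where d: "root_in X t a (p - cst d)" using p by (auto simp: has_residues_def)
  \<comment> \<open>This solves \<open>d + c * h = b\<close>; the residue \<open>c\<close> of
    \<open>q\<close> at \<open>a\<close> is non-zero because \<open>a\<close> is no root.\<close>
  define h where "h = (b - d) / c"
  define p' where "p' = p + q * cst h"
  have *: "root_in X t a' (p' - cst (b' + c' * h))" if "root_in X t a' (p - cst b')" "root_in X t a' (q - cst c')" for a' b' c'
  proof -
    have "p' - cst (b' + c' * h) = (p - cst b') + (q - cst c') * cst h"
      by (simp add: p'_def left_diff_distrib cst_mult flip: cst_add)
    then show ?thesis using root_in_add[OF that(1) root_in_mult[OF that(2) cst_in_free_algebra]] by metis
  qed
  have "p' \<in> free_algebra X" unfolding p'_def by (intro free_algebra_closed pX qX)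
  then have "has_residues X t p'" using * p q(1) unfolding has_residues_def by meson
  moreover have "root_in X t a (p' - cst b)"
    using *[OF d c] \<open>c \<noteq> 0\<close> by (simp add: h_def)
  moreover have "root_in X t a' (p' - cst b') = root_in X t a' (p - cst b')" if "root_in X t a' q" for a' b'
  proof -
    have qh: "root_in X t a' (q * cst h)" using that cst_in_free_algebra by (rule root_in_mult)
    have "p' - cst b' = (p - cst b') + q * cst h" "p - cst b' = (p' - cst b') - q * cst h"
      by (simp_all add: p'_def)
    then show ?thesis using root_in_add[OF _ qh] root_in_diff[OF _ qh] by metis
  qed
  ultimately show ?thesis by blast
qed

text \<open>Pairs are added one at a time. The current \<open>q\<close> has finitely many roots, so
  an infinite field offers a new scalar \<open>a\<close>; it becomes a root, and interpolation
  prescribes the two residues there while the old pairs are kept.\<close>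

lemma ex_coded_rel:
  fixes E :: "('k::field \<times> 'k) set" and t :: "('x, 'k) ncpoly"
  assumes "infinite (UNIV :: 'k set)" and t: "t \<in> free_algebra X" "t \<notin> range cst" and "finite E"
  shows "\<exists>q p1 p2. q \<noteq> 0 \<and> has_residues X t q \<and> has_residues X t p1 \<and> has_residues X t p2 \<and> coded_rel X t q p1 p2 = E"
  using assms(4)
proof (induction E)
  case empty
  have cst: "has_residues X t (cst c)" for c
    unfolding has_residues_def
  proof (intro conjI allI)
    show "\<exists>b. root_in X t a (cst c - cst b)" for a
      using root_in_cst_iff[OF t(2), of X a 0] by (intro exI[of _ c]) simp
  qed simp
  \<comment> \<open>A non-zero scalar has no roots, hence codes the empty relation.\<close>
  have "\<not> root_in X t a (cst 1)" for a using root_in_cst_iff[OF t(2), of X a 1] by simp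
  then have "coded_rel X t (cst 1) (cst 1) (cst 1) = {}" unfolding coded_rel_def by blast
  moreover have "cst 1 \<noteq> (0 :: ('x, 'k) ncpoly)" by simp
  ultimately show ?case using cst by blast
next
  case (insert z E)
  obtain b c where z: "z = (b, c)" by force
  obtain q p1 p2 where q: "q \<noteq> 0" "has_residues X t q" and p: "has_residues X t p1" "has_residues X t p2"
    and E: "coded_rel X t q p1 p2 = E" using insert.IH by blast
  have qX: "q \<in> free_algebra X" using q(2) by (simp add: has_residues_def)
  obtain a where a: "\<not> root_in X t a q"
    using finite_roots[OF t qX q(1)] assms(1) ex_new_if_finite by blast
  obtain p1' where p1: "has_residues X t p1'" "root_in X t a (p1' - cst b)"
    "\<And>a' b'. root_in X t a' q \<Longrightarrow> root_in X t a' (p1' - cst b') = root_in X t a' (p1 - cst b')"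
    using has_residues_adjust[OF q(2) a p(1), of b] by blast
  obtain p2' where p2: "has_residues X t p2'" "root_in X t a (p2' - cst c)"
    "\<And>a' b'. root_in X t a' q \<Longrightarrow> root_in X t a' (p2' - cst b') = root_in X t a' (p2 - cst b')"
    using has_residues_adjust[OF q(2) a p(2), of c] by blast
  let ?q = "(t - cst a) * q"
  have root: "root_in X t a' ?q \<longleftrightarrow> a' = a \<or> root_in X t a' q" for a'
    using root_in_iff_mult[OF t(1) qX] root_in_self[OF qX] by metis
  have "(u, v) \<in> coded_rel X t ?q p1' p2' \<longleftrightarrow> (u, v) = (b, c) \<or> (u, v) \<in> coded_rel X t q p1 p2" for u v
  proof -
    have "(u, v) \<in> coded_rel X t ?q p1' p2' \<longleftrightarrow> root_in X t a (p1' - cst u) \<and> root_in X t a (p2' - cst v) \<or>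
        (\<exists>a'. root_in X t a' q \<and> root_in X t a' (p1' - cst u) \<and> root_in X t a' (p2' - cst v))"
      by (auto simp: coded_rel_def root)
    also have "root_in X t a (p1' - cst u) \<longleftrightarrow> u = b" using p1(2) residue_unique[OF t(2)] by blast
    also have "root_in X t a (p2' - cst v) \<longleftrightarrow> v = c" using p2(2) residue_unique[OF t(2)] by blast
    also have "(\<exists>a'. root_in X t a' q \<and> root_in X t a' (p1' - cst u) \<and> root_in X t a' (p2' - cst v)) \<longleftrightarrow>
        (\<exists>a'. root_in X t a' q \<and> root_in X t a' (p1 - cst u) \<and> root_in X t a' (p2 - cst v))"
      using p1(3) p2(3) by blast
    finally show ?thesis by (simp add: coded_rel_def)
  qed
  then have "coded_rel X t ?q p1' p2' = insert z E" unfolding z E[symmetric] by auto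
  moreover have "t - cst a \<noteq> 0" using t(2) by auto
  then have "?q \<noteq> 0" using q(1) deg_mult_ge(1) by blast
  ultimately show ?case using has_residues_step[OF t(1) q(2)] p1(1) p2(1) by blast
qed

subsection \<open>Definability in rings\<close>

text \<open>The counterpart of \<open>hf_def2\<close>, with assignments confined to the carriers
  over which ring formulas quantify.\<close>

definition ring_def2 ::
  "'a::ring_1 set \<Rightarrow> 'b::ring_1 set \<Rightarrow> ((nat \<Rightarrow> 'a) \<Rightarrow> bool) \<Rightarrow> ((nat \<Rightarrow> 'b) \<Rightarrow> bool) \<Rightarrow> bool" where
  "ring_def2 D D' P Q \<longleftrightarrow> (\<forall>f. infinite (- range f) \<longrightarrow>
     (\<exists>\<phi>. (\<forall>e. range e \<subseteq> D \<longrightarrow> (ring_sat D e \<phi> = P (\<lambda>i. e (f i))))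
        \<and> (\<forall>e. range e \<subseteq> D' \<longrightarrow> (ring_sat D' e \<phi> = Q (\<lambda>i. e (f i))))))"

lemma ring_def2I:
  assumes "\<And>f. infinite (- range f) \<Longrightarrow>
     \<exists>\<phi>. (\<forall>e. range e \<subseteq> D \<longrightarrow> (ring_sat D e \<phi> = P (\<lambda>i. e (f i))))
        \<and> (\<forall>e. range e \<subseteq> D' \<longrightarrow> (ring_sat D' e \<phi> = Q (\<lambda>i. e (f i))))"
  shows "ring_def2 D D' P Q"
  using assms by (simp add: ring_def2_def)

lemma ring_def2E:
  assumes "ring_def2 D D' P Q" and "infinite (- range f)"
  obtains \<phi> where "\<And>e. range e \<subseteq> D \<Longrightarrow> ring_sat D e \<phi> = P (\<lambda>i. e (f i))"
    and "\<And>e. range e \<subseteq> D' \<Longrightarrow> ring_sat D' e \<phi> = Q (\<lambda>i. e (f i))"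
  using assms unfolding ring_def2_def by blast

lemma ring_def2_not:
  assumes "ring_def2 D D' P Q" shows "ring_def2 D D' (\<lambda>s. \<not> P s) (\<lambda>s. \<not> Q s)"
proof (rule ring_def2I, goal_cases)
  case f: (1 f)
  obtain \<phi> where "\<And>e. range e \<subseteq> D \<Longrightarrow> ring_sat D e \<phi> = P (\<lambda>i. e (f i))"
    "\<And>e. range e \<subseteq> D' \<Longrightarrow> ring_sat D' e \<phi> = Q (\<lambda>i. e (f i))"
    using ring_def2E[OF assms f] by blast
  then show ?case
    by (intro exI[of _ "RNeg \<phi>"]) simp
qed

lemma ring_def2_conj:
  assumes "ring_def2 D D' P Q" and "ring_def2 D D' P' Q'"
  shows "ring_def2 D D' (\<lambda>s. P s \<and> P' s) (\<lambda>s. Q s \<and> Q' s)"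
proof (rule ring_def2I, goal_cases)
  case f: (1 f)
  obtain \<phi> where \<phi>: "\<And>e. range e \<subseteq> D \<Longrightarrow> ring_sat D e \<phi> = P (\<lambda>i. e (f i))"
    "\<And>e. range e \<subseteq> D' \<Longrightarrow> ring_sat D' e \<phi> = Q (\<lambda>i. e (f i))"
    using ring_def2E[OF assms(1) f] by blast
  obtain \<psi> where \<psi>: "\<And>e. range e \<subseteq> D \<Longrightarrow> ring_sat D e \<psi> = P' (\<lambda>i. e (f i))"
    "\<And>e. range e \<subseteq> D' \<Longrightarrow> ring_sat D' e \<psi> = Q' (\<lambda>i. e (f i))"
    using ring_def2E[OF assms(2) f] by blast
  show ?case
    by (intro exI[of _ "RConj \<phi> \<psi>"]) (simp add: \<phi> \<psi>)
qed

lemma ring_def2_bex: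
  assumes "ring_def2 D D' (\<lambda>s. P (\<lambda>i. s (Suc i)) (s 0)) (\<lambda>s. Q (\<lambda>i. s (Suc i)) (s 0))"
  shows "ring_def2 D D' (\<lambda>s. \<exists>x\<in>D. P s x) (\<lambda>s. \<exists>x\<in>D'. Q s x)"
proof (rule ring_def2I, goal_cases)
  case f: (1 f)
  then obtain m where m: "\<And>i. f i \<noteq> m" by (rule obtain_fresh) blast
  define g where "g = case_nat m f"
  have "- range f \<subseteq> insert m (- range g)"
    by (auto simp: g_def split: nat.splits)
  then have g: "infinite (- range g)" using f by (metis finite_insert infinite_super)
  obtain \<phi> where \<phi>: "\<And>e. range e \<subseteq> D \<Longrightarrow> ring_sat D e \<phi> = P (\<lambda>i. e (g (Suc i))) (e (g 0))"
    "\<And>e. range e \<subseteq> D' \<Longrightarrow> ring_sat D' e \<phi> = Q (\<lambda>i. e (g (Suc i))) (e (g 0))"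
    using ring_def2E[OF assms g] by blast
  have upd: "range (e(m := a)) \<subseteq> C" if "range e \<subseteq> C" "a \<in> C" for a e and C :: "'c set"
    using that by auto
  have "ring_sat D (e(m := a)) \<phi> \<longleftrightarrow> P (\<lambda>i. e (f i)) a" if "range e \<subseteq> D" "a \<in> D" for e a
    using \<phi>(1)[OF upd[OF that]] by (simp add: g_def m)
  moreover have "ring_sat D' (e(m := a)) \<phi> \<longleftrightarrow> Q (\<lambda>i. e (f i)) a" if "range e \<subseteq> D'" "a \<in> D'" for e a
    using \<phi>(2)[OF upd[OF that]] by (simp add: g_def m)
  ultimately show ?case
    by (intro exI[of _ "REx m \<phi>"]) simp
qed

lemma ring_def2_disj:
  assumes "ring_def2 D D' P Q" and "ring_def2 D D' P' Q'"
  shows "ring_def2 D D' (\<lambda>s. P s \<or> P' s) (\<lambda>s. Q s \<or> Q' s)"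
  using ring_def2_not[OF ring_def2_conj[OF ring_def2_not[OF assms(1)] ring_def2_not[OF assms(2)]]] by simp

lemma ring_def2_imp:
  assumes "ring_def2 D D' P Q" and "ring_def2 D D' P' Q'"
  shows "ring_def2 D D' (\<lambda>s. P s \<longrightarrow> P' s) (\<lambda>s. Q s \<longrightarrow> Q' s)"
  using ring_def2_not[OF ring_def2_conj[OF assms(1) ring_def2_not[OF assms(2)]]] by simp

lemma ring_def2_iff:
  assumes "ring_def2 D D' P Q" and "ring_def2 D D' P' Q'"
  shows "ring_def2 D D' (\<lambda>s. P s \<longleftrightarrow> P' s) (\<lambda>s. Q s \<longleftrightarrow> Q' s)"
  using ring_def2_conj[OF ring_def2_imp[OF assms] ring_def2_imp[OF assms(2,1)]]
  by (simp add: iff_conv_conj_imp)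

lemma ring_def2_ball:
  assumes "ring_def2 D D' (\<lambda>s. P (\<lambda>i. s (Suc i)) (s 0)) (\<lambda>s. Q (\<lambda>i. s (Suc i)) (s 0))"
  shows "ring_def2 D D' (\<lambda>s. \<forall>x\<in>D. P s x) (\<lambda>s. \<forall>x\<in>D'. Q s x)"
  using ring_def2_not[OF ring_def2_bex[of _ _ "\<lambda>s x. \<not> P s x" "\<lambda>s x. \<not> Q s x", OF ring_def2_not[OF assms]]]
  by simp

text \<open>A difference of two terms, since the language of rings has no subtraction.\<close>

definition ring_term2 ::
  "((nat \<Rightarrow> 'a::ring_1) \<Rightarrow> 'a) \<Rightarrow> ((nat \<Rightarrow> 'b::ring_1) \<Rightarrow> 'b) \<Rightarrow> bool" where
  "ring_term2 f g \<longleftrightarrow> (\<forall>r. \<exists>t u. (\<forall>e. ring_term_val e t - ring_term_val e u = f (\<lambda>i. e (r i)))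
     \<and> (\<forall>e. ring_term_val e t - ring_term_val e u = g (\<lambda>i. e (r i))))"

lemma ring_term2E:
  assumes "ring_term2 f g"
  obtains t u where "\<And>e. f (\<lambda>i. e (r i)) = ring_term_val e t - ring_term_val e u"
    "\<And>e. g (\<lambda>i. e (r i)) = ring_term_val e t - ring_term_val e u"
  using assms unfolding ring_term2_def by metis

lemma ring_term2I:
  assumes "\<And>r. \<exists>t u. (\<forall>e. ring_term_val e t - ring_term_val e u = f (\<lambda>i. e (r i)))
     \<and> (\<forall>e. ring_term_val e t - ring_term_val e u = g (\<lambda>i. e (r i)))"
  shows "ring_term2 f g"
  using assms by (simp add: ring_term2_def)

lemma ring_term2_var: "ring_term2 (\<lambda>s. s i) (\<lambda>s. s i)"
proof (rule ring_term2I, goal_cases)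
  case (1 r)
  show ?case
    by (rule exI[of _ "RVar (r i)"], rule exI[of _ RZero]) simp
qed

lemma ring_term2_zero: "ring_term2 (\<lambda>s. 0) (\<lambda>s. 0)"
  by (rule ring_term2I, rule exI[of _ RZero], rule exI[of _ RZero]) simp

lemma ring_term2_one: "ring_term2 (\<lambda>s. 1) (\<lambda>s. 1)"
  by (rule ring_term2I, rule exI[of _ ROne], rule exI[of _ RZero]) simp

lemma ring_term2_shift:
  "ring_term2 f g \<Longrightarrow> ring_term2 (\<lambda>s. f (\<lambda>i. s (h i))) (\<lambda>s. g (\<lambda>i. s (h i)))"
  unfolding ring_term2_def by (intro allI) (erule allE, assumption)

lemma ring_term2_binary_aux:
  assumes "ring_term2 f f'" "ring_term2 g g'"
    and F: "\<And>t u v w e. ring_term_val e (T t u v w) - ring_term_val e (U t u v w)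
      = F (ring_term_val e t - ring_term_val e u) (ring_term_val e v - ring_term_val e w)"
      "\<And>t u v w e. ring_term_val e (T t u v w) - ring_term_val e (U t u v w)
      = F' (ring_term_val e t - ring_term_val e u) (ring_term_val e v - ring_term_val e w)"
  shows "ring_term2 (\<lambda>s. F (f s) (g s)) (\<lambda>s. F' (f' s) (g' s))"
proof (rule ring_term2I, goal_cases)
  case (1 r)
  obtain t u where tu: "\<And>e. f (\<lambda>i. e (r i)) = ring_term_val e t - ring_term_val e u"
    "\<And>e. f' (\<lambda>i. e (r i)) = ring_term_val e t - ring_term_val e u" using ring_term2E[OF assms(1)] by blast
  obtain v w where vw: "\<And>e. g (\<lambda>i. e (r i)) = ring_term_val e v - ring_term_val e w"
    "\<And>e. g' (\<lambda>i. e (r i)) = ring_term_val e v - ring_term_val e w" using ring_term2E[OF assms(2)] by blast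
  show ?case
    by (rule exI[of _ "T t u v w"], rule exI[of _ "U t u v w"]) (simp add: tu vw F)
qed

lemma ring_term2_binary:
  assumes "ring_term2 f f'" "ring_term2 g g'"
  shows "ring_term2 (\<lambda>s. f s + g s) (\<lambda>s. f' s + g' s)"
    and "ring_term2 (\<lambda>s. f s - g s) (\<lambda>s. f' s - g' s)"
    and "ring_term2 (\<lambda>s. f s * g s) (\<lambda>s. f' s * g' s)"
  using ring_term2_binary_aux[OF assms, of "\<lambda>t u v w. RAdd t v" "\<lambda>t u v w. RAdd u w" "(+)" "(+)"]
    ring_term2_binary_aux[OF assms, of "\<lambda>t u v w. RAdd t w" "\<lambda>t u v w. RAdd u v" "(-)" "(-)"]
    ring_term2_binary_aux[OF assms, of "\<lambda>t u v w. RAdd (RMul t v) (RMul u w)"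
      "\<lambda>t u v w. RAdd (RMul t w) (RMul u v)" "(*)" "(*)"]
  by (simp_all add: left_diff_distrib right_diff_distrib)

lemma ring_def2_eq:
  assumes "ring_term2 f f'" "ring_term2 g g'"
  shows "ring_def2 D D' (\<lambda>s. f s = g s) (\<lambda>s. f' s = g' s)"
proof (rule ring_def2I, goal_cases)
  case (1 r)
  obtain t u where 1: "\<And>e. f (\<lambda>i. e (r i)) - g (\<lambda>i. e (r i)) = ring_term_val e t - ring_term_val e u"
    "\<And>e. f' (\<lambda>i. e (r i)) - g' (\<lambda>i. e (r i)) = ring_term_val e t - ring_term_val e u"
    using ring_term2E[OF ring_term2_binary(2)[OF assms]] by blast
  have "f (\<lambda>i. e (r i)) = g (\<lambda>i. e (r i)) \<longleftrightarrow> ring_term_val e t = ring_term_val e u" for e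
    using 1(1)[of e] by (metis eq_iff_diff_eq_0)
  moreover have "f' (\<lambda>i. e (r i)) = g' (\<lambda>i. e (r i)) \<longleftrightarrow> ring_term_val e t = ring_term_val e u" for e
    using 1(2)[of e] by (metis eq_iff_diff_eq_0)
  ultimately show ?case
    by (intro exI[of _ "REq t u"]) simp
qed

lemma ring_def2_left_dvd:
  assumes "ring_term2 f f'" "ring_term2 g g'"
  shows "ring_def2 D D' (\<lambda>s. left_dvd D (f s) (g s)) (\<lambda>s. left_dvd D' (f' s) (g' s))"
  unfolding left_dvd_def
  by (intro ring_def2_bex ring_def2_eq ring_term2_binary ring_term2_var assms[THEN ring_term2_shift])

lemma ring_def2_const:
  assumes "ring_term2 f f'"
  shows "ring_def2 (free_algebra X) (free_algebra Y) (\<lambda>s. f s \<in> range cst) (\<lambda>s. f' s \<in> range cst)"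
  unfolding right_invertible_iff[of _ X, symmetric] right_invertible_iff[of _ Y, symmetric]
  by (intro ring_def2_disj ring_def2_bex ring_def2_eq ring_term2_binary ring_term2_var ring_term2_zero
      ring_term2_one assms[THEN ring_term2_shift] assms)

lemma bex_const_iff: "(\<exists>c\<in>range cst. R c) \<longleftrightarrow> (\<exists>c\<in>free_algebra X. c \<in> range cst \<and> R c)"
  using cst_in_free_algebra by blast

lemma ring_def2_bex_const:
  assumes "ring_def2 (free_algebra X) (free_algebra Y) (\<lambda>s. P (\<lambda>i. s (Suc i)) (s 0)) (\<lambda>s. Q (\<lambda>i. s (Suc i)) (s 0))"
  shows "ring_def2 (free_algebra X) (free_algebra Y) (\<lambda>s. \<exists>c\<in>range cst. P s c) (\<lambda>s. \<exists>c\<in>range cst. Q s c)"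
  unfolding bex_const_iff[of _ X] bex_const_iff[of _ Y]
  by (intro ring_def2_bex ring_def2_conj ring_def2_const ring_term2_var assms)

lemma ring_def2_ball_const:
  assumes "ring_def2 (free_algebra X) (free_algebra Y) (\<lambda>s. P (\<lambda>i. s (Suc i)) (s 0)) (\<lambda>s. Q (\<lambda>i. s (Suc i)) (s 0))"
  shows "ring_def2 (free_algebra X) (free_algebra Y) (\<lambda>s. \<forall>c\<in>range cst. P s c) (\<lambda>s. \<forall>c\<in>range cst. Q s c)"
  using ring_def2_not[OF ring_def2_bex_const[of _ _ "\<lambda>s x. \<not> P s x" "\<lambda>s x. \<not> Q s x", OF ring_def2_not[OF assms]]]
  by simp

lemmas ring_def2_intros = ring_def2_not ring_def2_conj ring_def2_disj ring_def2_imp ring_def2_iff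
  ring_def2_bex_const ring_def2_ball_const ring_def2_bex ring_def2_ball ring_def2_eq ring_def2_left_dvd ring_def2_const
lemmas ring_term2_intros = ring_term2_var ring_term2_zero ring_term2_one ring_term2_binary

subsection \<open>Interpreting hereditarily finite sets in the free algebra\<close>

text \<open>\<open>coded_rel\<close> with ring elements in place of field elements, in a form that
  is visibly first-order; on scalars the two agree.\<close>

definition rel_mem where
  "rel_mem X (t :: ('x, 'k::field) ncpoly) q p1 p2 b c \<longleftrightarrow> (\<exists>a\<in>range cst. left_dvd (free_algebra X) (t - a) q
     \<and> left_dvd (free_algebra X) (t - a) (p1 - b) \<and> left_dvd (free_algebra X) (t - a) (p2 - c))"

lemma rel_mem_cst_iff [simp]: "rel_mem X t q p1 p2 (cst b) (cst c) \<longleftrightarrow> (b, c) \<in> coded_rel X t q p1 p2"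
  by (auto simp: rel_mem_def coded_rel_def)

lemma ring_def2_rel_mem:
  assumes "ring_term2 f1 f1'" "ring_term2 f2 f2'" "ring_term2 f3 f3'" "ring_term2 f4 f4'"
    "ring_term2 f5 f5'" "ring_term2 f6 f6'"
  shows "ring_def2 (free_algebra X) (free_algebra Y) (\<lambda>s. rel_mem X (f1 s) (f2 s) (f3 s) (f4 s) (f5 s) (f6 s))
    (\<lambda>s. rel_mem Y (f1' s) (f2' s) (f3' s) (f4' s) (f5' s) (f6' s))"
  unfolding rel_mem_def
  by (intro ring_def2_intros ring_term2_binary ring_term2_var assms[THEN ring_term2_shift])

text \<open>The finite set in the definition of \<open>ill_founded\<close> is coded as the diagonal
  of a binary relation, so that all second-order quantification runs over triples of the same
  kind.\<close>

definition code_valid where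
  "code_valid X t r q p1 p2 \<longleftrightarrow> r \<in> range cst \<and> q \<noteq> 0 \<and>
     \<not> (\<exists>q'\<in>free_algebra X. \<exists>p1'\<in>free_algebra X. \<exists>p2'\<in>free_algebra X. q' \<noteq> 0 \<and> rel_mem X t q' p1' p2' r r \<and>
        (\<forall>m\<in>range cst. rel_mem X t q' p1' p2' m m \<longrightarrow> rel_mem X t q p1 p2 m m \<and>
          (\<exists>c\<in>range cst. rel_mem X t q' p1' p2' c c \<and> c \<noteq> m \<and> rel_mem X t q p1 p2 c m)))"

definition code_eq where
  "code_eq X t r q p1 p2 r' q' p1' p2' \<longleftrightarrow>
     (\<exists>q0\<in>free_algebra X. \<exists>p3\<in>free_algebra X. \<exists>p4\<in>free_algebra X. q0 \<noteq> 0 \<and> rel_mem X t q0 p3 p4 r r' \<and>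
       (\<forall>m\<in>range cst. \<forall>m'\<in>range cst. rel_mem X t q0 p3 p4 m m' \<longrightarrow>
          (rel_mem X t q p1 p2 m m \<longleftrightarrow> rel_mem X t q' p1' p2' m' m') \<and> (rel_mem X t q p1 p2 m m \<or> m = m') \<and>
          (rel_mem X t q p1 p2 m m \<longrightarrow>
            (\<forall>c\<in>range cst. c \<noteq> m \<and> rel_mem X t q p1 p2 c m \<longrightarrow>
               (\<exists>c'\<in>range cst. c' \<noteq> m' \<and> rel_mem X t q' p1' p2' c' m' \<and> rel_mem X t q0 p3 p4 c c')) \<and>
            (\<forall>c'\<in>range cst. c' \<noteq> m' \<and> rel_mem X t q' p1' p2' c' m' \<longrightarrow>
               (\<exists>c\<in>range cst. c \<noteq> m \<and> rel_mem X t q p1 p2 c m \<and> rel_mem X t q0 p3 p4 c c')))))"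

text \<open>A member of the second set is coded by the graph of that set with a predecessor of the
  root as new root; \<open>code_eq\<close> compares it with the code of the first set, which may use
  another graph.\<close>

definition code_mem where
  "code_mem X t r q p1 p2 r' q' p1' p2' \<longleftrightarrow> rel_mem X t q' p1' p2' r' r' \<and>
     (\<exists>c\<in>range cst. c \<noteq> r' \<and> rel_mem X t q' p1' p2' c r' \<and> code_eq X t r q p1 p2 c q' p1' p2')"

text \<open>A field element is its own name: \<open>Atom a\<close> can be decoded only from the node
  \<open>a\<close>, and only if this has no loop.\<close>

definition atom_mem where
  "atom_mem X t a r q p1 p2 \<longleftrightarrow> rel_mem X t q p1 p2 r r \<and> a \<noteq> r \<and> rel_mem X t q p1 p2 a r
     \<and> \<not> rel_mem X t q p1 p2 a a"

lemma ring_def2_code_eq: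
  "ring_def2 (free_algebra X) (free_algebra Y)
      (\<lambda>s. code_eq X (s t) (s r) (s q) (s p1) (s p2) (s r') (s q') (s p1') (s p2'))
      (\<lambda>s. code_eq Y (s t) (s r) (s q) (s p1) (s p2) (s r') (s q') (s p1') (s p2'))"
  unfolding code_eq_def by (intro ring_def2_intros ring_def2_rel_mem ring_term2_intros)

lemma ring_def2_codes:
  "ring_def2 (free_algebra X) (free_algebra Y)
      (\<lambda>s. code_valid X (s t) (s r) (s q) (s p1) (s p2)) (\<lambda>s. code_valid Y (s t) (s r) (s q) (s p1) (s p2))"
  "ring_def2 (free_algebra X) (free_algebra Y)
      (\<lambda>s. code_mem X (s t) (s r) (s q) (s p1) (s p2) (s r') (s q') (s p1') (s p2'))
      (\<lambda>s. code_mem Y (s t) (s r) (s q) (s p1) (s p2) (s r') (s q') (s p1') (s p2'))"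
  "ring_term2 f f' \<Longrightarrow> ring_def2 (free_algebra X) (free_algebra Y)
      (\<lambda>s. atom_mem X (s t) (f s) (s r) (s q) (s p1) (s p2)) (\<lambda>s. atom_mem Y (s t) (f' s) (s r) (s q) (s p1) (s p2))"
  unfolding code_valid_def code_mem_def atom_mem_def
  by (intro ring_def2_intros ring_def2_rel_mem ring_def2_code_eq ring_term2_intros; assumption?)+

definition codes_hf where
  "codes_hf X t r q p1 p2 x \<longleftrightarrow> q \<in> free_algebra X \<and> q \<noteq> 0 \<and>
     (\<exists>a. r = cst a \<and> graph_decodes (coded_rel X t q p1 p2) a x)"

context
  fixes X :: "'x set" and t :: "('x, 'k::field) ncpoly"
  assumes inf: "infinite (UNIV :: 'k set)" and t: "t \<in> free_algebra X" "t \<notin> range cst"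
begin

text \<open>A non-zero \<open>q\<close> has finitely many roots, which gives one direction;
  \<open>ex_coded_rel\<close> gives the other. Weak second-order quantification in
  \<open>code_valid\<close> and \<open>code_eq\<close> is understood through this
  equivalence.\<close>

lemma ex_finite_rel_iff:
  "(\<exists>q\<in>free_algebra X. \<exists>p1\<in>free_algebra X. \<exists>p2\<in>free_algebra X. q \<noteq> 0 \<and> P (coded_rel X t q p1 p2))
    \<longleftrightarrow> (\<exists>E. finite E \<and> P E)"
proof
  assume "\<exists>q\<in>free_algebra X. \<exists>p1\<in>free_algebra X. \<exists>p2\<in>free_algebra X. q \<noteq> 0 \<and> P (coded_rel X t q p1 p2)"
  then show "\<exists>E. finite E \<and> P E" using finite_coded_rel[OF t] by blast
next
  assume "\<exists>E. finite E \<and> P E"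
  then show "\<exists>q\<in>free_algebra X. \<exists>p1\<in>free_algebra X. \<exists>p2\<in>free_algebra X. q \<noteq> 0 \<and> P (coded_rel X t q p1 p2)"
    using ex_coded_rel[OF inf t] unfolding has_residues_def by metis
qed

lemma code_valid_iff:
  assumes "q \<in> free_algebra X"
  shows "code_valid X t r q p1 p2 \<longleftrightarrow> (\<exists>x. codes_hf X t r q p1 p2 x)"
proof -
  let ?E = "coded_rel X t q p1 p2"
  have "code_valid X t (cst a) q p1 p2 \<longleftrightarrow> (\<exists>x. graph_decodes ?E a x)" if q: "q \<noteq> 0" for a
  proof -
    let ?P = "\<lambda>E'. (a, a) \<in> E' \<and> (\<forall>m. (m, m) \<in> E' \<longrightarrow> (m, m) \<in> ?E \<and> (\<exists>c. (c, c) \<in> E' \<and> c \<noteq> m \<and> (c, m) \<in> ?E))"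
    have "code_valid X t (cst a) q p1 p2 \<longleftrightarrow> \<not> (\<exists>E'. finite E' \<and> ?P E')"
      unfolding ex_finite_rel_iff[of ?P, symmetric] by (simp add: code_valid_def q)
    \<comment> \<open>\<open>?P\<close> sees only the loops of \<open>E'\<close>, so a finite
      relation can be exchanged for the finite set of its looped nodes.\<close>
    also have "(\<exists>E'. finite E' \<and> ?P E') \<longleftrightarrow> (\<exists>M. finite M \<and> a \<in> M \<and> ill_founded ?E M)"
    proof
      assume "\<exists>E'. finite E' \<and> ?P E'"
      then obtain E' where E': "finite E'" "?P E'" by blast
      have "{m. (m, m) \<in> E'} \<subseteq> Domain E'" by auto
      then have "finite {m. (m, m) \<in> E'}" using finite_Domain[OF E'(1)] by (rule finite_subset)
      moreover have "ill_founded ?E {m. (m, m) \<in> E'}" using E'(2) by (simp add: ill_founded_def)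
      ultimately show "\<exists>M. finite M \<and> a \<in> M \<and> ill_founded ?E M" using E'(2) by blast
    next
      assume "\<exists>M. finite M \<and> a \<in> M \<and> ill_founded ?E M"
      then obtain M where "finite M" "a \<in> M" "ill_founded ?E M" by blast
      moreover from this have "finite (Id_on M)" by (simp add: Id_on_def)
      ultimately show "\<exists>E'. finite E' \<and> ?P E'"
        by (intro exI[of _ "Id_on M"]) (auto simp: ill_founded_def)
    qed
    finally show ?thesis using ex_graph_decodes_iff[OF finite_coded_rel[OF t assms q]] by simp
  qed
  moreover have "r \<in> range cst \<and> q \<noteq> 0" if "code_valid X t r q p1 p2"
    using that by (simp add: code_valid_def)
  ultimately show ?thesis unfolding codes_hf_def using assms by blast
qed

lemma ex_codes_hf:
  "\<exists>r\<in>free_algebra X. \<exists>q\<in>free_algebra X. \<exists>p1\<in>free_algebra X. \<exists>p2\<in>free_algebra X. codes_hf X t r q p1 p2 x"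
proof -
  obtain E a where E: "finite E" "graph_decodes E a x" using ex_graph_decodes[OF inf] by blast
  obtain q p1 p2 where "q \<noteq> 0" "has_residues X t q" "has_residues X t p1" "has_residues X t p2" "coded_rel X t q p1 p2 = E"
    using ex_coded_rel[OF inf t E(1)] by blast
  then have "q \<in> free_algebra X" "p1 \<in> free_algebra X" "p2 \<in> free_algebra X" "codes_hf X t (cst a) q p1 p2 x"
    using E(2) by (simp_all add: codes_hf_def has_residues_def)
  then show ?thesis using cst_in_free_algebra by blast
qed

lemma code_eq_iff:
  assumes x: "codes_hf X t r q p1 p2 x" and x': "codes_hf X t r' q' p1' p2' x'"
  shows "code_eq X t r q p1 p2 r' q' p1' p2' \<longleftrightarrow> x = x'"
proof -
  let ?E = "coded_rel X t q p1 p2" and ?E' = "coded_rel X t q' p1' p2'"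
  obtain a a' where a: "r = cst a" "graph_decodes ?E a x" and a': "r' = cst a'" "graph_decodes ?E' a' x'"
    using x x' by (auto simp: codes_hf_def)
  have fin: "finite ?E" "finite ?E'" using x x' finite_coded_rel[OF t] by (auto simp: codes_hf_def)
  have "code_eq X t r q p1 p2 r' q' p1' p2' \<longleftrightarrow> (\<exists>B. finite B \<and> (a, a') \<in> B \<and> bisimulation ?E ?E' B)"
    unfolding ex_finite_rel_iff[of "\<lambda>B. (a, a') \<in> B \<and> bisimulation ?E ?E' B", symmetric]
    by (simp add: code_eq_def bisimulation_def a(1) a'(1))
  then show ?thesis using graph_decodes_eq_iff[OF fin a(2) a'(2)] by simp
qed

lemma code_mem_iff:
  assumes x: "codes_hf X t r q p1 p2 x" and x': "codes_hf X t r' q' p1' p2' x'"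
  shows "code_mem X t r q p1 p2 r' q' p1' p2' \<longleftrightarrow> hf_mem x x'"
proof -
  let ?E' = "coded_rel X t q' p1' p2'"
  obtain a' where a': "r' = cst a'" "graph_decodes ?E' a' x'" using x' by (auto simp: codes_hf_def)
  have "code_mem X t r q p1 p2 r' q' p1' p2' \<longleftrightarrow> (a', a') \<in> ?E' \<and>
    (\<exists>c. c \<noteq> a' \<and> (c, a') \<in> ?E' \<and> code_eq X t r q p1 p2 (cst c) q' p1' p2')"
    by (simp add: code_mem_def a'(1))
  also have "\<dots> \<longleftrightarrow> hf_mem x x'"
  proof
    assume *: "(a', a') \<in> ?E' \<and> (\<exists>c. c \<noteq> a' \<and> (c, a') \<in> ?E' \<and> code_eq X t r q p1 p2 (cst c) q' p1' p2')"
    then obtain c where c: "c \<noteq> a'" "(c, a') \<in> ?E'" "code_eq X t r q p1 p2 (cst c) q' p1' p2'" by blast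
    obtain y where y: "hf_mem y x'" "graph_decodes ?E' c y"
      using graph_decodes_children(1)[OF a'(2) conjunct1[OF *] c(1,2)] by blast
    \<comment> \<open>A predecessor in the graph is coded by the same triple with another
      root.\<close>
    then have "codes_hf X t (cst c) q' p1' p2' y" using x' by (auto simp: codes_hf_def)
    then show "hf_mem x x'" using code_eq_iff[OF x] c(3) y(1) by metis
  next
    assume mem: "hf_mem x x'"
    then have "\<not> is_atom x'" by (cases x') (auto simp: is_atom_def)
    then have loop: "(a', a') \<in> ?E'" using graph_decodes_loop_iff[OF a'(2)] by simp
    obtain c where c: "c \<noteq> a'" "(c, a') \<in> ?E'" "graph_decodes ?E' c x"
      using graph_decodes_children(2)[OF a'(2) loop mem] by blast
    then have "codes_hf X t (cst c) q' p1' p2' x" using x' by (auto simp: codes_hf_def)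
    then have "code_eq X t r q p1 p2 (cst c) q' p1' p2'" using code_eq_iff[OF x] by metis
    then show "(a', a') \<in> ?E' \<and> (\<exists>c. c \<noteq> a' \<and> (c, a') \<in> ?E' \<and> code_eq X t r q p1 p2 (cst c) q' p1' p2')"
      using loop c by blast
  qed
  finally show ?thesis .
qed

lemma atom_mem_iff:
  assumes x: "codes_hf X t r q p1 p2 x"
  shows "atom_mem X t (cst a) r q p1 p2 \<longleftrightarrow> hf_mem (Atom a) x"
proof -
  let ?E = "coded_rel X t q p1 p2"
  obtain b where b: "r = cst b" "graph_decodes ?E b x" using x by (auto simp: codes_hf_def)
  have "atom_mem X t (cst a) r q p1 p2 \<longleftrightarrow> (b, b) \<in> ?E \<and> a \<noteq> b \<and> (a, b) \<in> ?E \<and> (a, a) \<notin> ?E"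
    by (simp add: atom_mem_def b(1))
  also have "\<dots> \<longleftrightarrow> hf_mem (Atom a) x"
  proof
    assume *: "(b, b) \<in> ?E \<and> a \<noteq> b \<and> (a, b) \<in> ?E \<and> (a, a) \<notin> ?E"
    then obtain y where "hf_mem y x" "graph_decodes ?E a y" using graph_decodes_children(1)[OF b(2)] by blast
    moreover have "graph_decodes ?E a (Atom a)" using * by (simp add: graph_decodes_Atom_iff)
    ultimately show "hf_mem (Atom a) x" using graph_decodes_unique by metis
  next
    assume mem: "hf_mem (Atom a) x"
    then have "\<not> is_atom x" by (cases x) (auto simp: is_atom_def)
    then have loop: "(b, b) \<in> ?E" using graph_decodes_loop_iff[OF b(2)] by simp
    then show "(b, b) \<in> ?E \<and> a \<noteq> b \<and> (a, b) \<in> ?E \<and> (a, a) \<notin> ?E"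
      using graph_decodes_children(2)[OF b(2) loop mem] by (auto simp: graph_decodes_Atom_iff)
  qed
  finally show ?thesis .
qed

end

section \<open>Translating formulas about hereditarily finite sets into ring formulas\<close>

definition pos :: "nat \<Rightarrow> nat \<Rightarrow> nat" where
  "pos k n = 2 * (5 * n + k)"

text \<open>With \<open>k\<close> from 1 to 5 the numbers \<open>5 * n + k\<close> fall into
  disjoint blocks for different \<open>n\<close>, and 0 is left for the parameter.\<close>

lemma pos_eq_iff:
  "1 \<le> k \<Longrightarrow> k \<le> 5 \<Longrightarrow> 1 \<le> l \<Longrightarrow> l \<le> 5 \<Longrightarrow> pos k m = pos l n \<longleftrightarrow> k = l \<and> m = n"
  by (cases m n rule: linorder_cases) (auto simp: pos_def)

lemma pos_neq_0: "1 \<le> k \<Longrightarrow> pos k n \<noteq> 0" "1 \<le> k \<Longrightarrow> 0 \<noteq> pos k n"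
  by (simp_all add: pos_def)

text \<open>
  The ring variable \<open>0\<close> holds the non-scalar parameter \<open>t\<close>, the variable \<open>pos 1 n\<close> the \<open>n\<close>-th field
  variable and the variables \<open>pos 2 n\<close> to \<open>pos 5 n\<close> a code of the \<open>n\<close>-th set variable.  All of them are
  even, so that infinitely many variables remain for the defining formulas.
\<close>

definition hf_env :: "'x set \<Rightarrow> nat set \<Rightarrow> nat set \<Rightarrow> (nat \<Rightarrow> ('x, 'k::field) ncpoly)
    \<Rightarrow> (nat \<Rightarrow> 'k) \<Rightarrow> (nat \<Rightarrow> 'k hf) \<Rightarrow> bool" where
  "hf_env X F S \<rho> e s \<longleftrightarrow> range \<rho> \<subseteq> free_algebra X \<and> \<rho> 0 \<notin> range cst \<and>
     (\<forall>n\<in>F. \<rho> (pos 1 n) = cst (e n)) \<and>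
     (\<forall>n\<in>S. codes_hf X (\<rho> 0) (\<rho> (pos 2 n)) (\<rho> (pos 3 n)) (\<rho> (pos 4 n)) (\<rho> (pos 5 n)) (s n))"

definition translates_hf_fm :: "'x set \<Rightarrow> 'k::field itself \<Rightarrow> hf_fm \<Rightarrow> ring_fm \<Rightarrow> bool" where
  "translates_hf_fm X K \<phi> \<psi> \<longleftrightarrow> (\<forall>e s \<rho>. hf_env X (hf_fm_field_vars \<phi>) (hf_fm_set_vars \<phi>) \<rho> e s \<longrightarrow>
     (ring_sat (free_algebra X :: ('x, 'k) ncpoly set) \<rho> \<psi> \<longleftrightarrow> hf_sat e s \<phi>))"

lemma hf_env_mono: "hf_env X F S \<rho> e s \<Longrightarrow> F' \<subseteq> F \<Longrightarrow> S' \<subseteq> S \<Longrightarrow> hf_env X F' S' \<rho> e s"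
  unfolding hf_env_def by blast

lemma translates_hf_fm_HNeg: "translates_hf_fm X K \<phi> \<psi> \<Longrightarrow> translates_hf_fm X K (HNeg \<phi>) (RNeg \<psi>)"
  by (simp add: translates_hf_fm_def)

lemma translates_hf_fm_HConj:
  fixes X :: "'x set"
  assumes "translates_hf_fm X TYPE('k::field) \<phi> \<psi>" and "translates_hf_fm X TYPE('k) \<phi>' \<psi>'"
  shows "translates_hf_fm X TYPE('k) (HConj \<phi> \<phi>') (RConj \<psi> \<psi>')"
  unfolding translates_hf_fm_def
proof (intro allI impI)
  fix e :: "nat \<Rightarrow> 'k" and s and \<rho> :: "nat \<Rightarrow> ('x, 'k) ncpoly"
  assume "hf_env X (hf_fm_field_vars (HConj \<phi> \<phi>')) (hf_fm_set_vars (HConj \<phi> \<phi>')) \<rho> e s"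
  then have "hf_env X (hf_fm_field_vars \<phi>) (hf_fm_set_vars \<phi>) \<rho> e s"
    "hf_env X (hf_fm_field_vars \<phi>') (hf_fm_set_vars \<phi>') \<rho> e s"
    by (auto elim: hf_env_mono)
  then show "ring_sat (free_algebra X) \<rho> (RConj \<psi> \<psi>') \<longleftrightarrow> hf_sat e s (HConj \<phi> \<phi>')"
    using assms by (simp add: translates_hf_fm_def)
qed

lemma translates_hf_fm_HAllField:
  fixes X :: "'x set"
  assumes tr: "translates_hf_fm X TYPE('k::field) \<phi> \<psi>"
  shows "translates_hf_fm X TYPE('k) (HAllField n \<phi>) (RAll (pos 1 n) (RImp (RConst (Suc (pos 1 n)) (pos 1 n)) \<psi>))"
    (is "translates_hf_fm _ _ _ ?\<psi>")
  unfolding translates_hf_fm_def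
proof (intro allI impI)
  fix e :: "nat \<Rightarrow> 'k" and s and \<rho> :: "nat \<Rightarrow> ('x, 'k) ncpoly"
  let ?A = "free_algebra X :: ('x, 'k) ncpoly set"
  assume env: "hf_env X (hf_fm_field_vars (HAllField n \<phi>)) (hf_fm_set_vars (HAllField n \<phi>)) \<rho> e s"
  have upd: "range (\<rho>(pos 1 n := p)) \<subseteq> ?A" if "p \<in> ?A" for p
    using env that by (auto simp: hf_env_def)
  have "hf_env X (hf_fm_field_vars \<phi>) (hf_fm_set_vars \<phi>) (\<rho>(pos 1 n := cst a)) (e(n := a)) s" for a
    using env upd[of "cst a"] by (auto simp: hf_env_def pos_eq_iff pos_neq_0)
  then have "ring_sat ?A (\<rho>(pos 1 n := cst a)) \<psi> \<longleftrightarrow> hf_sat (e(n := a)) s \<phi>" for a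
    using tr by (simp add: translates_hf_fm_def)
  moreover have "ring_sat ?A \<rho> ?\<psi> \<longleftrightarrow>
      (\<forall>p\<in>?A. p \<in> range cst \<longrightarrow> ring_sat ?A (\<rho>(pos 1 n := p)) \<psi>)"
    by simp
  moreover have "\<dots> \<longleftrightarrow> (\<forall>a. ring_sat ?A (\<rho>(pos 1 n := cst a)) \<psi>)"
    using cst_in_free_algebra by blast
  ultimately show "ring_sat ?A \<rho> ?\<psi> \<longleftrightarrow> hf_sat e s (HAllField n \<phi>)"
    by simp
qed

text \<open>Every set has a code and every valid code denotes a set; as the truth value of the body
  depends only on the denoted set, four ring quantifiers restricted to valid codes amount to one set
  quantifier.\<close>

lemma translates_hf_fm_HAllSet:
  fixes X :: "'x set"
  assumes inf: "infinite (UNIV :: 'k set)" and tr: "translates_hf_fm X TYPE('k::field) \<phi> \<psi>"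
    and \<kappa>: "\<And>\<rho> :: nat \<Rightarrow> ('x, 'k) ncpoly. range \<rho> \<subseteq> free_algebra X \<Longrightarrow>
      ring_sat (free_algebra X) \<rho> \<kappa> \<longleftrightarrow>
        code_valid X (\<rho> 0) (\<rho> (pos 2 n)) (\<rho> (pos 3 n)) (\<rho> (pos 4 n)) (\<rho> (pos 5 n))"
  shows "translates_hf_fm X TYPE('k) (HAllSet n \<phi>)
    (RAll (pos 2 n) (RAll (pos 3 n) (RAll (pos 4 n) (RAll (pos 5 n) (RImp \<kappa> \<psi>)))))"
  unfolding translates_hf_fm_def
proof (intro allI impI)
  fix e :: "nat \<Rightarrow> 'k" and s and \<rho> :: "nat \<Rightarrow> ('x, 'k) ncpoly"
  let ?A = "free_algebra X :: ('x, 'k) ncpoly set"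
  assume env: "hf_env X (hf_fm_field_vars (HAllSet n \<phi>)) (hf_fm_set_vars (HAllSet n \<phi>)) \<rho> e s"
  then have t: "\<rho> 0 \<in> ?A" "\<rho> 0 \<notin> range cst" by (auto simp: hf_env_def)
  define u where "u r q p1 p2 = \<rho>(pos 2 n := r, pos 3 n := q, pos 4 n := p1, pos 5 n := p2)" for r q p1 p2
  have u: "u r q p1 p2 0 = \<rho> 0" "u r q p1 p2 (pos 2 n) = r" "u r q p1 p2 (pos 3 n) = q"
    "u r q p1 p2 (pos 4 n) = p1" "u r q p1 p2 (pos 5 n) = p2" for r q p1 p2
    by (simp_all add: u_def pos_eq_iff pos_neq_0)
  have upd: "range (u r q p1 p2) \<subseteq> ?A" if "r \<in> ?A" "q \<in> ?A" "p1 \<in> ?A" "p2 \<in> ?A" for r q p1 p2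
    using env that by (auto simp: hf_env_def u_def)
  have sat: "ring_sat ?A (u r q p1 p2) \<psi> \<longleftrightarrow> hf_sat e (s(n := x)) \<phi>"
    if "r \<in> ?A" "q \<in> ?A" "p1 \<in> ?A" "p2 \<in> ?A" and x: "codes_hf X (\<rho> 0) r q p1 p2 x" for r q p1 p2 x
  proof -
    have "hf_env X (hf_fm_field_vars \<phi>) (hf_fm_set_vars \<phi>) (u r q p1 p2) e (s(n := x))"
      unfolding hf_env_def u(1)
    proof (intro conjI ballI)
      show "range (u r q p1 p2) \<subseteq> ?A" using upd that by blast
      show "\<rho> 0 \<notin> range cst" by (rule t)
    next
      fix m assume "m \<in> hf_fm_field_vars \<phi>"
      then show "u r q p1 p2 (pos 1 m) = cst (e m)"
        using env by (simp add: hf_env_def u_def pos_eq_iff)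
    next
      fix m assume m: "m \<in> hf_fm_set_vars \<phi>"
      show "codes_hf X (\<rho> 0) (u r q p1 p2 (pos 2 m)) (u r q p1 p2 (pos 3 m)) (u r q p1 p2 (pos 4 m))
        (u r q p1 p2 (pos 5 m)) ((s(n := x)) m)"
      proof (cases "m = n")
        case True
        then show ?thesis using x by (simp add: u)
      next
        case False
        then show ?thesis using env m by (simp add: hf_env_def u_def pos_eq_iff)
      qed
    qed
    then show ?thesis using tr by (simp add: translates_hf_fm_def)
  qed
  have "ring_sat ?A \<rho> (RAll (pos 2 n) (RAll (pos 3 n) (RAll (pos 4 n) (RAll (pos 5 n) (RImp \<kappa> \<psi>))))) \<longleftrightarrow>
    (\<forall>r\<in>?A. \<forall>q\<in>?A. \<forall>p1\<in>?A. \<forall>p2\<in>?A. ring_sat ?A (u r q p1 p2) \<kappa> \<longrightarrow> ring_sat ?A (u r q p1 p2) \<psi>)"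
    by (simp add: u_def)
  also have "\<dots> \<longleftrightarrow> (\<forall>r\<in>?A. \<forall>q\<in>?A. \<forall>p1\<in>?A. \<forall>p2\<in>?A.
      (\<exists>x. codes_hf X (\<rho> 0) r q p1 p2 x) \<longrightarrow> ring_sat ?A (u r q p1 p2) \<psi>)"
    using \<kappa>[OF upd] code_valid_iff[OF inf t] by (simp add: u)
  also have "\<dots> \<longleftrightarrow> (\<forall>x. hf_sat e (s(n := x)) \<phi>)"
    using sat ex_codes_hf[OF inf t] by meson
  finally show "ring_sat ?A \<rho> (RAll (pos 2 n) (RAll (pos 3 n) (RAll (pos 4 n) (RAll (pos 5 n) (RImp \<kappa> \<psi>)))))
      \<longleftrightarrow> hf_sat e s (HAllSet n \<phi>)"
    by simp
qed

lemma ring_term2_ring_term_val: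
  "ring_term2 (\<lambda>s. ring_term_val (\<lambda>n. s (h n)) t) (\<lambda>s. ring_term_val (\<lambda>n. s (h n)) t)"
  by (induction t) (simp_all add: ring_term2_intros)

lemma hf_env_ring_term_val:
  assumes "hf_env X F S \<rho> e s" and "ring_term_vars t \<subseteq> F"
  shows "ring_term_val (\<lambda>n. \<rho> (pos 1 n)) t = cst (ring_term_val e t)"
proof -
  have "\<rho> (pos 1 n) = cst (e n)" if "n \<in> ring_term_vars t" for n
    using assms that by (auto simp: hf_env_def)
  then show ?thesis by (induction t) (simp_all add: cst_add cst_mult)
qed

lemma ex_ring_fm:
  assumes "ring_def2 D D' P Q"
  obtains \<psi> where "\<And>e. range e \<subseteq> D \<Longrightarrow> ring_sat D e \<psi> = P (\<lambda>i. e (2 * i))"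
    and "\<And>e. range e \<subseteq> D' \<Longrightarrow> ring_sat D' e \<psi> = Q (\<lambda>i. e (2 * i))"
  using ring_def2E[OF assms infinite_odd] by blast

lemma hf_env_range: "hf_env X F S \<rho> e s \<Longrightarrow> range \<rho> \<subseteq> free_algebra X"
  by (simp add: hf_env_def)

lemma ex_translates_hf_fm_atomic:
  fixes X :: "'x set" and Y :: "'y set"
  assumes "ring_def2 (free_algebra X :: ('x, 'k1::field) ncpoly set) (free_algebra Y :: ('y, 'k2::field) ncpoly set) P Q"
    and P: "\<And>\<rho> e s. hf_env X (hf_fm_field_vars \<phi>) (hf_fm_set_vars \<phi>) \<rho> e s \<Longrightarrow> P (\<lambda>i. \<rho> (2 * i)) \<longleftrightarrow> hf_sat e s \<phi>"
    and Q: "\<And>\<rho> e s. hf_env Y (hf_fm_field_vars \<phi>) (hf_fm_set_vars \<phi>) \<rho> e s \<Longrightarrow> Q (\<lambda>i. \<rho> (2 * i)) \<longleftrightarrow> hf_sat e s \<phi>"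
  shows "\<exists>\<psi>. translates_hf_fm X TYPE('k1) \<phi> \<psi> \<and> translates_hf_fm Y TYPE('k2) \<phi> \<psi>"
proof -
  obtain \<psi> where \<psi>:
    "\<And>\<rho>. range \<rho> \<subseteq> free_algebra X \<Longrightarrow> ring_sat (free_algebra X) \<rho> \<psi> \<longleftrightarrow> P (\<lambda>i. \<rho> (2 * i))"
    "\<And>\<rho>. range \<rho> \<subseteq> free_algebra Y \<Longrightarrow> ring_sat (free_algebra Y) \<rho> \<psi> \<longleftrightarrow> Q (\<lambda>i. \<rho> (2 * i))"
    using ex_ring_fm[OF assms(1)] by blast
  have "translates_hf_fm X TYPE('k1) \<phi> \<psi>" "translates_hf_fm Y TYPE('k2) \<phi> \<psi>"
    unfolding translates_hf_fm_def using \<psi>(1)[OF hf_env_range] P \<psi>(2)[OF hf_env_range] Q by simp_all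
  then show ?thesis by blast
qed

lemma hf_env_codes_hf:
  assumes "hf_env X F S \<rho> e s" and "n \<in> S"
  shows "codes_hf X (\<rho> 0) (\<rho> (pos 2 n)) (\<rho> (pos 3 n)) (\<rho> (pos 4 n)) (\<rho> (pos 5 n)) (s n)"
    and "\<rho> 0 \<in> free_algebra X" and "\<rho> 0 \<notin> range cst"
  using assms by (auto simp: hf_env_def)

lemma ex_translates_hf_fm:
  fixes X :: "'x set" and Y :: "'y set"
  assumes inf: "infinite (UNIV :: 'k1::field set)" "infinite (UNIV :: 'k2::field set)"
  shows "\<exists>\<psi>. translates_hf_fm X TYPE('k1) \<phi> \<psi> \<and> translates_hf_fm Y TYPE('k2) \<phi> \<psi>"
proof (induction \<phi>)
  case (HFieldEq t u)
  show ?case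
  \<comment> \<open>\<open>pos k n\<close> is twice \<open>5 * n + k\<close>, and the defining
    formula reads ring variable \<open>2 * i\<close> as its \<open>i\<close>-th argument.\<close>
  proof (rule ex_translates_hf_fm_atomic[OF ring_def2_eq[OF ring_term2_ring_term_val[of "\<lambda>n. 5 * n + 1" t]
            ring_term2_ring_term_val[of "\<lambda>n. 5 * n + 1" u]]], goal_cases)
    case (1 \<rho> e s)
    from hf_env_ring_term_val[OF 1, of t] hf_env_ring_term_val[OF 1, of u] show ?case by (simp add: pos_def)
  next
    case (2 \<rho> e s)
    from hf_env_ring_term_val[OF 2, of t] hf_env_ring_term_val[OF 2, of u] show ?case by (simp add: pos_def)
  qed
next
  case (HSetEq m n)
  show ?case
  proof (rule ex_translates_hf_fm_atomic[OF ring_def2_code_eq[of _ _ 0 "5 * m + 2" "5 * m + 3" "5 * m + 4" "5 * m + 5"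
          "5 * n + 2" "5 * n + 3" "5 * n + 4" "5 * n + 5"]], goal_cases)
    case (1 \<rho> e s)
    from code_eq_iff[OF inf(1) hf_env_codes_hf(2,3,1,1)[OF 1], of m n] show ?case by (simp add: pos_def)
  next
    case (2 \<rho> e s)
    from code_eq_iff[OF inf(2) hf_env_codes_hf(2,3,1,1)[OF 2], of m n] show ?case by (simp add: pos_def)
  qed
next
  case (HMem x y)
  show ?case
  proof (cases y)
    case (FieldObj u)
    \<comment> \<open>Atoms have no members, so the translation is a false formula.\<close>
    then show ?thesis by (intro exI[of _ "RNeg (REq RZero RZero)"]) (simp add: translates_hf_fm_def)
  next
    case y: (SetObj n)
    show ?thesis
    proof (cases x)
      case x: (FieldObj u)
      show ?thesis
        unfolding x y
      proof (rule ex_translates_hf_fm_atomic[OF ring_def2_codes(3)[OF ring_term2_ring_term_val[of "\<lambda>n. 5 * n + 1" u],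
              of _ _ 0 "5 * n + 2" "5 * n + 3" "5 * n + 4" "5 * n + 5"]], goal_cases)
        case (1 \<rho> e s)
        from atom_mem_iff[OF inf(1) hf_env_codes_hf(2,3,1)[OF 1], of n] hf_env_ring_term_val[OF 1, of u]
        show ?case by (simp add: pos_def)
      next
        case (2 \<rho> e s)
        from atom_mem_iff[OF inf(2) hf_env_codes_hf(2,3,1)[OF 2], of n] hf_env_ring_term_val[OF 2, of u]
        show ?case by (simp add: pos_def)
      qed
    next
      case x: (SetObj m)
      show ?thesis
        unfolding x y
      proof (rule ex_translates_hf_fm_atomic[OF ring_def2_codes(2)[of _ _ 0 "5 * m + 2" "5 * m + 3" "5 * m + 4" "5 * m + 5"
              "5 * n + 2" "5 * n + 3" "5 * n + 4" "5 * n + 5"]], goal_cases)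
        case (1 \<rho> e s)
        from code_mem_iff[OF inf(1) hf_env_codes_hf(2,3,1,1)[OF 1], of m n] show ?case by (simp add: pos_def)
      next
        case (2 \<rho> e s)
        from code_mem_iff[OF inf(2) hf_env_codes_hf(2,3,1,1)[OF 2], of m n] show ?case by (simp add: pos_def)
      qed
    qed
  qed
next
  case (HNeg \<phi>)
  then obtain \<psi> where "translates_hf_fm X TYPE('k1) \<phi> \<psi>" "translates_hf_fm Y TYPE('k2) \<phi> \<psi>" by blast
  then show ?case by (intro exI[of _ "RNeg \<psi>"] conjI translates_hf_fm_HNeg)
next
  case (HConj \<phi> \<phi>')
  then obtain \<psi> \<psi>' where "translates_hf_fm X TYPE('k1) \<phi> \<psi>" "translates_hf_fm Y TYPE('k2) \<phi> \<psi>"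
    "translates_hf_fm X TYPE('k1) \<phi>' \<psi>'" "translates_hf_fm Y TYPE('k2) \<phi>' \<psi>'" by blast
  then show ?case by (intro exI[of _ "RConj \<psi> \<psi>'"] conjI translates_hf_fm_HConj)
next
  case (HAllField n \<phi>)
  then obtain \<psi> where "translates_hf_fm X TYPE('k1) \<phi> \<psi>" "translates_hf_fm Y TYPE('k2) \<phi> \<psi>" by blast
  then show ?case
    by (intro exI[of _ "RAll (pos 1 n) (RImp (RConst (Suc (pos 1 n)) (pos 1 n)) \<psi>)"] conjI translates_hf_fm_HAllField)
next
  case (HAllSet n \<phi>)
  then obtain \<psi> where "translates_hf_fm X TYPE('k1) \<phi> \<psi>" "translates_hf_fm Y TYPE('k2) \<phi> \<psi>" by blast
  moreover
  have "ring_def2 (free_algebra X :: ('x, 'k1) ncpoly set) (free_algebra Y :: ('y, 'k2) ncpoly set)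
      (\<lambda>s. code_valid X (s 0) (s (5 * n + 2)) (s (5 * n + 3)) (s (5 * n + 4)) (s (5 * n + 5)))
      (\<lambda>s. code_valid Y (s 0) (s (5 * n + 2)) (s (5 * n + 3)) (s (5 * n + 4)) (s (5 * n + 5)))"
    by (rule ring_def2_codes)
  then obtain \<kappa> where
    "\<And>\<rho>. range \<rho> \<subseteq> (free_algebra X :: ('x, 'k1) ncpoly set) \<Longrightarrow> ring_sat (free_algebra X) \<rho> \<kappa> \<longleftrightarrow>
       code_valid X (\<rho> (2 * 0)) (\<rho> (pos 2 n)) (\<rho> (pos 3 n)) (\<rho> (pos 4 n)) (\<rho> (pos 5 n))"
    "\<And>\<rho>. range \<rho> \<subseteq> (free_algebra Y :: ('y, 'k2) ncpoly set) \<Longrightarrow> ring_sat (free_algebra Y) \<rho> \<kappa> \<longleftrightarrow>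
       code_valid Y (\<rho> (2 * 0)) (\<rho> (pos 2 n)) (\<rho> (pos 3 n)) (\<rho> (pos 4 n)) (\<rho> (pos 5 n))"
    unfolding pos_def by (rule ex_ring_fm) blast
  ultimately show ?case unfolding mult_0_right
    by (intro exI[of _ "RAll (pos 2 n) (RAll (pos 3 n) (RAll (pos 4 n) (RAll (pos 5 n) (RImp \<kappa> \<psi>))))"] conjI
        translates_hf_fm_HAllSet inf)
qed

lemma var_not_cst: "(var x :: ('x, 'k::field) ncpoly) \<notin> range cst"
proof
  assume "(var x :: ('x, 'k) ncpoly) \<in> range cst"
  then obtain a where "(var x :: ('x, 'k) ncpoly) = cst a" by blast
  then have "coeff (var x :: ('x, 'k) ncpoly) [x] = coeff (cst a) [x]" by (rule arg_cong)
  then show False by simp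
qed

text \<open>Validity eliminates the parameter: the ring formula states \<open>\<psi>\<close> for
  every non-scalar value of variable 0. A letter of the non-empty \<open>X\<close> is such a value,
  so the statement is not vacuous.\<close>

lemma translates_hf_fm_models:
  fixes X :: "'x set"
  assumes "X \<noteq> {}" and tr: "translates_hf_fm X TYPE('k::field) \<phi> \<psi>"
    and closed: "hf_fm_field_vars \<phi> = {}" "hf_fm_set_vars \<phi> = {}"
  shows "ring_models (free_algebra X :: ('x, 'k) ncpoly set) (RDisj (RConst 1 0) \<psi>) \<longleftrightarrow> hf_models TYPE('k) \<phi>"
proof -
  let ?A = "free_algebra X :: ('x, 'k) ncpoly set"
  have *: "ring_sat ?A \<rho> (RDisj (RConst 1 0) \<psi>) \<longleftrightarrow> \<rho> 0 \<in> range cst \<or> hf_sat e s \<phi>" if "range \<rho> \<subseteq> ?A" for \<rho> and e :: "nat \<Rightarrow> 'k" and s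
  proof (cases "\<rho> 0 \<in> range cst")
    case True
    then show ?thesis by simp
  next
    case False
    then have "hf_env X {} {} \<rho> e s" using that by (simp add: hf_env_def)
    then have "ring_sat ?A \<rho> \<psi> \<longleftrightarrow> hf_sat e s \<phi>" using tr closed by (simp add: translates_hf_fm_def)
    then show ?thesis by simp
  qed
  obtain x where "x \<in> X" using assms(1) by blast
  then have x: "range (\<lambda>_. var x) \<subseteq> ?A" by (auto intro: var_in_free_algebra)
  show ?thesis
  proof
    assume "ring_models ?A (RDisj (RConst 1 0) \<psi>)"
    then have "ring_sat ?A (\<lambda>_. var x) (RDisj (RConst 1 0) \<psi>)" using x by (simp add: ring_models_def del: ring_sat_derived)
    then show "hf_models TYPE('k) \<phi>" unfolding hf_models_iff using *[OF x] var_not_cst[of x] by blast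
  next
    assume "hf_models TYPE('k) \<phi>"
    then show "ring_models ?A (RDisj (RConst 1 0) \<psi>)" unfolding hf_models_iff ring_models_def using * by blast
  qed
qed

lemma hf_elem_equiv_if_ring_elem_equiv:
  fixes X :: "'x set" and Y :: "'y set"
  assumes "infinite (UNIV :: 'k1::field set)" "infinite (UNIV :: 'k2::field set)" and "X \<noteq> {}" "Y \<noteq> {}"
    and equiv: "ring_elem_equiv (free_algebra X :: ('x, 'k1) ncpoly set) (free_algebra Y :: ('y, 'k2) ncpoly set)"
  shows "hf_elem_equiv TYPE('k1) TYPE('k2)"
  unfolding hf_elem_equiv_def
proof (intro allI impI)
  fix \<phi> assume closed: "hf_fm_field_vars \<phi> = {} \<and> hf_fm_set_vars \<phi> = {}"
  obtain \<psi> where \<psi>: "translates_hf_fm X TYPE('k1) \<phi> \<psi>" "translates_hf_fm Y TYPE('k2) \<phi> \<psi>"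
    using ex_translates_hf_fm[OF assms(1,2)] by blast
  show "hf_models TYPE('k1) \<phi> \<longleftrightarrow> hf_models TYPE('k2) \<phi>"
    using translates_hf_fm_models[OF assms(3) \<psi>(1)] translates_hf_fm_models[OF assms(4) \<psi>(2)] closed
      ring_elem_equiv_models[OF equiv, of "RDisj (RConst 1 0) \<psi>"] by blast
qed

section \<open>Infinity of the field as a property of the ring\<close>

definition no_full_product :: "'x set \<Rightarrow> 'k::field itself \<Rightarrow> bool" where
  "no_full_product X K \<longleftrightarrow> (\<forall>t\<in>free_algebra X. t \<notin> range cst \<longrightarrow> (\<forall>q\<in>free_algebra X. q \<noteq> 0 \<longrightarrow>
     (\<exists>a\<in>range (cst :: 'k \<Rightarrow> ('x, 'k) ncpoly). \<not> left_dvd (free_algebra X) (t - a) q)))"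

text \<open>Over an infinite field the finitely many roots of \<open>q\<close> leave a scalar out;
  over a finite one the product of all \<open>x - a\<close>, for a letter \<open>x\<close>, is
  non-zero and divisible by each factor.\<close>

lemma no_full_product_iff:
  fixes X :: "'x set"
  assumes "X \<noteq> {}"
  shows "no_full_product X TYPE('k::field) \<longleftrightarrow> infinite (UNIV :: 'k set)"
proof
  assume inf: "infinite (UNIV :: 'k set)"
  show "no_full_product X TYPE('k)"
    unfolding no_full_product_def
  proof (intro ballI impI)
    fix t q :: "('x, 'k) ncpoly" assume *: "t \<in> free_algebra X" "t \<notin> range cst" "q \<in> free_algebra X" "q \<noteq> 0"
    then show "\<exists>a\<in>range cst. \<not> left_dvd (free_algebra X) (t - a) q"
      using finite_roots[OF *] ex_new_if_finite[OF inf] by blast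
  qed
next
  assume no: "no_full_product X TYPE('k)"
  obtain x where "x \<in> X" using assms by blast
  then have t: "var x \<in> (free_algebra X :: ('x, 'k) ncpoly set)" by (rule var_in_free_algebra)
  show "infinite (UNIV :: 'k set)"
  proof
    assume fin: "finite (UNIV :: 'k set)"
    have "\<exists>q\<in>free_algebra X. q \<noteq> 0 \<and> (\<forall>a\<in>S. root_in X (var x) a q)" if "finite S" for S :: "'k set"
      using that
    proof induction
      case empty
      show ?case by (rule bexI[of _ 1]) (simp_all add: one_in_free_algebra)
    next
      case (insert a S)
      then obtain q where q: "q \<in> free_algebra X" "q \<noteq> 0" "\<forall>a\<in>S. root_in X (var x) a q" by blast
      have "var x - cst a \<noteq> 0" using var_not_cst[of x] by auto
      then have "(var x - cst a) * q \<noteq> 0" using q(2) by (rule deg_mult_ge(1))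
      moreover have "(var x - cst a) * q \<in> free_algebra X" by (intro free_algebra_closed t q)
      moreover have "root_in X (var x) a' ((var x - cst a) * q)" if "a' \<in> insert a S" for a'
        using that q(3) root_in_iff_mult[OF t q(1)] root_in_self[OF q(1)] by (cases "a' = a") auto
      ultimately show ?case by blast
    qed
    from this[OF fin] obtain q where "q \<in> free_algebra X" "q \<noteq> 0" "\<forall>a. root_in X (var x) (a :: 'k) q" by blast
    then show False using no t var_not_cst[of x] unfolding no_full_product_def by blast
  qed
qed

text \<open>One infinite field is given, whereas coding hereditarily finite sets uses two; the
  sentence for \<open>no_full_product\<close> carries the property across.\<close>

lemma infinite_field_if_ring_elem_equiv:
  fixes X :: "'x set" and Y :: "'y set"
  assumes "X \<noteq> {}" "Y \<noteq> {}"
    and equiv: "ring_elem_equiv (free_algebra X :: ('x, 'k1::field) ncpoly set) (free_algebra Y :: ('y, 'k2::field) ncpoly set)"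
  shows "infinite (UNIV :: 'k1 set) \<longleftrightarrow> infinite (UNIV :: 'k2 set)"
proof -
  let ?A = "free_algebra X :: ('x, 'k1) ncpoly set" and ?B = "free_algebra Y :: ('y, 'k2) ncpoly set"
  have "ring_def2 ?A ?B (\<lambda>_. no_full_product X TYPE('k1)) (\<lambda>_. no_full_product Y TYPE('k2))"
    unfolding no_full_product_def by (intro ring_def2_intros ring_term2_intros)
  then obtain \<psi> where "\<And>\<rho>. range \<rho> \<subseteq> ?A \<Longrightarrow> ring_sat ?A \<rho> \<psi> \<longleftrightarrow> no_full_product X TYPE('k1)"
    "\<And>\<rho>. range \<rho> \<subseteq> ?B \<Longrightarrow> ring_sat ?B \<rho> \<psi> \<longleftrightarrow> no_full_product Y TYPE('k2)"
    by (rule ex_ring_fm) blast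
  moreover have "range (\<lambda>_. 0) \<subseteq> ?A" "range (\<lambda>_. 0) \<subseteq> ?B" by (auto simp: zero_in_free_algebra)
  ultimately have "ring_models ?A \<psi> \<longleftrightarrow> no_full_product X TYPE('k1)" "ring_models ?B \<psi> \<longleftrightarrow> no_full_product Y TYPE('k2)"
    unfolding ring_models_def by blast+
  then show ?thesis
    using ring_elem_equiv_models[OF equiv, of \<psi>] no_full_product_iff[OF assms(1), where 'k = 'k1]
      no_full_product_iff[OF assms(2), where 'k = 'k2] by blast
qed

theorem theorem7p3:
  fixes X :: "'x set" and Y :: "'y set"
  assumes "infinite (UNIV :: 'k1::field set) \<or> infinite (UNIV :: 'k2::field set)"
    and "X \<noteq> {}" and "Y \<noteq> {}"
  shows "ring_elem_equiv (free_algebra X :: ('x, 'k1) ncpoly set)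
                         (free_algebra Y :: ('y, 'k2) ncpoly set)
    \<longleftrightarrow> ((finite X \<and> finite Y \<and> card X = card Y) \<or> (infinite X \<and> infinite Y))
        \<and> hf_elem_equiv TYPE('k1) TYPE('k2)"
proof
  assume equiv: "ring_elem_equiv (free_algebra X :: ('x, 'k1) ncpoly set) (free_algebra Y :: ('y, 'k2) ncpoly set)"
  have inf: "infinite (UNIV :: 'k1 set)" "infinite (UNIV :: 'k2 set)"
    using assms(1) infinite_field_if_ring_elem_equiv[OF assms(2,3) equiv] by simp_all
  show "((finite X \<and> finite Y \<and> card X = card Y) \<or> (infinite X \<and> infinite Y))
      \<and> hf_elem_equiv TYPE('k1) TYPE('k2)"
    using ring_elem_equiv_card[OF equiv] hf_elem_equiv_if_ring_elem_equiv[OF inf assms(2,3) equiv] ..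
next
  assume *: "((finite X \<and> finite Y \<and> card X = card Y) \<or> (infinite X \<and> infinite Y))
      \<and> hf_elem_equiv TYPE('k1) TYPE('k2)"
  then show "ring_elem_equiv (free_algebra X :: ('x, 'k1) ncpoly set) (free_algebra Y :: ('y, 'k2) ncpoly set)"
    by (intro ring_elem_equiv_if_hf_elem_equiv) (simp_all add: same_rank_def)
qed

end
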